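(* Let $\Sigma$ be $\mathbb{R}^2$ or $S^2$. The knot-type knotoid $3_1$ in $\Sigma$ is chiral, i.e. the knotoids $3_1$ and $\mathrm{mir}(3_1)$ are not equivalent.
   Context: A knotoid diagram in an oriented surface $\Sigma$ is a generic immersion of the unit interval $[0,1]$ in $\Sigma$ with over/under information at each transverse double point (crossing); the images of $0$ and $1$ are distinct and are called the head and the leg. Diagrams are oriented (here from $0$ to $1$). Two diagrams are equivalent if they are related by planar isotopy of $\Sigma$ and Reidemeister moves I, II, III performed in disks disjoint from both endpoints (so no strand may be moved over or under an endpoint). Equivalence classes are called knotoids. For a knotoid $\kappa$ with diagram $D$, its mirror $\mathrm{mir}(\kappa)$ is the knotoid represented by the diagram obtained from $D$ by switching over and under at every crossing. A knotoid is chiral if it is not equivalent to its mirror. A knotoid in $\mathbb{R}^2$ is a knot-type knotoid if it admits a diagram with both endpoints in the outer (unbounded) region; a knotoid in $S^2$ is a knot-type knotoid if it admits a diagram with both endpoints in the same region. The knotoid $3_1$ is the knot-type knotoid whose associated knot is the trefoil (with all crossings negative): it is represented by the diagram obtained from the standard 3-crossing planar diagram of the (left-handed) trefoil by deleting a small open sub-arc, containing no crossing, of an edge adjacent to the outer region, so that both endpoints lie in the outer region. *)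

theory Defs
  imports "HOL-Analysis.Analysis"
begin

section \<open>Smooth maps between subsets of Euclidean spaces\<close>

primrec Ck_on :: "nat \<Rightarrow> ('a::euclidean_space \<Rightarrow> 'b::euclidean_space) \<Rightarrow> 'a set \<Rightarrow> bool" where
  "Ck_on 0 f U \<longleftrightarrow> continuous_on U f"
| "Ck_on (Suc k) f U \<longleftrightarrow>
     (\<forall>x\<in>U. f differentiable (at x)) \<and> (\<forall>v. Ck_on k (\<lambda>x. frechet_derivative f (at x) v) U)"

text \<open>\<^const>\<open>Ck_on\<close> is meaningful on open sets only. On an arbitrary subset of a Euclidean space, a map
  is smooth if it extends locally to smooth maps on open sets.\<close>

definition smooth_on :: "'a::euclidean_space set \<Rightarrow> ('a \<Rightarrow> 'b::euclidean_space) \<Rightarrow> bool" where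
  "smooth_on A f \<longleftrightarrow>
     (\<forall>x\<in>A. \<exists>U g. open U \<and> x \<in> U \<and> (\<forall>k. Ck_on k g U) \<and> (\<forall>y\<in>U \<inter> A. g y = f y))"

definition diffeo :: "'a::euclidean_space set \<Rightarrow> 'b::euclidean_space set \<Rightarrow> ('a \<Rightarrow> 'b) \<Rightarrow> bool" where
  "diffeo A B f \<longleftrightarrow> bij_betw f A B \<and> smooth_on A f \<and> smooth_on B (inv_into A f)"

section \<open>Knotoid diagrams\<close>

text \<open>The surface is a subset \<open>S\<close> of a Euclidean space; it will be \<open>UNIV\<close> in \<open>\<real>\<^sup>2\<close> or the unit sphere
  in \<open>\<real>\<^sup>3\<close>. A diagram is a curve, used on \<open>{0..1}\<close> only and oriented from \<open>0\<close> to \<open>1\<close>, with the set of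
  those parameters at which the curve runs through a crossing as the over-strand.\<close>

datatype 'a diagram = Diagram (curve: "real \<Rightarrow> 'a") (over: "real set")

definition crossing_params :: "(real \<Rightarrow> 'a) \<Rightarrow> real set" where
  "crossing_params \<gamma> = {s\<in>{0..1}. \<exists>t\<in>{0..1}. s \<noteq> t \<and> \<gamma> s = \<gamma> t}"

abbreviation velocity :: "(real \<Rightarrow> 'a::euclidean_space) \<Rightarrow> real \<Rightarrow> 'a" where
  "velocity \<gamma> t \<equiv> vector_derivative \<gamma> (at t within {0..1})"

definition generic_immersion :: "'a::euclidean_space set \<Rightarrow> (real \<Rightarrow> 'a) \<Rightarrow> bool" where
  "generic_immersion S \<gamma> \<longleftrightarrow>
     \<gamma> ` {0..1} \<subseteq> S \<and> smooth_on {0..1} \<gamma> \<and> (\<forall>t\<in>{0..1}. velocity \<gamma> t \<noteq> 0) \<and>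
     finite (crossing_params \<gamma>) \<and> crossing_params \<gamma> \<subseteq> {0<..<1} \<and>
     (\<forall>s\<in>{0..1}. \<forall>t\<in>{0..1}. s \<noteq> t \<and> \<gamma> s = \<gamma> t \<longrightarrow>
        dim {velocity \<gamma> s, velocity \<gamma> t} = 2 \<and>
        (\<forall>u\<in>{0..1}. \<gamma> u = \<gamma> s \<longrightarrow> u = s \<or> u = t))"

definition knotoid_diagram :: "'a::euclidean_space set \<Rightarrow> 'a diagram \<Rightarrow> bool" where
  "knotoid_diagram S D \<longleftrightarrow>
     generic_immersion S (curve D) \<and> over D \<subseteq> crossing_params (curve D) \<and>
     (\<forall>s\<in>{0..1}. \<forall>t\<in>{0..1}. s \<noteq> t \<and> curve D s = curve D t \<longrightarrow> (s \<in> over D \<longleftrightarrow> t \<notin> over D))"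

definition mirror :: "'a diagram \<Rightarrow> 'a diagram" where
  "mirror D = Diagram (curve D) (crossing_params (curve D) - over D)"

section \<open>Equivalence of diagrams\<close>

definition ambient_isotopy :: "'a::euclidean_space set \<Rightarrow> (real \<Rightarrow> 'a \<Rightarrow> 'a) \<Rightarrow> bool" where
  "ambient_isotopy S H \<longleftrightarrow>
     smooth_on ({0..1} \<times> S) (\<lambda>(\<tau>, x). H \<tau> x) \<and> (\<forall>\<tau>\<in>{0..1}. diffeo S S (H \<tau>)) \<and> (\<forall>x\<in>S. H 0 x = x)"

text \<open>The disk of a Reidemeister move is \<open>\<phi> ` cball 0 1\<close> for a smooth embedding \<open>\<phi>\<close> into \<open>S\<close> of a
  neighbourhood of the closed unit disk.\<close>

definition smooth_disk :: "'a::euclidean_space set \<Rightarrow> (real^2 \<Rightarrow> 'a) \<Rightarrow> bool" where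
  "smooth_disk S \<phi> \<longleftrightarrow> (\<exists>U. open U \<and> cball 0 1 \<subseteq> U \<and> \<phi> ` U \<subseteq> S \<and> diffeo U (\<phi> ` U) \<phi>)"

text \<open>The curve meets the disk in exactly \<open>n\<close> strands, with parameter intervals \<open>{a i..b i}\<close> for
  \<open>i < n\<close> in any order. Each strand is properly embedded as far as the boundary of the disk is
  concerned, and the disk contains neither endpoint of the curve, as \<open>0 < a i\<close> and \<open>b i < 1\<close>.\<close>

definition strands_in_disk ::
  "(real^2 \<Rightarrow> 'a) \<Rightarrow> nat \<Rightarrow> (nat \<Rightarrow> real) \<Rightarrow> (nat \<Rightarrow> real) \<Rightarrow> (real \<Rightarrow> 'a) \<Rightarrow> bool" where
  "strands_in_disk \<phi> n a b \<gamma> \<longleftrightarrow>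
     (\<forall>i<n. 0 < a i \<and> a i < b i \<and> b i < 1) \<and> disjoint_family_on (\<lambda>i. {a i..b i}) {..<n} \<and>
     {t\<in>{0..1}. \<gamma> t \<in> \<phi> ` cball 0 1} = (\<Union>i<n. {a i..b i}) \<and>
     {t\<in>{0..1}. \<gamma> t \<in> \<phi> ` ball 0 1} = (\<Union>i<n. {a i<..<b i})"

definition same_outside_disk ::
  "'a::euclidean_space set \<Rightarrow> nat \<Rightarrow> (nat \<Rightarrow> real) \<Rightarrow> (nat \<Rightarrow> real) \<Rightarrow> 'a diagram \<Rightarrow> 'a diagram \<Rightarrow> bool"
where
  "same_outside_disk S n a b D E \<longleftrightarrow>
     (\<exists>\<phi>. smooth_disk S \<phi> \<and> strands_in_disk \<phi> n a b (curve D) \<and> strands_in_disk \<phi> n a b (curve E)) \<and>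
     (\<forall>t\<in>{0..1} - (\<Union>i<n. {a i<..<b i}). curve D t = curve E t \<and> (t \<in> over D \<longleftrightarrow> t \<in> over E))"

definition meetings :: "(real \<Rightarrow> 'a) \<Rightarrow> real set \<Rightarrow> real set \<Rightarrow> (real \<times> real) set" where
  "meetings \<gamma> I J = {(s, t). s \<in> I \<and> t \<in> J \<and> \<gamma> s = \<gamma> t}"

text \<open>The Reidemeister moves describe how the part of the diagram in the disk is replaced, up to a
  diffeomorphism of the disk:
  \<^item> move I: a strand without self-crossing becomes a strand with one self-crossing (of any kind);
  \<^item> move II: two disjoint simple strands become two simple strands that cross each other twice,
    strand \<open>0\<close> being the over-strand at both crossings;
  \<^item> move III: three simple strands cross pairwise exactly once, strand \<open>i\<close> over strand \<open>j\<close> for \<open>i < j\<close>,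
    before and after the move, and the order of the two crossings on each strand is reversed.

  The moves I and II decreasing the number of crossings are added by the symmetric closure below.
  In move III, \<open>p i j\<close> and \<open>q i j\<close> are the parameters on strand \<open>i\<close> of its crossing with strand \<open>j\<close>,
  before and after the move.\<close>

definition reidemeister_I :: "'a::euclidean_space set \<Rightarrow> 'a diagram \<Rightarrow> 'a diagram \<Rightarrow> bool" where
  "reidemeister_I S D E \<longleftrightarrow>
     (\<exists>a b. same_outside_disk S 1 a b D E \<and> inj_on (curve D) {a 0..b 0} \<and>
        card {(s, t) \<in> meetings (curve E) {a 0..b 0} {a 0..b 0}. s < t} = 1)"

definition reidemeister_II :: "'a::euclidean_space set \<Rightarrow> 'a diagram \<Rightarrow> 'a diagram \<Rightarrow> bool" where
  "reidemeister_II S D E \<longleftrightarrow>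
     (\<exists>a b. same_outside_disk S 2 a b D E \<and>
        (\<forall>i<2. inj_on (curve D) {a i..b i} \<and> inj_on (curve E) {a i..b i}) \<and>
        meetings (curve D) {a 0..b 0} {a 1..b 1} = {} \<and>
        card (meetings (curve E) {a 0..b 0} {a 1..b 1}) = 2 \<and>
        (\<forall>(s, t) \<in> meetings (curve E) {a 0..b 0} {a 1..b 1}. s \<in> over E))"

definition reidemeister_III :: "'a::euclidean_space set \<Rightarrow> 'a diagram \<Rightarrow> 'a diagram \<Rightarrow> bool" where
  "reidemeister_III S D E \<longleftrightarrow>
     (\<exists>a b p q. same_outside_disk S 3 a b D E \<and>
        (\<forall>i<3. inj_on (curve D) {a i..b i} \<and> inj_on (curve E) {a i..b i}) \<and>
        (\<forall>i<3. \<forall>j<3. i < j \<longrightarrow>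
           meetings (curve D) {a i..b i} {a j..b j} = {(p i j, p j i)} \<and> p i j \<in> over D \<and>
           meetings (curve E) {a i..b i} {a j..b j} = {(q i j, q j i)} \<and> q i j \<in> over E) \<and>
        (\<forall>i<3. \<forall>j<3. \<forall>k<3. distinct [i, j, k] \<longrightarrow> (p i j < p i k \<longleftrightarrow> q i k < q i j)))"

text \<open>Orientation-preserving reparametrizations are included since a diagram is regarded as an
  oriented curve in \<open>S\<close>; crossings keep their over/under information under all isotopies.\<close>

inductive elementary_move :: "'a::euclidean_space set \<Rightarrow> 'a diagram \<Rightarrow> 'a diagram \<Rightarrow> bool"
  for S D E where
  reparametrization:
    "elementary_move S D E"
    if "knotoid_diagram S D" "knotoid_diagram S E" "diffeo {0..1} {0..1} \<psi>" "\<psi> 0 = 0"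
       "\<forall>t\<in>{0..1}. curve E t = curve D (\<psi> t) \<and> (t \<in> over E \<longleftrightarrow> \<psi> t \<in> over D)"
| isotopy:
    "elementary_move S D E"
    if "knotoid_diagram S D" "knotoid_diagram S E" "ambient_isotopy S H"
       "\<forall>t\<in>{0..1}. curve E t = H 1 (curve D t)" "over E = over D"
| reidemeister:
    "elementary_move S D E"
    if "knotoid_diagram S D" "knotoid_diagram S E"
       "reidemeister_I S D E \<or> reidemeister_II S D E \<or> reidemeister_III S D E"

definition diagram_equiv :: "'a::euclidean_space set \<Rightarrow> 'a diagram \<Rightarrow> 'a diagram \<Rightarrow> bool" where
  "diagram_equiv S = equivclp (elementary_move S)"

section \<open>Knotoids, mirrors and chirality\<close>

definition knotoid :: "'a::euclidean_space set \<Rightarrow> 'a diagram \<Rightarrow> 'a diagram set" where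
  "knotoid S D = {E. diagram_equiv S D E}"

definition knotoids :: "'a::euclidean_space set \<Rightarrow> 'a diagram set set" where
  "knotoids S = {knotoid S D | D. knotoid_diagram S D}"

definition mir :: "'a::euclidean_space set \<Rightarrow> 'a diagram set \<Rightarrow> 'a diagram set" where
  "mir S \<kappa> = (\<Union>D\<in>\<kappa>. knotoid S (mirror D))"

definition chiral :: "'a::euclidean_space set \<Rightarrow> 'a diagram set \<Rightarrow> bool" where
  "chiral S \<kappa> \<longleftrightarrow> \<kappa> \<in> knotoids S \<and> mir S \<kappa> \<noteq> \<kappa>"

section \<open>The knotoid \<open>3\<^sub>1\<close>\<close>

text \<open>The closed curve \<open>\<theta> \<mapsto> (sin \<theta> + 2 sin 2\<theta>, cos \<theta> - 2 cos 2\<theta>)\<close> is the standard projection of the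
  trefoil, with three-fold symmetry. Its squared distance from the origin is \<open>5 - 4 cos 3\<theta>\<close>, so that
  \<open>\<theta> = \<pi>\<close> is the outermost point of one of the three outer edges. We delete the sub-arc
  \<open>\<bar>\<theta>\<bar> > 11\<pi>/12\<close> (modulo \<open>2\<pi>\<close>) around this point. The crossings are at
  \<open>{-\<pi>/3 - c, -\<pi>/3 + c}\<close>, \<open>{\<pi>/3 - c, \<pi>/3 + c}\<close> and \<open>{\<pi> - c, -\<pi> + c}\<close> where \<open>c = arccos (1/4)\<close>;
  the over-passages chosen below make the diagram alternating with all crossings
  negative.\<close>

definition trefoil_curve :: "real \<Rightarrow> real^2" where
  "trefoil_curve \<theta> = vector [sin \<theta> + 2 * sin (2 * \<theta>), cos \<theta> - 2 * cos (2 * \<theta>)]"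

definition trefoil_angle :: "real \<Rightarrow> real" where
  "trefoil_angle u = (2 * u - 1) * (11 * pi / 12)"

definition trefoil_over :: "real set" where
  "trefoil_over =
     {u. trefoil_angle u \<in> {- pi/3 - arccos (1/4), pi/3 - arccos (1/4), pi - arccos (1/4)}}"

definition trefoil_plane :: "(real^2) diagram" where
  "trefoil_plane = Diagram (trefoil_curve \<circ> trefoil_angle) trefoil_over"

text \<open>Inverse stereographic projection from the south pole preserves orientation if the sphere is
  oriented by its outward normal.\<close>

definition plane_to_sphere :: "real^2 \<Rightarrow> real^3" where
  "plane_to_sphere p =
     (1 / (1 + (norm p)\<^sup>2)) *\<^sub>R vector [2 * p $ 1, 2 * p $ 2, 1 - (norm p)\<^sup>2]"

definition trefoil_sphere :: "(real^3) diagram" where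
  "trefoil_sphere = Diagram (plane_to_sphere \<circ> curve trefoil_plane) (over trefoil_plane)"

end

theory Submission
  imports Defs "HOL-Complex_Analysis.Riemann_Mapping"
begin

text \<open>
  The two trefoils are told apart by their peripheral structure: in the group of a trefoil, the longitude
  is \<open>z x\<^bsup>-6\<^esup>\<close> or \<open>z\<^bsup>-1\<^esup> x\<^bsup>6\<^esup>\<close>, where \<open>x\<close> is a meridian and \<open>z\<close> is central, depending on the sign of the crossings.
  A representation that sends \<open>x\<close> to the shear \<open>(1 1; 0 1)\<close> sends \<open>z\<close> to \<open>-1\<close> (or is abelian, with trivial longitude),
  and the two longitudes become \<open>-x\<^bsup>-6\<^esup>\<close> and \<open>-x\<^bsup>6\<^esup>\<close>, which differ.

  For knotoids this is best phrased with quandle colorings of diagrams. Given a group \<open>G\<close> and an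
  element \<open>x\<close>, color a strand by \<open>g\<close> if its meridian is \<open>g\<^bsup>-1\<^esup> x g\<close>; a strand \<open>g\<close> that passes under a strand \<open>h\<close>
  becomes \<open>x\<^bsup>-\<epsilon>\<^esup> g (h\<^bsup>-1\<^esup> x\<^bsup>\<epsilon>\<^esup> h)\<close>. This is a quandle operation on \<open>G\<close>, and a coloring that starts with \<open>1\<close>
  ends with the longitude. Only the first and the last strand, those at the endpoints of the knotoid,
  are prescribed, so the set of pairs (first color, last color) is an invariant: no strand crosses an endpoint.
  For the shear in \<open>SL\<^sub>2(\<int>)\<close> the operation \<open>cross_under\<close> is explicit. The negative trefoil has a
  coloring from \<open>1\<close> to \<open>-x\<^bsup>6\<^esup>\<close>, found by hand (\<open>negative_trefoil_colors\<close>), whereas the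
  equations for its mirror image have no solution with these ends (\<open>positive_trefoil_no_colors\<close>).

  The coloring conditions refer to a diagram only through its Gauss data (\<open>gauss\<close>): which parameter passes under
  which, and with which sign. The invariance of colorability under changes of Gauss data is algebra
  (\<open>colorable_loop_add\<close>, \<open>colorable_bigon_add\<close>, \<open>colorable_triangle\<close>). What remains is to see that smooth moves change
  the Gauss data in that way. Isotopies preserve crossing signs because the oriented area spanned by the
  two velocities varies continuously and never vanishes (\<open>isotopy_crossing_sign\<close>). In the disk of a
  Reidemeister move one needs that the two crossings of move II have opposite signs, and that in move III
  signs persist and are tied to the order in which the strands meet. All of this follows from one
  topological fact: a proper arc in the disk has two sides, and a second curve changes sides at each transverse
  crossing, in the direction given by the sign (\<open>side_jump\<close>). The side is measured by the winding
  number of the arc closed up outside the disk.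
\<close>

section \<open>Winding numbers and the two sides of an arc in a disk\<close>

text \<open>The difference of the two winding numbers counts the turns of the quotient \<open>(G t - z\<^sub>1) / (G t - z\<^sub>2)\<close>.
  The quotient is real and negative exactly when \<open>G t\<close> lies between \<open>z\<^sub>2\<close> and \<open>z\<^sub>1\<close>, hence at \<open>t0\<close> only, where it goes
  from the upper to the lower half plane. Its argument therefore crosses an odd multiple of \<open>\<pi>\<close> once, upwards,
  which makes exactly one full turn.\<close>

lemma winding_number_jump:
  fixes G :: "real \<Rightarrow> complex" and y :: real
  assumes G: "path G" "pathfinish G = pathstart G" and t0: "0 < t0" "t0 < 1"
    and v: "v \<noteq> 0" and y: "0 < y"
    and meet: "\<And>t x. t \<in> {0..1} \<Longrightarrow> \<bar>x\<bar> \<le> y \<Longrightarrow> G t = G t0 + of_real x * \<i> * v \<Longrightarrow> t = t0"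
    and left: "\<forall>\<^sub>F t in at_left t0. Re ((G t - G t0) / v) < 0"
    and right: "\<forall>\<^sub>F t in at_right t0. Re ((G t - G t0) / v) > 0"
  shows "winding_number G (G t0 + of_real y * \<i> * v) - winding_number G (G t0 - of_real y * \<i> * v) = 1"
proof -
  define z1 where "z1 = G t0 + of_real y * \<i> * v"
  define z2 where "z2 = G t0 - of_real y * \<i> * v"
  have z1: "z1 \<notin> path_image G"
  proof
    assume "z1 \<in> path_image G"
    then obtain t where "t \<in> {0..1}" "G t = z1" by (auto simp: path_image_def)
    with meet[of t y] y v show False by (auto simp: z1_def)
  qed
  have z2: "z2 \<notin> path_image G"
  proof
    assume "z2 \<in> path_image G"
    then obtain t where "t \<in> {0..1}" "G t = z2" by (auto simp: path_image_def)
    with meet[of t "-y"] y v show False by (auto simp: z2_def)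
  qed
  obtain q1 where q1: "path q1" "pathfinish q1 - pathstart q1 = 2 * of_real pi * \<i> * winding_number G z1"
    "\<And>t. t \<in> {0..1} \<Longrightarrow> G t = z1 + exp (q1 t)"
    using winding_number_as_continuous_log[OF G(1) z1] by blast
  obtain q2 where q2: "path q2" "pathfinish q2 - pathstart q2 = 2 * of_real pi * \<i> * winding_number G z2"
    "\<And>t. t \<in> {0..1} \<Longrightarrow> G t = z2 + exp (q2 t)"
    using winding_number_as_continuous_log[OF G(1) z2] by blast
  define u where "u = (\<lambda>t. q1 t - q2 t)"
  define \<theta> where "\<theta> = (\<lambda>t. Im (u t))"
  have cont: "continuous_on {0..1} \<theta>"
    unfolding \<theta>_def u_def using q1(1) q2(1) by (auto simp: path_def intro!: continuous_intros)
  define Z where "Z = (\<lambda>t. (G t - G t0) / v)"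
  have GZ: "G t = G t0 + Z t * v" for t using v by (simp add: Z_def)
  have expu: "exp (u t) * (Z t + \<i> * y) = Z t - \<i> * y" if "t \<in> {0..1}" for t
  proof -
    have "exp (u t) * (G t - z2) = G t - z1"
    proof -
      have "G t - z1 = exp (q1 t)" "G t - z2 = exp (q2 t)"
        using q1(3)[OF that] q2(3)[OF that] by (metis add_diff_cancel_left')+
      then show ?thesis by (simp add: u_def exp_diff)
    qed
    then have "v * (exp (u t) * (Z t + \<i> * y)) = v * (Z t - \<i> * y)"
      unfolding z1_def z2_def by (subst (asm) (1 2) GZ) (simp add: algebra_simps)
    then show ?thesis using v by simp
  qed
  \<comment> \<open>the ratio of the two differences is a positive multiple of the complex number computed here\<close>
  have polar: "exp (u t) * of_real ((cmod (Z t + \<i> * y))\<^sup>2) =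
      Complex ((cmod (Z t))\<^sup>2 - y\<^sup>2) (- 2 * y * Re (Z t))" if "t \<in> {0..1}" for t
  proof -
    have "exp (u t) * of_real ((cmod (Z t + \<i> * y))\<^sup>2) = (exp (u t) * (Z t + \<i> * y)) * cnj (Z t + \<i> * y)"
      by (simp only: mult.assoc complex_norm_square)
    also have "\<dots> = (Z t - \<i> * y) * cnj (Z t + \<i> * y)"
      using expu[OF that] by simp
    also have "\<dots> = Complex ((cmod (Z t))\<^sup>2 - y\<^sup>2) (- 2 * y * Re (Z t))"
      by (simp add: complex_eq_iff cmod_power2) (simp add: power2_eq_square algebra_simps)
    finally show ?thesis .
  qed
  define m where "m = (\<lambda>t. exp (Re (u t)) * (cmod (Z t + \<i> * y))\<^sup>2)"
  have m: "m t > 0" if "t \<in> {0..1}" for t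
  proof -
    have "Z t + \<i> * y \<noteq> 0"
    proof
      assume "Z t + \<i> * y = 0"
      then have "Z t = of_real (- y) * \<i>" by (simp add: complex_eq_iff)
      then have "G t = G t0 + of_real (-y) * \<i> * v" using GZ[of t] by simp
      with meet[of "t" "-y"] y that have "t = t0" by simp
      with \<open>Z t = _\<close> y show False by (simp add: Z_def complex_eq_iff)
    qed
    then show ?thesis by (simp add: m_def)
  qed
  have msin: "m t * sin (\<theta> t) = - 2 * y * Re (Z t)" and mcos: "m t * cos (\<theta> t) = (cmod (Z t))\<^sup>2 - y\<^sup>2"
    if "t \<in> {0..1}" for t
    using arg_cong[OF polar[OF that], of Im] arg_cong[OF polar[OF that], of Re]
    by (simp_all add: m_def \<theta>_def Im_exp Re_exp mult_ac)
  have only: "t = t0" if t: "t \<in> {0..1}" and "sin (\<theta> t) = 0" "cos (\<theta> t) < 0" for t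
  proof -
    have "Re (Z t) = 0" using msin[OF t] that y by simp
    moreover have "(cmod (Z t))\<^sup>2 < y\<^sup>2"
      using mcos[OF t] mult_pos_neg[OF m[OF t] that(3)] by linarith
    ultimately have "Z t = of_real (Im (Z t)) * \<i>" "\<bar>Im (Z t)\<bar> \<le> y"
      using y power2_less_imp_less[of "\<bar>Im (Z t)\<bar>" y] by (auto simp: complex_eq_iff cmod_power2)
    then show ?thesis using meet[OF t, of "Im (Z t)"] GZ[of t] by (simp add: mult_ac)
  qed
  have t0': "t0 \<in> {0..1}" using t0 by auto
  have s0: "sin (\<theta> t0) = 0" using msin[OF t0'] m[OF t0'] by (simp add: Z_def)
  have c0: "cos (\<theta> t0) < 0"
  proof -
    have "m t0 * cos (\<theta> t0) < 0" using mcos[OF t0'] y by (simp add: Z_def)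
    then show ?thesis using m[OF t0'] by (simp add: mult_less_0_iff)
  qed
  have c0': "cos (\<theta> t0) = -1" using s0 c0 by (metis sin_zero_abs_cos_one abs_of_neg minus_minus)
  have sin_eq: "sin (\<theta> t) = - sin (\<theta> t - \<theta> t0)" for t
    using s0 c0' by (simp add: sin_diff)
  \<comment> \<open>\<open>\<theta>\<close> takes the values \<open>\<theta> t0 + 2 * pi * k\<close> at \<open>t0\<close> only\<close>
  have avoid: "\<theta> t \<noteq> \<theta> t0 + 2 * pi * of_int k" if "t \<in> {0..1}" "t \<noteq> t0" for t k
  proof
    assume eq: "\<theta> t = \<theta> t0 + 2 * pi * of_int k"
    then have "sin (\<theta> t) = 0" "cos (\<theta> t) < 0"
      using s0 c0 by (simp_all add: sin_add cos_add sin_int_2pin cos_int_2pin)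
    with only that show False by blast
  qed
  have isC: "(\<theta> \<longlongrightarrow> \<theta> t0) (at t0)"
    using cont t0 by (metis at_within_interior continuous_on interior_atLeastAtMost_real greaterThanLessThan_iff t0')
  have near: "\<forall>\<^sub>F t in at t0. \<bar>\<theta> t - \<theta> t0\<bar> < pi"
    using tendstoD[OF isC, of pi] by (simp add: dist_real_def)
  have in01: "\<forall>\<^sub>F t in at t0. t \<in> {0..1}"
    using eventually_at_in_open'[of "{0<..<1}" t0] t0 by (auto elim: eventually_mono)
  have lt: "\<forall>\<^sub>F t in at_left t0. t < t0" and gt: "\<forall>\<^sub>F t in at_right t0. t0 < t"
    by (simp_all add: eventually_at_filter)
  have "\<forall>\<^sub>F t in at_left t0. t < t0 \<and> t \<in> {0..1} \<and> \<theta> t < \<theta> t0 \<and> \<theta> t > \<theta> t0 - 2 * pi"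
    using left near[unfolded eventually_at_split, THEN conjunct1] in01[unfolded eventually_at_split, THEN conjunct1]
      lt
  proof eventually_elim
    case (elim t)
    have "m t * sin (\<theta> t) > 0" using msin[of t] elim y by (simp add: Z_def mult_pos_neg)
    then have "sin (\<theta> t - \<theta> t0) < 0" using m[of t] elim sin_eq[of t] by (simp add: zero_less_mult_iff mult_less_0_iff)
    then have "\<theta> t - \<theta> t0 < 0" using sin_ge_zero[of "\<theta> t - \<theta> t0"] elim by fastforce
    with elim show ?case by auto
  qed
  from eventually_happens'[OF _ this] obtain t1 where t1: "t1 < t0" "t1 \<in> {0..1}" "\<theta> t1 < \<theta> t0" "\<theta> t1 > \<theta> t0 - 2*pi"
    by auto
  have "\<forall>\<^sub>F t in at_right t0. t > t0 \<and> t \<in> {0..1} \<and> \<theta> t > \<theta> t0 \<and> \<theta> t < \<theta> t0 + 2 * pi"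
    using right near[unfolded eventually_at_split, THEN conjunct2] in01[unfolded eventually_at_split, THEN conjunct2]
      gt
  proof eventually_elim
    case (elim t)
    have "m t * sin (\<theta> t) < 0" using msin[of t] elim y by (simp add: Z_def mult_pos_pos)
    then have "sin (\<theta> t - \<theta> t0) > 0" using m[of t] elim sin_eq[of t] by (simp add: zero_less_mult_iff mult_less_0_iff)
    then have "\<theta> t - \<theta> t0 > 0" using sin_ge_zero[of "\<theta> t0 - \<theta> t"] sin_minus[of "\<theta> t - \<theta> t0"] elim by fastforce
    with elim show ?case by auto
  qed
  from eventually_happens'[OF _ this] obtain t2 where t2: "t2 > t0" "t2 \<in> {0..1}" "\<theta> t2 > \<theta> t0" "\<theta> t2 < \<theta> t0 + 2*pi"
    by auto
  have stay: "\<theta> s < c \<longleftrightarrow> \<theta> s' < c" if s: "s \<in> {0..1}" "s' \<in> {0..1}" "s \<le> s'" "t0 \<notin> {s..s'}" "c = \<theta> t0 + 2 * pi * of_int k" for s s' c k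
  proof -
    have co: "continuous_on {s..s'} \<theta>" using cont s by (auto intro: continuous_on_subset)
    have ne: "\<theta> x \<noteq> c" if "x \<in> {s..s'}" for x using avoid[of x k] s that by auto
    show ?thesis
      using IVT'[of \<theta> s c s'] IVT2'[of \<theta> s' c s] co s(3) ne by (meson atLeastAtMost_iff linorder_not_less order_less_imp_le order_refl)
  qed
  have a: "\<theta> 0 < \<theta> t0" using stay[of 0 t1 "\<theta> t0" 0] t1 by auto
  have b: "\<theta> 0 > \<theta> t0 - 2 * pi"
    using stay[of 0 t1 "\<theta> t0 - 2 * pi" "-1"] t1 avoid[of 0 "-1"] t0 by auto
  have c: "\<theta> 1 > \<theta> t0" using stay[of t2 1 "\<theta> t0" 0] avoid[of 1 0] t2 t0 by auto
  have d: "\<theta> 1 < \<theta> t0 + 2 * pi"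
    using stay[of t2 1 "\<theta> t0 + 2 * pi" "1"] t2 t0 by auto
  have "winding_number G z1 - winding_number G z2 \<in> \<int>"
    using integer_winding_number[OF G z1] integer_winding_number[OF G z2] by (rule Ints_diff)
  then obtain n where n: "winding_number G z1 - winding_number G z2 = of_int n" by (auto elim: Ints_cases)
  have "u 1 - u 0 = 2 * of_real pi * \<i> * (winding_number G z1 - winding_number G z2)"
    using q1(2) q2(2) by (simp add: u_def pathfinish_def pathstart_def algebra_simps)
  then have "\<theta> 1 - \<theta> 0 = 2 * pi * of_int n" unfolding n \<theta>_def
    by (metis (no_types, lifting) Im_complex_of_real complex_Im_of_int Re_complex_of_real minus_complex.simps(2) Im_i_times mult.assoc mult.commute of_real_mult of_real_numeral of_real_of_int_eq)
  then have "0 < 2 * pi * of_int n" "2 * pi * of_int n < 2 * pi * 2" using a b c d by linarith+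
  then have "n = 1" by (simp add: zero_less_mult_iff)
  then show ?thesis using n by (simp add: z1_def z2_def)
qed


lemma has_vector_derivative_difference_quotient:
  fixes f :: "real \<Rightarrow> 'a::real_normed_vector"
  assumes "(f has_vector_derivative D) (at x)"
  shows "((\<lambda>y. (f y - f x) /\<^sub>R (y - x)) \<longlongrightarrow> D) (at x)"
proof -
  have "((\<lambda>y. (1 / norm (y - x)) *\<^sub>R (f y - (f x + (y - x) *\<^sub>R D))) \<longlongrightarrow> 0) (at x)"
    using assms unfolding has_vector_derivative_def has_derivative_within by blast
  then have "((\<lambda>y. norm ((f y - f x) /\<^sub>R (y - x) - D)) \<longlongrightarrow> 0) (at x)"
  proof (rule Lim_transform_eventually[OF tendsto_norm_zero])
    have "norm ((1 / norm (y - x)) *\<^sub>R (f y - (f x + (y - x) *\<^sub>R D))) = norm ((f y - f x) /\<^sub>R (y - x) - D)"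
      if "y \<noteq> x" for y
    proof -
      have "(f y - f x) /\<^sub>R (y - x) - D = inverse (y - x) *\<^sub>R (f y - (f x + (y - x) *\<^sub>R D))"
        using that by (simp add: diff_diff_eq[symmetric] scaleR_diff_right[of _ "f y - f x" "(y - x) *\<^sub>R D"])
      then show ?thesis by (simp add: divide_inverse)
    qed
    then show "\<forall>\<^sub>F y in at x. norm ((1 / norm (y - x)) *\<^sub>R (f y - (f x + (y - x) *\<^sub>R D))) =
        norm ((f y - f x) /\<^sub>R (y - x) - D)"
      by (auto simp: eventually_at_filter)
  qed
  then show ?thesis by (simp add: tendsto_norm_zero_iff LIM_zero_iff)
qed

lemma eventually_at_sides:
  assumes "\<forall>\<^sub>F t in at (x::real). P t"
  shows "\<forall>\<^sub>F t in at_left x. t < x \<and> P t" "\<forall>\<^sub>F t in at_right x. x < t \<and> P t"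
  using assms by (auto simp: eventually_at_filter elim: eventually_mono)

lemma convex_cone_complex: "0 \<le> k \<Longrightarrow> convex {z. k * cmod z < Im z}"
proof (rule convexI, clarsimp)
  fix x y :: complex and u v :: real
  assume *: "0 \<le> k" "k * cmod x < Im x" "k * cmod y < Im y" "0 \<le> u" "0 \<le> v" "u + v = 1"
  have "k * cmod (u *\<^sub>R x + v *\<^sub>R y) \<le> k * (u * cmod x + v * cmod y)"
    using * norm_triangle_ineq[of "u *\<^sub>R x" "v *\<^sub>R y"] by (intro mult_left_mono) auto
  also have "\<dots> = u * (k * cmod x) + v * (k * cmod y)" by (simp add: algebra_simps)
  also have "\<dots> < u * Im x + v * Im y"
    using * by (cases "u = 0") (auto intro!: add_less_le_mono mult_left_mono mult_strict_left_mono)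
  finally show "k * cmod (u *\<^sub>R x + v *\<^sub>R y) < u * Im x + v * Im y" .
qed

text \<open>Close to the crossing the loop stays in a thin double cone around its tangent. The two complementary cones in
  a small ball are convex and free of the loop, so the winding number is constant on each of them; their
  axes form the normal segment to which \<open>winding_number_jump\<close> applies. The curve \<open>\<beta>\<close> runs from one cone to the other
  as its velocity is not tangent to the loop.\<close>

lemma winding_number_jump_crossing:
  fixes G \<beta> :: "real \<Rightarrow> complex"
  assumes G: "path G" "pathfinish G = pathstart G" and t0: "0 < t0" "t0 < 1"
    and simple: "\<And>t. t \<in> {0..1} \<Longrightarrow> G t = G t0 \<Longrightarrow> t = t0"
    and v: "(G has_vector_derivative v) (at t0)"
    and w: "(\<beta> has_vector_derivative w) (at r0)" and eq: "\<beta> r0 = G t0"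
    and pos: "Im (cnj v * w) > 0"
  shows "\<exists>k. (\<forall>\<^sub>F r in at_left r0. winding_number G (\<beta> r) = k) \<and>
             (\<forall>\<^sub>F r in at_right r0. winding_number G (\<beta> r) = k + 1)"
proof -
  define p where "p = G t0"
  have v0: "v \<noteq> 0" using pos by auto
  define om where "om = w / v"
  have Imom: "Im om > 0"
  proof -
    have "om = cnj v * w / of_real ((cmod v)\<^sup>2)"
      unfolding om_def complex_norm_square using v0 by (simp add: field_simps)
    then show ?thesis using pos v0 by (simp add: Im_divide_of_real)
  qed
  have om0: "om \<noteq> 0" using Imom by auto
  define k where "k = Im om / (2 * cmod om)"
  have k: "0 < k" "k \<le> 1 / 2"
    using Imom om0 abs_Im_le_cmod[of om] by (auto simp: k_def field_simps)
  have kom: "k * cmod om < Im om" using Imom om0 by (simp add: k_def)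
  define Z where "Z = (\<lambda>t. (G t - p) / v)"
  define \<xi> where "\<xi> = (\<lambda>r. (\<beta> r - p) / v)"
  have GZ: "G t = p + Z t * v" for t using v0 by (simp add: Z_def)
  have \<beta>\<xi>: "\<beta> r = p + \<xi> r * v" for r using v0 by (simp add: \<xi>_def)
  have "((\<lambda>t. (G t - p) /\<^sub>R (t - t0) / v) \<longlongrightarrow> v / v) (at t0)"
    unfolding p_def by (intro tendsto_intros has_vector_derivative_difference_quotient v v0)
  then have Zlim: "((\<lambda>t. Z t /\<^sub>R (t - t0)) \<longlongrightarrow> 1) (at t0)"
    using v0 by (simp add: Z_def scaleR_conv_of_real)
  have "((\<lambda>r. (\<beta> r - \<beta> r0) /\<^sub>R (r - r0) / v) \<longlongrightarrow> w / v) (at r0)"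
    by (intro tendsto_intros has_vector_derivative_difference_quotient w v0)
  then have \<xi>lim: "((\<lambda>r. \<xi> r /\<^sub>R (r - r0)) \<longlongrightarrow> om) (at r0)"
    by (simp add: \<xi>_def om_def eq p_def scaleR_conv_of_real)
  \<comment> \<open>near the crossing, the loop stays in a thin double cone around its tangent\<close>
  have "((\<lambda>t. k * cmod (Z t /\<^sub>R (t - t0)) - \<bar>Im (Z t /\<^sub>R (t - t0))\<bar>) \<longlongrightarrow> k * cmod 1 - \<bar>Im 1\<bar>) (at t0)"
    by (intro tendsto_intros Zlim)
  then have "\<forall>\<^sub>F t in at t0. k * cmod (Z t /\<^sub>R (t - t0)) - \<bar>Im (Z t /\<^sub>R (t - t0))\<bar> > 0"
    by (rule order_tendstoD) (use k in simp)
  then obtain d where d: "d > 0" and "\<And>t. t \<noteq> t0 \<Longrightarrow> dist t t0 < d \<Longrightarrow>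
      k * cmod (Z t /\<^sub>R (t - t0)) - \<bar>Im (Z t /\<^sub>R (t - t0))\<bar> > 0"
    unfolding eventually_at by blast
  then have cone: "\<bar>Im (Z t)\<bar> \<le> k * cmod (Z t)" if "dist t t0 < d" for t
  proof (cases "t = t0")
    case False
    then have "\<bar>Im (Z t)\<bar> / \<bar>t - t0\<bar> < k * cmod (Z t) / \<bar>t - t0\<bar>"
      using that \<open>\<And>t. t \<noteq> t0 \<Longrightarrow> dist t t0 < d \<Longrightarrow> _\<close>[of t]
      by (simp add: abs_mult divide_inverse mult_ac)
    then show ?thesis using False by (simp add: divide_less_cancel)
  qed (use k in \<open>simp add: Z_def p_def\<close>)
  \<comment> \<open>away from the crossing parameter, the loop keeps a distance from the crossing\<close>
  obtain \<rho> where \<rho>: "\<rho> > 0" and far: "\<And>t. t \<in> {0..1} \<Longrightarrow> cmod (Z t) < \<rho> \<Longrightarrow> dist t t0 < d"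
  proof -
    have "compact (Z ` ({0..1} - ball t0 d))"
    proof (rule compact_continuous_image)
      show "continuous_on ({0..1} - ball t0 d) Z"
        unfolding Z_def using G(1) v0 by (auto simp: path_def intro!: continuous_intros intro: continuous_on_subset)
      show "compact ({0..1} - ball t0 d)" by (intro compact_diff) auto
    qed
    moreover have "0 \<notin> Z ` ({0..1} - ball t0 d)"
    proof
      assume "0 \<in> Z ` ({0..1} - ball t0 d)"
      then obtain t where "t \<in> {0..1}" "t \<notin> ball t0 d" "G t = p" using v0 by (auto simp: Z_def)
      with simple[of t] d show False by (auto simp: p_def)
    qed
    ultimately obtain \<rho> where "\<rho> > 0" "\<And>z. z \<in> Z ` ({0..1} - ball t0 d) \<Longrightarrow> \<rho> \<le> dist 0 z"
      using separate_point_closed[of _ 0] compact_imp_closed by metis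
    then show ?thesis by (intro that[of \<rho>]) (force simp: dist_commute)+
  qed
  define L where "L = ball 0 \<rho> \<inter> {z. k * cmod z < Im z}"
  define R where "R = uminus ` L"
  have convL: "convex L" unfolding L_def using k by (intro convex_Int convex_cone_complex) auto
  have convR: "convex R" unfolding R_def using convL by (rule convex_negations)
  have notL: "Z t \<notin> L" if "t \<in> {0..1}" for t
    using far[OF that] cone[of t] by (auto simp: L_def)
  have notR: "Z t \<notin> R" if "t \<in> {0..1}" for t
    using far[OF that] cone[of t] by (auto simp: L_def R_def)
  have const: "\<exists>c. \<forall>z\<in>C. winding_number G (p + z * v) = c"
    if "convex C" "\<And>t. t \<in> {0..1} \<Longrightarrow> Z t \<notin> C" for C
  proof -
    have "winding_number G constant_on ((\<lambda>z. p + z * v) ` C)"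
    proof (rule winding_number_constant[OF G])
      show "connected ((\<lambda>z. p + z * v) ` C)"
        using that(1) by (intro connected_continuous_image convex_connected continuous_intros)
      show "(\<lambda>z. p + z * v) ` C \<inter> path_image G = {}"
        using that(2) v0 GZ by (auto simp: path_image_def)
    qed
    then show ?thesis by (auto simp: constant_on_def)
  qed
  obtain cL where cL: "\<And>z. z \<in> L \<Longrightarrow> winding_number G (p + z * v) = cL"
    using const[OF convL notL] by blast
  obtain cR where cR: "\<And>z. z \<in> R \<Longrightarrow> winding_number G (p + z * v) = cR"
    using const[OF convR notR] by blast
  have "winding_number G (G t0 + of_real (\<rho> / 2) * \<i> * v) - winding_number G (G t0 - of_real (\<rho> / 2) * \<i> * v) = 1"
  proof (rule winding_number_jump[OF G t0 v0])
    show "0 < \<rho> / 2" using \<rho> by simp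
    fix t x assume t: "t \<in> {0..1}" and x: "\<bar>x\<bar> \<le> \<rho> / 2" and "G t = G t0 + of_real x * \<i> * v"
    then have Z: "Z t = of_real x * \<i>" using v0 by (simp add: Z_def p_def)
    then have "dist t t0 < d" using far[OF t] x \<rho> by (simp add: norm_mult)
    from cone[OF this] have "\<bar>x\<bar> \<le> k * \<bar>x\<bar>" by (simp add: Z norm_mult)
    also have "\<dots> \<le> 1 / 2 * \<bar>x\<bar>" using k by (intro mult_right_mono) auto
    finally have "x = 0" by simp
    then show "t = t0" using simple[OF t] GZ[of t] Z by (simp add: p_def)
  next
    have "((\<lambda>t. Re (Z t /\<^sub>R (t - t0))) \<longlongrightarrow> Re 1) (at t0)" by (intro tendsto_intros Zlim)
    then have *: "\<forall>\<^sub>F t in at t0. Re (Z t /\<^sub>R (t - t0)) > 0" by (rule order_tendstoD) simp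
    have "\<forall>\<^sub>F t in at_left t0. Re (Z t) < 0" "\<forall>\<^sub>F t in at_right t0. 0 < Re (Z t)"
      using eventually_at_sides[OF *] by (auto elim!: eventually_mono simp: zero_less_mult_iff)
    then show "\<forall>\<^sub>F t in at_left t0. Re ((G t - G t0) / v) < 0" "\<forall>\<^sub>F t in at_right t0. 0 < Re ((G t - G t0) / v)"
      by (simp_all add: Z_def p_def)
  qed
  moreover have "of_real (\<rho> / 2) * \<i> \<in> L" using \<rho> k by (auto simp: L_def norm_mult)
  moreover from this have "- (of_real (\<rho> / 2) * \<i>) \<in> R" unfolding R_def by (rule imageI)
  ultimately have cc: "cL = cR + 1" using cL cR by (force simp: p_def algebra_simps)
  have "((\<lambda>r. Im (\<xi> r /\<^sub>R (r - r0)) - k * cmod (\<xi> r /\<^sub>R (r - r0))) \<longlongrightarrow> Im om - k * cmod om) (at r0)"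
    by (intro tendsto_intros \<xi>lim)
  then have E1: "\<forall>\<^sub>F r in at r0. Im (\<xi> r /\<^sub>R (r - r0)) - k * cmod (\<xi> r /\<^sub>R (r - r0)) > 0"
    by (rule order_tendstoD) (use kom in simp)
  have "((\<lambda>r. (r - r0) *\<^sub>R (\<xi> r /\<^sub>R (r - r0))) \<longlongrightarrow> (r0 - r0) *\<^sub>R om) (at r0)"
    by (intro tendsto_intros \<xi>lim)
  then have E2: "\<forall>\<^sub>F r in at r0. dist ((r - r0) *\<^sub>R (\<xi> r /\<^sub>R (r - r0))) 0 < \<rho>"
    using \<rho> by (intro tendstoD) auto
  have "\<forall>\<^sub>F r in at r0. r \<noteq> r0" by (simp add: eventually_at_filter)
  with E1 E2 have E: "\<forall>\<^sub>F r in at r0. (r > r0 \<longrightarrow> \<xi> r \<in> L) \<and> (r < r0 \<longrightarrow> \<xi> r \<in> R)"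
  proof eventually_elim
    case (elim r)
    define q where "q = \<xi> r /\<^sub>R (r - r0)"
    have q: "\<xi> r = (r - r0) *\<^sub>R q" using elim by (simp add: q_def)
    have 1: "Im q > k * cmod q" and 2: "cmod (\<xi> r) < \<rho>" using elim by (simp_all add: q_def)
    show ?case
    proof safe
      assume "r > r0"
      then have "Im (\<xi> r) > k * cmod (\<xi> r)" unfolding q using 1 mult_strict_left_mono[of "k * cmod q" "Im q" "r - r0"]
        by (simp add: mult_ac)
      then show "\<xi> r \<in> L" using 2 by (simp add: L_def)
    next
      assume "r < r0"
      then have "cmod (- \<xi> r) = (r0 - r) * cmod q"
        unfolding q norm_minus_cancel norm_scaleR by simp
      moreover have "Im (- \<xi> r) = (r0 - r) * Im q"
        unfolding q by (simp add: algebra_simps)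
      ultimately have "Im (- \<xi> r) > k * cmod (- \<xi> r)"
        using 1 \<open>r < r0\<close> mult_strict_left_mono[of "k * cmod q" "Im q" "r0 - r"] by (simp add: mult_ac)
      then have "- \<xi> r \<in> L" using 2 by (simp add: L_def)
      then show "\<xi> r \<in> R" unfolding R_def by force
    qed
  qed
  have "\<forall>\<^sub>F r in at_left r0. \<xi> r \<in> R" "\<forall>\<^sub>F r in at_right r0. \<xi> r \<in> L"
    using eventually_at_sides[OF E] by (auto elim!: eventually_mono)
  then show ?thesis
    using cL cR cc by (intro exI[of _ cR]) (auto simp: \<beta>\<xi> elim!: eventually_mono)
qed


definition proper_arc :: "real \<Rightarrow> real \<Rightarrow> (real \<Rightarrow> complex) \<Rightarrow> bool" where
  "proper_arc a b f \<longleftrightarrow> a < b \<and> continuous_on {a..b} f \<and> inj_on f {a..b} \<and>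
     cmod (f a) = 1 \<and> cmod (f b) = 1 \<and> (\<forall>t\<in>{a<..<b}. cmod (f t) < 1)"

lemma proper_arc_cball: "proper_arc a b f \<Longrightarrow> t \<in> {a..b} \<Longrightarrow> cmod (f t) \<le> 1"
  by (cases "t = a \<or> t = b") (auto simp: proper_arc_def less_imp_le)

text \<open>The closed disk stays convex when the two boundary points are removed, so the complement of what is left
  is path connected.\<close>

lemma arc_outside_unit_disk:
  assumes "cmod A = 1" "cmod B = 1" "A \<noteq> B"
  obtains \<delta> where "arc \<delta>" "pathstart \<delta> = A" "pathfinish \<delta> = B" "path_image \<delta> \<inter> cball 0 1 \<subseteq> {A, B}"
proof -
  have "convex (cball 0 1 - {A, B})"
  proof -
    have seg: "cmod (u *\<^sub>R x + v *\<^sub>R y) < 1"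
      if "cmod x \<le> 1" "cmod y \<le> 1" "0 < u" "0 < v" "u + v = 1" "x \<noteq> y" for x y :: complex and u v :: real
    proof -
      have "u *\<^sub>R x + v *\<^sub>R y \<in> open_segment x y"
        using that by (auto simp: in_segment intro!: exI[of _ v] simp: algebra_simps) (metis add.commute add_diff_cancel_left' diff_add_eq scaleR_left_diff_distrib scaleR_one)
      then have "dist 0 (u *\<^sub>R x + v *\<^sub>R y) < dist 0 x \<or> dist 0 (u *\<^sub>R x + v *\<^sub>R y) < dist 0 y"
        by (rule dist_decreases_open_segment)
      with that show ?thesis by auto
    qed
    show ?thesis
    proof (rule convexI)
      fix x y :: complex and u v :: real
      assume *: "x \<in> cball 0 1 - {A, B}" "y \<in> cball 0 1 - {A, B}" "0 \<le> u" "0 \<le> v" "u + v = 1"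
      consider "u = 0" | "v = 0" | "x = y" | "0 < u" "0 < v" "x \<noteq> y" using * by fastforce
      then show "u *\<^sub>R x + v *\<^sub>R y \<in> cball 0 1 - {A, B}"
      proof cases
        case 3 then show ?thesis using * by (simp flip: scaleR_left_distrib)
      next
        case 4 then show ?thesis using seg[of x y u v] * assms by auto
      qed (use * in auto)
    qed
  qed
  moreover have "bounded (cball (0::complex) 1 - {A, B})" by (rule bounded_subset[OF bounded_cball]) auto
  ultimately have "path_connected (- (cball 0 1 - {A, B}))"
    by (intro path_connected_complement_bounded_convex) auto
  with assms show ?thesis
    unfolding path_connected_arcwise by (elim ballE[of _ _ A] ballE[of _ _ B]) (auto intro!: that)
qed

definition on_unit :: "real \<Rightarrow> real \<Rightarrow> (real \<Rightarrow> complex) \<Rightarrow> real \<Rightarrow> complex" where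
  "on_unit a b f = (\<lambda>t. f (a + t * (b - a)))"

lemma on_unit_image: "(a::real) < b \<Longrightarrow> (\<lambda>t. a + t * (b - a)) ` {0..1} = {a..b}"
  using image_affinity_atLeastAtMost[of "b - a" a 0 1] by (simp add: mult.commute add.commute)

lemma arc_on_unit:
  assumes "proper_arc a b f"
  shows "arc (on_unit a b f)" "path_image (on_unit a b f) = f ` {a..b}"
    "pathstart (on_unit a b f) = f a" "pathfinish (on_unit a b f) = f b"
proof -
  have ab: "a < b" using assms by (simp add: proper_arc_def)
  have "continuous_on {0..1} (f \<circ> (\<lambda>t. a + t * (b - a)))"
    by (rule continuous_on_compose)
       (use assms on_unit_image[OF ab] in \<open>auto intro!: continuous_intros simp: proper_arc_def\<close>)
  moreover have "inj_on (f \<circ> (\<lambda>t. a + t * (b - a))) {0..1}"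
    by (rule comp_inj_on) (use assms on_unit_image[OF ab] ab in \<open>auto simp: proper_arc_def inj_on_def\<close>)
  ultimately show "arc (on_unit a b f)" by (simp add: arc_def path_def on_unit_def comp_def)
  show "path_image (on_unit a b f) = f ` {a..b}"
    unfolding path_image_def on_unit_def image_image[symmetric, of f "\<lambda>t. a + t * (b - a)"] on_unit_image[OF ab] ..
qed (simp_all add: pathstart_def pathfinish_def on_unit_def)

text \<open>The outer arc is chosen for its endpoints, independently of the arc that it closes up: two arcs with
  common endpoints are closed up in the same way, which is what makes their sides comparable.\<close>

definition outer_arc :: "complex \<Rightarrow> complex \<Rightarrow> real \<Rightarrow> complex" where
  "outer_arc A B = (SOME \<delta>. arc \<delta> \<and> pathstart \<delta> = A \<and> pathfinish \<delta> = B \<and> path_image \<delta> \<inter> cball 0 1 \<subseteq> {A, B})"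

definition closed_up :: "real \<Rightarrow> real \<Rightarrow> (real \<Rightarrow> complex) \<Rightarrow> real \<Rightarrow> complex" where
  "closed_up a b f = on_unit a b f +++ outer_arc (f b) (f a)"

definition side :: "real \<Rightarrow> real \<Rightarrow> (real \<Rightarrow> complex) \<Rightarrow> complex \<Rightarrow> real" where
  "side a b f z = Re (winding_number (closed_up a b f) z)"

lemma proper_arc_endpoint: "proper_arc a b f \<Longrightarrow> t \<in> {a..b} \<Longrightarrow> cmod (f t) = 1 \<Longrightarrow> t = a \<or> t = b"
  unfolding proper_arc_def by (metis atLeastAtMost_iff greaterThanLessThan_iff less_eq_real_def less_irrefl)

lemma proper_arc_ends_distinct: "proper_arc a b f \<Longrightarrow> f a \<noteq> f b"
  by (force simp: proper_arc_def inj_on_def)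

lemma outer_arc:
  assumes f: "proper_arc a b f"
  shows "arc (outer_arc (f b) (f a))" "pathstart (outer_arc (f b) (f a)) = f b"
    "pathfinish (outer_arc (f b) (f a)) = f a" "path_image (outer_arc (f b) (f a)) \<inter> cball 0 1 \<subseteq> {f b, f a}"
proof -
  have "\<exists>\<delta>. arc \<delta> \<and> pathstart \<delta> = f b \<and> pathfinish \<delta> = f a \<and> path_image \<delta> \<inter> cball 0 1 \<subseteq> {f b, f a}"
    using arc_outside_unit_disk[of "f b" "f a"] f proper_arc_ends_distinct[OF f] by (metis proper_arc_def)
  from someI_ex[OF this] show "arc (outer_arc (f b) (f a))" "pathstart (outer_arc (f b) (f a)) = f b"
    "pathfinish (outer_arc (f b) (f a)) = f a" "path_image (outer_arc (f b) (f a)) \<inter> cball 0 1 \<subseteq> {f b, f a}"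
    unfolding outer_arc_def by blast+
qed

lemma
  assumes f: "proper_arc a b f"
  shows path_closed_up: "path (closed_up a b f)"
    and loop_closed_up: "pathfinish (closed_up a b f) = pathstart (closed_up a b f)"
    and simple_closed_up: "simple_path (closed_up a b f)"
    and notin_closed_up: "\<And>z. cmod z \<le> 1 \<Longrightarrow> z \<notin> f ` {a..b} \<Longrightarrow> z \<notin> path_image (closed_up a b f)"
proof -
  note au = arc_on_unit[OF f] and \<delta> = outer_arc[OF f]
  have im: "path_image (closed_up a b f) = f ` {a..b} \<union> path_image (outer_arc (f b) (f a))"
    unfolding closed_up_def using au \<delta> by (subst path_image_join) auto
  show "pathfinish (closed_up a b f) = pathstart (closed_up a b f)"
    unfolding closed_up_def using au \<delta> by simp
  have "f ` {a..b} \<inter> path_image (outer_arc (f b) (f a)) \<subseteq> {f a, f b}"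
    using \<delta>(4) proper_arc_cball[OF f] by auto
  then show simple: "simple_path (closed_up a b f)"
    unfolding closed_up_def using au \<delta> by (intro simple_path_join_loop) auto
  then show "path (closed_up a b f)" by (rule simple_path_imp_path)
  show "z \<notin> path_image (closed_up a b f)" if "cmod z \<le> 1" "z \<notin> f ` {a..b}" for z
  proof
    assume "z \<in> path_image (closed_up a b f)"
    then have "z \<in> {f b, f a}" using that im \<delta>(4) by auto
    then show False using that f by (auto simp: proper_arc_def)
  qed
qed

text \<open>This is the Jordan curve theorem with winding numbers: the closed-up arc winds around all inner points once, in the
  same direction, and not at all around outer points.\<close>

lemma side_two_values:
  assumes f: "proper_arc a b f"
  obtains k where "\<And>z. cmod z \<le> 1 \<Longrightarrow> z \<notin> f ` {a..b} \<Longrightarrow> side a b f z = k \<or> side a b f z = k + 1"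
proof -
  have out: "winding_number (closed_up a b f) z = 0" if "z \<in> outside (path_image (closed_up a b f))" for z
    using winding_number_zero_in_outside[OF path_closed_up[OF f] loop_closed_up[OF f] that] .
  have io: "z \<in> inside (path_image (closed_up a b f)) \<or> z \<in> outside (path_image (closed_up a b f))"
    if "cmod z \<le> 1" "z \<notin> f ` {a..b}" for z
    using notin_closed_up[OF f that] inside_Un_outside by blast
  from simple_closed_path_winding_number_inside[OF simple_closed_up[OF f]] show ?thesis
  proof cases
    case 1 then show ?thesis using out io by (intro that[of 0]) (force simp: side_def)
  next
    case 2 then show ?thesis using out io by (intro that[of "-1"]) (force simp: side_def)
  qed
qed

lemma side_constant:
  assumes f: "proper_arc a b f" and "x \<le> y" and "continuous_on {x..y} \<beta>"
    and "\<And>t. t \<in> {x..y} \<Longrightarrow> cmod (\<beta> t) \<le> 1 \<and> \<beta> t \<notin> f ` {a..b}"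
  shows "side a b f (\<beta> x) = side a b f (\<beta> (y::real))"
proof -
  have "winding_number (closed_up a b f) constant_on \<beta> ` {x..y}"
    using assms notin_closed_up[OF f]
    by (intro winding_number_constant path_closed_up[OF f] loop_closed_up[OF f] connected_continuous_image) (auto simp: connected_Icc)
  then show ?thesis using \<open>x \<le> y\<close> by (auto simp: constant_on_def side_def)
qed

lemma side_jump_positive:
  assumes f: "proper_arc a b f" and cont: "continuous_on {x..y} \<beta>"
    and \<beta>: "\<And>t. t \<in> {x..y} \<Longrightarrow> cmod (\<beta> t) \<le> 1" and s: "s \<in> {a<..<b}" and r: "r \<in> {x<..<y}" and eq: "f s = \<beta> r"
    and only: "\<And>t. t \<in> {x..y} \<Longrightarrow> \<beta> t \<in> f ` {a..b} \<Longrightarrow> t = r"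
    and v: "(f has_vector_derivative v) (at s)" and w: "(\<beta> has_vector_derivative w) (at r)"
    and pos: "Im (cnj v * w) > 0"
  shows "side a b f (\<beta> y) - side a b f (\<beta> x) = 1"
proof -
  have ab: "a < b" and fs: "cmod (f s) < 1" using f(1) s by (auto simp: proper_arc_def)
  define q where "q = (s - a) / (b - a)"
  define t0 where "t0 = q / 2"
  have t0: "0 < t0" "t0 < 1 / 2" using s ab by (auto simp: t0_def q_def field_simps)
  have "2 * t0 = q" by (simp add: t0_def)
  then have at0: "a + 2 * t0 * (b - a) = s" using ab by (simp add: q_def)
  have G1: "closed_up a b f t = f (a + 2 * t * (b - a))" if "t \<le> 1/2" for t
    using that by (simp add: closed_up_def joinpaths_def on_unit_def)
  have Gt0: "closed_up a b f t0 = f s" using G1[of t0] t0 at0 by simp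
  have "(f \<circ> (\<lambda>t. a + 2 * t * (b - a)) has_vector_derivative (2 * (b - a)) *\<^sub>R v) (at t0)"
    by (rule vector_diff_chain_at) (use v at0 in \<open>auto intro!: derivative_eq_intros\<close>)
  then have deriv: "(closed_up a b f has_vector_derivative (2 * (b - a)) *\<^sub>R v) (at t0)"
    by (rule has_vector_derivative_transform_within_open[of _ _ _ "{..<1/2}"]) (use t0 G1 in auto)
  have "\<exists>k. (\<forall>\<^sub>F q in at_left r. winding_number (closed_up a b f) (\<beta> q) = k) \<and>
           (\<forall>\<^sub>F q in at_right r. winding_number (closed_up a b f) (\<beta> q) = k + 1)"
  proof (rule winding_number_jump_crossing[OF path_closed_up[OF f] loop_closed_up[OF f]])
    show "0 < t0" "t0 < 1" using t0 by auto
    show "(closed_up a b f has_vector_derivative (2 * (b - a)) *\<^sub>R v) (at t0)" by (rule deriv)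
    show "(\<beta> has_vector_derivative w) (at r)" by (rule w)
    show "\<beta> r = closed_up a b f t0" using eq Gt0 by simp
    show "0 < Im (cnj ((2 * (b - a)) *\<^sub>R v) * w)"
    proof -
      have "Im (cnj ((2 * (b - a)) *\<^sub>R v) * w) = 2 * (b - a) * Im (cnj v * w)" by (simp add: algebra_simps)
      then show ?thesis using pos ab by simp
    qed
    fix t assume "t \<in> {0..1}" "closed_up a b f t = closed_up a b f t0"
    moreover have "t0 \<in> {0..1}" using t0 by auto
    ultimately have "t = t0 \<or> t = 0 \<and> t0 = 1 \<or> t = 1 \<and> t0 = 0"
      using simple_closed_up[OF f] unfolding simple_path_def loop_free_def by blast
    then show "t = t0" using t0 by auto
  qed
  then obtain k where "\<forall>\<^sub>F q in at_left r. winding_number (closed_up a b f) (\<beta> q) = k"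
    "\<forall>\<^sub>F q in at_right r. winding_number (closed_up a b f) (\<beta> q) = k + 1" by blast
  moreover have "\<forall>\<^sub>F q in at_left r. q \<in> {x<..<r}" "\<forall>\<^sub>F q in at_right r. q \<in> {r<..<y}"
    using r by (auto intro: eventually_at_leftI eventually_at_rightI)
  ultimately have "\<forall>\<^sub>F q in at_left r. winding_number (closed_up a b f) (\<beta> q) = k \<and> q \<in> {x<..<r}"
    "\<forall>\<^sub>F q in at_right r. winding_number (closed_up a b f) (\<beta> q) = k + 1 \<and> q \<in> {r<..<y}"
    by (auto elim: eventually_elim2)
  from this[THEN eventually_happens'[rotated]] obtain q1 q2 where
    q: "winding_number (closed_up a b f) (\<beta> q1) = k" "q1 \<in> {x<..<r}"
      "winding_number (closed_up a b f) (\<beta> q2) = k + 1" "q2 \<in> {r<..<y}" by auto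
  have "side a b f (\<beta> x) = side a b f (\<beta> q1)"
  proof (rule side_constant[OF f])
    show "continuous_on {x..q1} \<beta>" using q r by (intro continuous_on_subset[OF cont]) auto
    show "cmod (\<beta> t) \<le> 1 \<and> \<beta> t \<notin> f ` {a..b}" if "t \<in> {x..q1}" for t
      using that q r \<beta>[of t] only[of t] by force
  qed (use q in auto)
  moreover have "side a b f (\<beta> q2) = side a b f (\<beta> y)"
  proof (rule side_constant[OF f])
    show "continuous_on {q2..y} \<beta>" using q r by (intro continuous_on_subset[OF cont]) auto
    show "cmod (\<beta> t) \<le> 1 \<and> \<beta> t \<notin> f ` {a..b}" if "t \<in> {q2..y}" for t
      using that q r \<beta>[of t] only[of t] by force
  qed (use q in auto)
  ultimately show ?thesis using q by (simp add: side_def)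
qed

lemma side_jump:
  assumes f: "proper_arc a b f" and cont: "continuous_on {x..y} \<beta>"
    and \<beta>: "\<And>t. t \<in> {x..y} \<Longrightarrow> cmod (\<beta> t) \<le> 1" and s: "s \<in> {a<..<b}" and r: "r \<in> {x<..<y}" and eq: "f s = \<beta> r"
    and only: "\<And>t. t \<in> {x..y} \<Longrightarrow> \<beta> t \<in> f ` {a..b} \<Longrightarrow> t = r"
    and v: "(f has_vector_derivative v) (at s)" and w: "(\<beta> has_vector_derivative w) (at r)"
    and nz: "Im (cnj v * w) \<noteq> 0"
  shows "side a b f (\<beta> y) - side a b f (\<beta> x) = sgn (Im (cnj v * w))"
  proof (cases "Im (cnj v * w) > 0")
    case True then show ?thesis using side_jump_positive[OF f cont \<beta> s r eq only v w] by simp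
  next
    case False
    \<comment> \<open>traversing \<open>\<beta>\<close> backwards reduces this case to the other one\<close>
    have "side a b f ((\<beta> \<circ> uminus) (- x)) - side a b f ((\<beta> \<circ> uminus) (- y)) = 1"
    proof (rule side_jump_positive[OF f _ _ s _ _ _ v])
      have "continuous_on (uminus ` {-y..-x}) \<beta>" using cont by simp
      then show "continuous_on {- y..- x} (\<beta> \<circ> uminus)" by (intro continuous_on_compose continuous_intros)
      show "- r \<in> {- y<..<- x}" using r by auto
      show "f s = (\<beta> \<circ> uminus) (- r)" using eq by simp
      show "cmod ((\<beta> \<circ> uminus) t) \<le> 1" if "t \<in> {- y..- x}" for t using that \<beta>[of "- t"] by auto
      show "t = - r" if "t \<in> {- y..- x}" "(\<beta> \<circ> uminus) t \<in> f ` {a..b}" for t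
        using that only[of "- t"] by auto
      show "(\<beta> \<circ> uminus has_vector_derivative - 1 *\<^sub>R w) (at (- r))"
        by (rule vector_diff_chain_at) (use w in \<open>auto intro!: derivative_eq_intros\<close>)
      show "0 < Im (cnj v * (- 1 *\<^sub>R w))" using False nz by simp
    qed
    then show ?thesis using False nz by simp
  qed

text \<open>The straight-line homotopy between the two arcs stays in the open disk except at the common endpoints,
  so it never passes through \<open>P\<close>.\<close>

lemma side_boundary:
  assumes f: "proper_arc a b f" and g: "proper_arc a b g" and fg: "g a = f a" "g b = f b"
    and P: "cmod P = 1" "P \<noteq> f a" "P \<noteq> f b"
  shows "side a b g P = side a b f P"
proof -
  have notin: "P \<notin> path_image (on_unit a b h)" if h: "proper_arc a b h" "h a = f a" "h b = f b" for h
  proof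
    assume "P \<in> path_image (on_unit a b h)"
    then obtain t where t: "t \<in> {a..b}" "P = h t" using arc_on_unit[OF h(1)] by auto
    then have "t \<noteq> a" "t \<noteq> b" using h P by auto
    then have "cmod (h t) < 1" using t h(1) by (auto simp: proper_arc_def)
    with t P show False by simp
  qed
  have Pd: "P \<notin> path_image (outer_arc (f b) (f a))" using P outer_arc(4)[OF f] by auto
  have wj: "winding_number (closed_up a b h) P = winding_number (on_unit a b h) P + winding_number (outer_arc (f b) (f a)) P"
    if h: "proper_arc a b h" "h a = f a" "h b = f b" for h
    unfolding closed_up_def h(2,3) using arc_on_unit[OF h(1)] outer_arc[OF f] h notin[OF h] Pd
    by (intro winding_number_join) (auto intro: arc_imp_path)
  have ab: "a < b" using f by (simp add: proper_arc_def)
  have "winding_number (on_unit a b f) P = winding_number (on_unit a b g) P"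
  proof (rule winding_number_paths_linear_eq)
    fix t :: real assume t: "t \<in> {0..1}"
    define t' where "t' = a + t * (b - a)"
    have t': "t' \<in> {a..b}" unfolding t'_def on_unit_image[OF ab, symmetric] using t by (rule imageI)
    show "P \<notin> closed_segment (on_unit a b g t) (on_unit a b f t)"
    proof (cases "t' = a \<or> t' = b")
      case True then show ?thesis using f g fg P by (auto simp: on_unit_def t'_def[symmetric])
    next
      case False
      then have "f t' \<in> ball 0 1" "g t' \<in> ball 0 1" using t' f g by (auto simp: proper_arc_def)
      then have "closed_segment (g t') (f t') \<subseteq> ball 0 1" by (simp add: closed_segment_subset)
      then show ?thesis using P by (auto simp: on_unit_def t'_def[symmetric])
    qed
  qed (use arc_on_unit[OF f] arc_on_unit[OF g] fg in \<open>auto intro: arc_imp_path\<close>)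
  then show ?thesis unfolding side_def using wj[OF f] wj[OF g fg] by simp
qed

definition transverse_crossing :: "(real \<Rightarrow> complex) \<Rightarrow> (real \<Rightarrow> complex) \<Rightarrow> real \<Rightarrow> real \<Rightarrow> complex \<Rightarrow> complex \<Rightarrow> bool" where
  "transverse_crossing f g s t v w \<longleftrightarrow> f s = g t \<and>
     (f has_vector_derivative v) (at s) \<and> (g has_vector_derivative w) (at t) \<and> Im (cnj v * w) \<noteq> 0"

text \<open>The geometric input to move II. Along \<open>g'\<close> the side with respect to \<open>f'\<close> changes by the sum of the two
  signs. The endpoints of \<open>g'\<close> are on the circle, where the sides with respect to \<open>f\<close> and \<open>f'\<close> agree, and the disjoint
  arc \<open>g\<close> joins them without changing sides; so the sum is zero.\<close>

lemma two_crossings_opposite_signs: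
  assumes f: "proper_arc a b f" and g: "proper_arc c d g" and f': "proper_arc a b f'" and g': "proper_arc c d g'"
    and ends: "f' a = f a" "f' b = f b" "g' c = g c" "g' d = g d"
    and disj: "f ` {a..b} \<inter> g ` {c..d} = {}"
    and crossings: "{(s, t). s \<in> {a..b} \<and> t \<in> {c..d} \<and> f' s = g' t} = {(s1, t1), (s2, t2)}"
    and ne: "(s1, t1) \<noteq> (s2, t2)"
    and 1: "transverse_crossing f' g' s1 t1 v1 w1" and 2: "transverse_crossing f' g' s2 t2 v2 w2"
  shows "sgn (Im (cnj v1 * w1)) = - sgn (Im (cnj v2 * w2))"
proof -
  have cd: "c < d" "a < b" using f g by (auto simp: proper_arc_def)
  have cr: "(s, t) = (s1, t1) \<or> (s, t) = (s2, t2)" if "s \<in> {a..b}" "t \<in> {c..d}" "f' s = g' t" for s t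
    using crossings that by blast
  have in1: "s1 \<in> {a..b}" "t1 \<in> {c..d}" "f' s1 = g' t1" and in2: "s2 \<in> {a..b}" "t2 \<in> {c..d}" "f' s2 = g' t2"
    using crossings by blast+
  have e: "f a \<noteq> g c" "f a \<noteq> g d" "f b \<noteq> g c" "f b \<noteq> g d"
  proof -
    have "{f a, f b} \<subseteq> f ` {a..b}" "{g c, g d} \<subseteq> g ` {c..d}" using cd by auto
    with disj show "f a \<noteq> g c" "f a \<noteq> g d" "f b \<noteq> g c" "f b \<noteq> g d" by blast+
  qed
  have int: "s \<in> {a<..<b} \<and> t \<in> {c<..<d}" if "s \<in> {a..b}" "t \<in> {c..d}" "f' s = g' t" for s t
  proof -
    have "cmod (f' s) \<noteq> 1"
    proof
      assume "cmod (f' s) = 1"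
      with proper_arc_endpoint[OF f', of s] proper_arc_endpoint[OF g', of t] that e ends show False by auto
    qed
    then have "s \<noteq> a" "s \<noteq> b" "t \<noteq> c" "t \<noteq> d" using that f' g' by (auto simp: proper_arc_def)
    with that show ?thesis by auto
  qed
  have tne: "t1 \<noteq> t2"
  proof
    assume "t1 = t2"
    then have "f' s1 = f' s2" using in1 in2 by simp
    then have "s1 = s2" using f' in1 in2 by (auto simp: proper_arc_def inj_on_def)
    with ne \<open>t1 = t2\<close> show False by simp
  qed
  have total: "sgn (Im (cnj v * w)) + sgn (Im (cnj v' * w')) = side a b f' (g' d) - side a b f' (g' c)"
    if st: "s \<in> {a..b}" "t \<in> {c..d}" "f' s = g' t" and st': "s' \<in> {a..b}" "t' \<in> {c..d}" "f' s' = g' t'" and "t < t'"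
      and tc: "transverse_crossing f' g' s t v w" and tc': "transverse_crossing f' g' s' t' v' w'"
      and cr': "\<And>r q. r \<in> {a..b} \<Longrightarrow> q \<in> {c..d} \<Longrightarrow> f' r = g' q \<Longrightarrow> q = t \<or> q = t'" for s t s' t' v w v' w'
  proof -
    define m where "m = (t + t') / 2"
    have m: "t < m" "m < t'" using \<open>t < t'\<close> by (auto simp: m_def)
    have co: "continuous_on {c..d} g'" using g' by (simp add: proper_arc_def)
    have "side a b f' (g' m) - side a b f' (g' c) = sgn (Im (cnj v * w))"
    proof (rule side_jump[OF f'])
      show "continuous_on {c..m} g'" using m st' by (intro continuous_on_subset[OF co]) auto
      show "cmod (g' q) \<le> 1" if "q \<in> {c..m}" for q using that m st' by (intro proper_arc_cball[OF g']) auto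
      show "q = t" if "q \<in> {c..m}" "g' q \<in> f' ` {a..b}" for q using that cr'[of _ q] m st' by force
    qed (use int[OF st] st tc m in \<open>auto simp: transverse_crossing_def\<close>)
    moreover have "side a b f' (g' d) - side a b f' (g' m) = sgn (Im (cnj v' * w'))"
    proof (rule side_jump[OF f'])
      show "continuous_on {m..d} g'" using m st by (intro continuous_on_subset[OF co]) auto
      show "cmod (g' q) \<le> 1" if "q \<in> {m..d}" for q using that m st by (intro proper_arc_cball[OF g']) auto
      show "q = t'" if "q \<in> {m..d}" "g' q \<in> f' ` {a..b}" for q using that cr'[of _ q] m st by force
    qed (use int[OF st'] st' tc' m in \<open>auto simp: transverse_crossing_def\<close>)
    ultimately show ?thesis by simp
  qed
  have "sgn (Im (cnj v1 * w1)) + sgn (Im (cnj v2 * w2)) = side a b f' (g' d) - side a b f' (g' c)"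
  proof (cases "t1 < t2")
    case True
    show ?thesis by (rule total[OF in1 in2 True 1 2]) (use cr in blast)
  next
    case False
    then have "t2 < t1" using tne by simp
    have "sgn (Im (cnj v2 * w2)) + sgn (Im (cnj v1 * w1)) = side a b f' (g' d) - side a b f' (g' c)"
      by (rule total[OF in2 in1 \<open>t2 < t1\<close> 2 1]) (use cr in blast)
    then show ?thesis by simp
  qed
  also have "side a b f' (g' d) = side a b f (g d)"
    using g e by (subst side_boundary[OF f f' ends(1,2)]) (auto simp: proper_arc_def ends)
  also have "side a b f' (g' c) = side a b f (g c)"
    using g e by (subst side_boundary[OF f f' ends(1,2)]) (auto simp: proper_arc_def ends)
  also have "side a b f (g c) = side a b f (g d)"
  proof (rule side_constant[OF f])
    show "continuous_on {c..d} g" using g by (simp add: proper_arc_def)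
    show "cmod (g t) \<le> 1 \<and> g t \<notin> f ` {a..b}" if "t \<in> {c..d}" for t
      using disj that proper_arc_cball[OF g that] by blast
  qed (use cd in auto)
  finally show ?thesis by simp
qed

definition single_crossing where
  "single_crossing a b f c d g s t v w \<longleftrightarrow> s \<in> {a<..<b} \<and> t \<in> {c<..<d} \<and> transverse_crossing f g s t v w \<and>
     (\<forall>s'\<in>{a..b}. \<forall>t'\<in>{c..d}. f s' = g t' \<longrightarrow> t' = t)"

text \<open>The sign of the only crossing is the difference between the sides of the endpoints of \<open>g\<close>, and these
  are points of the circle.\<close>

lemma single_crossing_same_sign:
  assumes f: "proper_arc a b f" and g: "proper_arc c d g" and f': "proper_arc a b f'" and g': "proper_arc c d g'"
    and ends: "f' a = f a" "f' b = f b" "g' c = g c" "g' d = g d"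
    and 1: "single_crossing a b f c d g s t v w" and 2: "single_crossing a b f' c d g' s' t' v' w'"
  shows "sgn (Im (cnj v * w)) = sgn (Im (cnj v' * w'))"
proof -
  have "side a b f (g d) - side a b f (g c) = sgn (Im (cnj v * w))"
    by (rule side_jump[OF f]) (use g 1 proper_arc_cball[OF g] in \<open>auto simp: proper_arc_def single_crossing_def transverse_crossing_def\<close>)
  moreover have "side a b f' (g' d) - side a b f' (g' c) = sgn (Im (cnj v' * w'))"
    by (rule side_jump[OF f']) (use g' 2 ends proper_arc_cball[OF g'] in \<open>auto simp: proper_arc_def single_crossing_def transverse_crossing_def\<close>)
  moreover have "g q \<notin> {f a, f b}" if "q = c \<or> q = d" for q
  proof
    assume "g q \<in> {f a, f b}"
    then obtain p where "f p = g q" "p \<in> {a..b}" using f by (fastforce simp: proper_arc_def)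
    moreover have "q \<in> {c..d}" using that g by (auto simp: proper_arc_def)
    ultimately have "q = t" using 1 by (auto simp: single_crossing_def)
    then show False using 1 that by (auto simp: single_crossing_def)
  qed
  then have "side a b f' (g' d) = side a b f (g d)" "side a b f' (g' c) = side a b f (g c)"
    using g by (auto simp: ends proper_arc_def intro!: side_boundary[OF f f' ends(1,2)])
  ultimately show ?thesis by simp
qed

text \<open>The geometric input to move III. The arcs \<open>g\<close> and \<open>h\<close> both cross \<open>f\<close> once and meet each other in a point \<open>X\<close>.
  The side of \<open>X\<close> is determined by the sign with which \<open>g\<close> crosses \<open>f\<close> and by whether this happens before or after \<open>X\<close>,
  and likewise for \<open>h\<close>. As the side can take two values only, the two descriptions must match.\<close>

lemma triangle_orders:
  assumes f: "proper_arc a b f" and g: "proper_arc c d g" and h: "proper_arc c' d' h"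
    and 1: "single_crossing a b f c d g s t v w" and 2: "single_crossing a b f c' d' h s' t' v' w'"
    and X: "q \<in> {c..d}" "q' \<in> {c'..d'}" "g q = h q'" "q \<noteq> t" "q' \<noteq> t'"
  shows "(t < q \<longleftrightarrow> t' < q') \<longleftrightarrow> sgn (Im (cnj v * w)) = sgn (Im (cnj v' * w'))"
proof -
  obtain k where k: "\<And>z. cmod z \<le> 1 \<Longrightarrow> z \<notin> f ` {a..b} \<Longrightarrow> side a b f z = k \<or> side a b f z = k + 1"
    using side_two_values[OF f] by blast
  have side: "side a b f (g q) = k + 1 \<longleftrightarrow> (t < q \<longleftrightarrow> Im (cnj v * w) > 0)"
    if g: "proper_arc c d g" and 1: "single_crossing a b f c d g s t v w" and q: "q \<in> {c..d}" "q \<noteq> t" for c d g s t v w q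
  proof -
    have co: "continuous_on {c..d} g" using g by (simp add: proper_arc_def)
    have val: "side a b f (g r) = k \<or> side a b f (g r) = k + 1" if "r \<in> {c..d}" "r \<noteq> t" for r
      using k[OF proper_arc_cball[OF g that(1)]] that 1 by (force simp: single_crossing_def)
    have vq: "side a b f (g q) = k \<or> side a b f (g q) = k + 1" using val q by blast
    have t: "t \<in> {c<..<d}" using 1 by (simp add: single_crossing_def)
    have nz: "Im (cnj v * w) \<noteq> 0" using 1 by (simp add: single_crossing_def transverse_crossing_def)
    show ?thesis
    proof (cases "t < q")
      case True
      have "side a b f (g q) - side a b f (g c) = sgn (Im (cnj v * w))"
      proof (rule side_jump[OF f])
        show "continuous_on {c..q} g" using q by (intro continuous_on_subset[OF co]) auto
      qed (use True q 1 proper_arc_cball[OF g] in \<open>auto simp: single_crossing_def transverse_crossing_def\<close>)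
      with True nz vq val[of c] t show ?thesis by (auto simp: sgn_if split: if_splits)
    next
      case False
      have "side a b f (g d) - side a b f (g q) = sgn (Im (cnj v * w))"
      proof (rule side_jump[OF f])
        show "continuous_on {q..d} g" using q by (intro continuous_on_subset[OF co]) auto
      qed (use False q 1 proper_arc_cball[OF g] in \<open>auto simp: single_crossing_def transverse_crossing_def\<close>)
      with False nz vq val[of d] t show ?thesis by (auto simp: sgn_if split: if_splits)
    qed
  qed
  have "(t < q \<longleftrightarrow> Im (cnj v * w) > 0) \<longleftrightarrow> (t' < q' \<longleftrightarrow> Im (cnj v' * w') > 0)"
    using side[OF g 1 X(1,4)] side[OF h 2 X(2,5)] X(3) by simp
  moreover have "Im (cnj v * w) \<noteq> 0" "Im (cnj v' * w') \<noteq> 0"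
    using 1 2 by (auto simp: single_crossing_def transverse_crossing_def)
  ultimately show ?thesis by (auto simp: sgn_if)
qed

section \<open>Quandle colorings of Gauss data\<close>

text \<open>The first argument of \<open>tri\<close> selects the operation or its inverse; the law \<open>tri_distrib\<close> mixes both, so that
  it can be applied at crossings of any signs.\<close>

locale quandle =
  fixes tri :: "bool \<Rightarrow> 'q \<Rightarrow> 'q \<Rightarrow> 'q"
  assumes tri_idem: "tri e x x = x"
    and tri_cancel: "tri (\<not> e) (tri e x y) y = x"
    and tri_distrib: "tri e (tri d x y) z = tri d (tri e x z) (tri e y z)"
begin

text \<open>Gauss data assign \<open>Some (e, s)\<close> to the parameters \<open>t\<close> at which the curve passes under itself, where \<open>s\<close> is the
  parameter of the over-passage and \<open>e\<close> tells whether the crossing is positive. The color \<open>c t\<close> at an under-passage is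
  the one of the incoming strand, so colorings are left continuous, and \<open>passed g c t\<close> is the color just after \<open>t\<close>.\<close>

definition passed :: "(real \<Rightarrow> (bool \<times> real) option) \<Rightarrow> (real \<Rightarrow> 'q) \<Rightarrow> real \<Rightarrow> 'q" where
  "passed g c t = (case g t of None \<Rightarrow> c t | Some (e, s) \<Rightarrow> tri e (c t) (c s))"

text \<open>One-sided germs make the coloring condition local in the parameter, so that colorings can be changed on some
  intervals without touching the rest.\<close>

definition coloring_on :: "(real \<Rightarrow> (bool \<times> real) option) \<Rightarrow> (real \<Rightarrow> 'q) \<Rightarrow> real \<Rightarrow> real \<Rightarrow> bool" where
  "coloring_on g c a b \<longleftrightarrow>
     (\<forall>t\<in>{a<..b}. \<forall>\<^sub>F x in at_left t. c x = c t) \<and> (\<forall>t\<in>{a..<b}. \<forall>\<^sub>F x in at_right t. c x = passed g c t)"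

lemma passed_None: "g t = None \<Longrightarrow> passed g c t = c t"
  by (simp add: passed_def)

lemma passed_Some: "g t = Some (e, s) \<Longrightarrow> passed g c t = tri e (c t) (c s)"
  by (simp add: passed_def)

lemma coloring_on_subset: "coloring_on g c a b \<Longrightarrow> a \<le> a' \<Longrightarrow> b' \<le> b \<Longrightarrow> coloring_on g c a' b'"
  by (auto simp: coloring_on_def)

lemma coloring_on_passed:
  assumes c: "coloring_on g c a b" and u: "a \<le> u" "u < t" "t \<le> b" and g: "\<And>x. u < x \<Longrightarrow> x < t \<Longrightarrow> g x = None"
  shows "c t = passed g c u"
proof -
  have "\<forall>\<^sub>F x in at_right u. c x = passed g c u" using c u by (auto simp: coloring_on_def)
  moreover have "\<forall>\<^sub>F x in at_right u. x \<in> {u<..<t}" using u by (intro eventually_at_rightI) auto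
  ultimately have "\<forall>\<^sub>F x in at_right u. c x = passed g c u \<and> x \<in> {u<..<t}" by (rule eventually_conj)
  then obtain x where x: "c x = passed g c u" "u < x" "x < t"
    using eventually_happens'[of "at_right u"] by auto
  have "c x = c t"
  proof (rule connected_local_const[of "{x..t}"])
    show "\<forall>y\<in>{x..t}. \<forall>\<^sub>F z in at y within {x..t}. c y = c z"
    proof
      fix y assume y: "y \<in> {x..t}"
      have "\<forall>\<^sub>F z in at y. z \<in> {x..t} \<longrightarrow> c y = c z"
        unfolding eventually_at_split
      proof
        show "\<forall>\<^sub>F z in at_left y. z \<in> {x..t} \<longrightarrow> c y = c z"
        proof (cases "y = x")
          case True
          then show ?thesis by (simp add: eventually_at_filter)
        next
          case False
          then have "\<forall>\<^sub>F z in at_left y. c z = c y" using c u x y by (auto simp: coloring_on_def)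
          then show ?thesis by (rule eventually_mono) simp
        qed
        show "\<forall>\<^sub>F z in at_right y. z \<in> {x..t} \<longrightarrow> c y = c z"
        proof (cases "y = t")
          case True
          then show ?thesis by (simp add: eventually_at_filter)
        next
          case False
          then have "\<forall>\<^sub>F z in at_right y. c z = passed g c y" using c u x y by (auto simp: coloring_on_def)
          moreover have "passed g c y = c y" using False x y g by (intro passed_None) auto
          ultimately show ?thesis by (auto elim: eventually_mono)
        qed
      qed
      then show "\<forall>\<^sub>F z in at y within {x..t}. c y = c z"
        by (auto simp: eventually_at_filter elim: eventually_mono)
    qed
  qed (use x in \<open>auto simp: connected_Icc\<close>)
  with x show ?thesis by simp
qed

lemma coloring_on_const:
  assumes "coloring_on g c a b" "\<And>x. a \<le> x \<Longrightarrow> x < b \<Longrightarrow> g x = None" "t \<in> {a..b}"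
  shows "c t = c a"
proof (cases "t = a")
  case False
  then show ?thesis using coloring_on_passed[OF assms(1), of a t] assms by (simp add: passed_None)
qed simp

text \<open>The two parameters \<open>u\<close> and \<open>u'\<close> may coincide, so the case of a single crossing is included.\<close>

lemma coloring_on_steps_dest:
  assumes c: "coloring_on g c a b" and u: "a < u" "u \<le> u'" "u' < b"
    and g: "\<And>x. a \<le> x \<Longrightarrow> x < b \<Longrightarrow> x \<noteq> u \<Longrightarrow> x \<noteq> u' \<Longrightarrow> g x = None" and t: "t \<in> {a..b}"
  shows "c t = (if t \<le> u then c a else if t \<le> u' then passed g c u else passed g c u')"
proof -
  consider "t = a" | "a < t" "t \<le> u" | "u < t" "t \<le> u'" | "u' < t" using t by force
  then show ?thesis
  proof cases
    case 1 then show ?thesis using u by simp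
  next
    case 2
    then have "c t = passed g c a" using u t g by (intro coloring_on_passed[OF c]) auto
    then show ?thesis using 2 u g by (simp add: passed_None)
  next
    case 3
    then have "c t = passed g c u" using u t g by (intro coloring_on_passed[OF c]) auto
    then show ?thesis using 3 by simp
  next
    case 4
    then have "c t = passed g c u'" using u t g by (intro coloring_on_passed[OF c]) auto
    then show ?thesis using 4 u by simp
  qed
qed

lemma eventually_le_threshold:
  "\<forall>\<^sub>F x in at_left t. (x \<le> u) = (t \<le> (u::real))" "\<forall>\<^sub>F x in at_right t. (x \<le> u) = (t < u)"
proof -
  have l: "\<forall>\<^sub>F x in at_left t. x < t" and r: "\<forall>\<^sub>F x in at_right t. t < x"
    by (simp_all add: eventually_at_filter)
  show "\<forall>\<^sub>F x in at_left t. (x \<le> u) = (t \<le> u)"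
  proof (cases "u < t")
    case True
    then have "\<forall>\<^sub>F x in at_left t. x \<in> {u<..<t}" by (intro eventually_at_leftI) auto
    then show ?thesis by (rule eventually_mono) (use True in auto)
  next
    case False
    from l show ?thesis by (rule eventually_mono) (use False in auto)
  qed
  show "\<forall>\<^sub>F x in at_right t. (x \<le> u) = (t < u)"
  proof (cases "t < u")
    case True
    then have "\<forall>\<^sub>F x in at_right t. x \<in> {t<..<u}" by (intro eventually_at_rightI) auto
    then show ?thesis by (rule eventually_mono) (use True in auto)
  next
    case False
    from r show ?thesis by (rule eventually_mono) (use False in auto)
  qed
qed

lemma coloring_on_stepsI:
  assumes c: "\<And>t. t \<in> {a..b} \<Longrightarrow> c t = (if t \<le> u then x else if t \<le> u' then y else z)"
    and p: "\<And>t. t \<in> {a..<b} \<Longrightarrow> passed g c t = (if t < u then x else if t < u' then y else z)"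
  shows "coloring_on g c a b"
  unfolding coloring_on_def
proof safe
  fix t assume t: "t \<in> {a<..b}"
  have "\<forall>\<^sub>F x in at_left t. x \<in> {a<..<t}" using t by (intro eventually_at_leftI) auto
  with eventually_le_threshold(1)[of u t] eventually_le_threshold(1)[of u' t]
  show "\<forall>\<^sub>F x in at_left t. c x = c t"
    by eventually_elim (use t c in auto)
next
  fix t assume t: "t \<in> {a..<b}"
  have "\<forall>\<^sub>F x in at_right t. x \<in> {t<..<b}" using t by (intro eventually_at_rightI) auto
  with eventually_le_threshold(2)[of u t] eventually_le_threshold(2)[of u' t]
  show "\<forall>\<^sub>F x in at_right t. c x = passed g c t"
    by eventually_elim (use t c p in auto)
qed

end

definition agree_outside ::
  "nat \<Rightarrow> (nat \<Rightarrow> real) \<Rightarrow> (nat \<Rightarrow> real) \<Rightarrow> (real \<Rightarrow> (bool \<times> real) option) \<Rightarrow> (real \<Rightarrow> (bool \<times> real) option) \<Rightarrow> bool"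
where
  "agree_outside n a b g g' \<longleftrightarrow> (\<forall>t\<in>{0..<1} - (\<Union>i<n. {a i..<b i}). g' t = g t \<and>
     (\<forall>e s. g t = Some (e, s) \<longrightarrow> s \<notin> (\<Union>i<n. {a i<..<b i})))"

lemma agree_outside_sym: "agree_outside n a b g g' \<Longrightarrow> agree_outside n a b g' g"
  unfolding agree_outside_def by (intro ballI) (drule (1) bspec, simp)

context quandle begin

text \<open>Outside the open strands nothing changes, and the half-open intervals in \<open>agree_outside\<close> fit the one-sided conditions:
  at the left end of a strand the condition from the right already belongs to the strand.\<close>

lemma coloring_glue:
  fixes a b :: "nat \<Rightarrow> real"
  assumes c: "coloring_on g c 0 1" and ao: "agree_outside n a b g g'"
    and out: "\<And>t. t \<notin> (\<Union>i<n. {a i<..<b i}) \<Longrightarrow> c' t = c t"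
    and strand: "\<And>i. i < n \<Longrightarrow> coloring_on g' c' (a i) (b i)"
  shows "coloring_on g' c' 0 1"
  unfolding coloring_on_def
proof safe
  fix t :: real assume t: "t \<in> {0<..1}"
  show "\<forall>\<^sub>F x in at_left t. c' x = c' t"
  proof (cases "\<exists>i<n. t \<in> {a i<..b i}")
    case True
    then show ?thesis using strand by (auto simp: coloring_on_def)
  next
    case False
    have "\<forall>\<^sub>F x in at_left t. \<forall>i\<in>{..<n}. x \<notin> {a i<..<b i}"
    proof (rule eventually_ball_finite, safe)
      fix i assume "i < n"
      with False have "t \<le> a i \<or> b i < t" by force
      with eventually_le_threshold(1)[of "a i" t] eventually_le_threshold(1)[of "b i" t]
      show "\<forall>\<^sub>F x in at_left t. x \<notin> {a i<..<b i}"
        by (auto elim: eventually_mono)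
    qed
    moreover have "\<forall>\<^sub>F x in at_left t. c x = c t" using c t by (auto simp: coloring_on_def)
    ultimately show ?thesis
    proof eventually_elim
      case (elim x)
      then have "c' x = c x" by (intro out) auto
      moreover have "c' t = c t" using False by (intro out) auto
      ultimately show ?case using elim by simp
    qed
  qed
next
  fix t :: real assume t: "t \<in> {0..<1}"
  show "\<forall>\<^sub>F x in at_right t. c' x = passed g' c' t"
  proof (cases "\<exists>i<n. t \<in> {a i..<b i}")
    case True
    then show ?thesis using strand by (auto simp: coloring_on_def)
  next
    case False
    have "\<forall>\<^sub>F x in at_right t. \<forall>i\<in>{..<n}. x \<notin> {a i<..<b i}"
    proof (rule eventually_ball_finite, safe)
      fix i assume "i < n"
      with False have "t < a i \<or> b i \<le> t" by force
      with eventually_le_threshold(2)[of "a i" t] eventually_le_threshold(2)[of "b i" t]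
      show "\<forall>\<^sub>F x in at_right t. x \<notin> {a i<..<b i}"
        by (auto elim: eventually_mono)
    qed
    moreover have "\<forall>\<^sub>F x in at_right t. c x = passed g c t" using c t by (auto simp: coloring_on_def)
    ultimately have "\<forall>\<^sub>F x in at_right t. c' x = passed g c t"
    proof eventually_elim
      case (elim x)
      then have "c' x = c x" by (intro out) auto
      then show ?case using elim by simp
    qed
    moreover have "passed g' c' t = passed g c t"
    proof -
      have t_out: "t \<in> {0..<1} - (\<Union>i<n. {a i..<b i})" using t False by auto
      then have *: "g' t = g t \<and> (\<forall>e s. g t = Some (e, s) \<longrightarrow> s \<notin> (\<Union>i<n. {a i<..<b i}))"
        using ao unfolding agree_outside_def by blast
      have "c' t = c t" using t_out by (intro out) auto
      then show ?thesis
      proof (cases "g t")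
        case None
        then show ?thesis using * \<open>c' t = c t\<close> by (simp add: passed_def)
      next
        case (Some es)
        obtain e s where es: "es = (e, s)" by (cases es)
        have "c' s = c s" using * Some es by (intro out) blast
        then show ?thesis using * \<open>c' t = c t\<close> Some es by (simp add: passed_def)
      qed
    qed
    ultimately show ?thesis by simp
  qed
qed

definition colorable :: "(real \<Rightarrow> (bool \<times> real) option) \<Rightarrow> 'q \<Rightarrow> 'q \<Rightarrow> bool" where
  "colorable g p q \<longleftrightarrow> (\<exists>c. coloring_on g c 0 1 \<and> c 0 = p \<and> c 1 = q)"

text \<open>A strand that crosses itself under its own color keeps this color, by idempotence.\<close>

lemma colorable_loop_add:
  assumes ao: "agree_outside 1 a b g g'" and ab: "0 < a 0" "a 0 < b 0" "b 0 < 1"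
    and g: "\<And>t. t \<in> {a 0..b 0} \<Longrightarrow> g t = None"
    and g': "\<And>t e s. t \<in> {a 0..b 0} \<Longrightarrow> g' t = Some (e, s) \<Longrightarrow> s \<in> {a 0..b 0}"
    and col: "colorable g p q"
  shows "colorable g' p q"
proof -
  obtain c where c: "coloring_on g c 0 1" "c 0 = p" "c 1 = q" using col by (auto simp: colorable_def)
  define A where "A = c (a 0)"
  have const: "c t = A" if "t \<in> {a 0..b 0}" for t
    unfolding A_def using coloring_on_const[OF coloring_on_subset[OF c(1)] _ that] g ab by auto
  have "coloring_on g' c 0 1"
  proof (rule coloring_glue[OF c(1) ao])
    fix i :: nat assume "i < 1"
    have "passed g' c t = A" if t: "t \<in> {a 0..b 0}" for t
    proof (cases "g' t")
      case None
      then show ?thesis using const[OF t] by (simp add: passed_def)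
    next
      case (Some es)
      obtain e s where es: "es = (e, s)" by (cases es)
      have "c s = A" using Some es g'[OF t] by (intro const) blast
      then show ?thesis using const[OF t] Some es by (simp add: passed_def tri_idem)
    qed
    then have "coloring_on g' c (a 0) (b 0)"
      using const by (intro coloring_on_stepsI[of _ _ _ 0 A 0 A A]) auto
    then show "coloring_on g' c (a i) (b i)" using \<open>i < 1\<close> by simp
  qed simp
  then show ?thesis using c by (auto simp: colorable_def)
qed

lemma colorable_loop_remove:
  assumes ao: "agree_outside 1 a b g g'" and ab: "0 < a 0" "a 0 < b 0" "b 0 < 1"
    and g: "\<And>t. t \<in> {a 0..b 0} \<Longrightarrow> g t = None"
    and g'u: "g' u = Some (e, s)" and u: "u \<in> {a 0<..<b 0}" and s: "s \<in> {a 0..b 0}"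
    and g': "\<And>t. t \<in> {a 0..b 0} \<Longrightarrow> t \<noteq> u \<Longrightarrow> g' t = None"
    and col: "colorable g' p q"
  shows "colorable g p q"
proof -
  obtain c where c: "coloring_on g' c 0 1" "c 0 = p" "c 1 = q" using col by (auto simp: colorable_def)
  have steps: "c t = (if t \<le> u then c (a 0) else tri e (c u) (c s))" if "t \<in> {a 0..b 0}" for t
    using coloring_on_steps_dest[OF coloring_on_subset[OF c(1)], of "a 0" "b 0" u u t] u ab g' that passed_Some[where g="g'" and t="u", OF g'u]
    by auto
  \<comment> \<open>both sides of the crossing have the colour of the loop, by idempotence\<close>
  have cb: "c (b 0) = c (a 0)"
  proof (cases "s \<le> u")
    case True
    then have "c s = c (a 0)" using steps[OF s] by simp
    then show ?thesis using steps[of "b 0"] steps[of u] u by (auto simp: tri_idem)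
  next
    case False
    then have "c s = tri e (c (a 0)) (c s)" using steps[OF s] steps[of u] u by auto
    then have "tri (\<not> e) (c s) (c s) = c (a 0)" by (metis tri_cancel)
    then have "c s = c (a 0)" by (simp add: tri_idem)
    then show ?thesis using steps[of "b 0"] steps[of u] u by (auto simp: tri_idem)
  qed
  define c' where "c' = (\<lambda>t. if t \<in> {a 0..b 0} then c (a 0) else c t)"
  have "coloring_on g c' 0 1"
  proof (rule coloring_glue[OF c(1) agree_outside_sym[OF ao]])
    fix i :: nat assume "i < 1"
    have "coloring_on g c' (a 0) (b 0)"
      by (rule coloring_on_stepsI[of _ _ _ 0 "c (a 0)" 0 "c (a 0)" "c (a 0)"])
         (auto simp: c'_def passed_None g)
    then show "coloring_on g c' (a i) (b i)" using \<open>i < 1\<close> by simp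
  next
    fix t assume "t \<notin> (\<Union>i<1. {a i<..<b i})"
    then have "t \<notin> {a 0<..<b 0}" by auto
    then show "c' t = c t" using cb by (auto simp: c'_def)
  qed
  then show ?thesis using c ab by (auto simp: colorable_def c'_def intro!: exI[of _ c'])
qed

lemma less_2_iff: "i < (2::nat) \<longleftrightarrow> i = 0 \<or> i = 1" and less_3_iff: "i < (3::nat) \<longleftrightarrow> i = 0 \<or> i = 1 \<or> i = 2"
  by auto

context
  fixes a b :: "nat \<Rightarrow> real" and g g' :: "real \<Rightarrow> (bool \<times> real) option" and e :: bool and t1 t2 s1 s2 :: real
  assumes ao: "agree_outside 2 a b g g'" and ab: "\<And>i. i < 2 \<Longrightarrow> 0 < a i \<and> a i < b i \<and> b i < 1"
    and dis: "{a 0..b 0} \<inter> {a 1..b 1} = {}"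
    and g: "\<And>i t. i < 2 \<Longrightarrow> t \<in> {a i..b i} \<Longrightarrow> g t = None"
    and g'0: "\<And>t. t \<in> {a 0..b 0} \<Longrightarrow> g' t = None"
    and t12: "a 1 < t1" "t1 < t2" "t2 < b 1" and s: "s1 \<in> {a 0..b 0}" "s2 \<in> {a 0..b 0}"
    and g't: "g' t1 = Some (e, s1)" "g' t2 = Some (\<not> e, s2)"
    and g'1: "\<And>t. t \<in> {a 1..b 1} \<Longrightarrow> t \<noteq> t1 \<Longrightarrow> t \<noteq> t2 \<Longrightarrow> g' t = None"
begin

text \<open>Between the two crossings the lower strand gets a new color, and the opposite sign of the second crossing undoes
  the change.\<close>

lemma colorable_bigon_add:
  assumes col: "colorable g p q"
  shows "colorable g' p q"
proof -
  obtain c where c: "coloring_on g c 0 1" "c 0 = p" "c 1 = q" using col by (auto simp: colorable_def)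
  define A B where "A = c (a 0)" and "B = c (a 1)"
  define m where "m = tri e B A"
  have const: "c t = c (a i)" if "i < 2" "t \<in> {a i..b i}" for t i
    using coloring_on_const[OF coloring_on_subset[OF c(1)] _ that(2)] g ab[OF that(1)] that by auto
  define c' where "c' = (\<lambda>t. if t \<in> {t1<..t2} then m else c t)"
  have c'0: "c' t = A" if "t \<in> {a 0..b 0}" for t
    using that const[of 0 t] dis t12 by (auto simp: A_def c'_def disjoint_iff)
  have c'1: "c' t = (if t \<le> t1 then B else if t \<le> t2 then m else B)" if "t \<in> {a 1..b 1}" for t
    using that const[of 1 t] by (auto simp: B_def c'_def)
  have "coloring_on g' c' 0 1"
  proof (rule coloring_glue[OF c(1) ao])
    have "coloring_on g' c' (a 0) (b 0)"
      by (rule coloring_on_stepsI[of _ _ _ 0 "A" 0 "A" "A"])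
         (auto simp: c'0 passed_None g'0)
    moreover have "coloring_on g' c' (a 1) (b 1)"
    proof (rule coloring_on_stepsI[OF c'1])
      fix t assume t: "t \<in> {a 1..<b 1}"
      consider "t = t1" | "t = t2" | "t \<noteq> t1" "t \<noteq> t2" by blast
      then show "passed g' c' t = (if t < t1 then B else if t < t2 then m else B)"
      proof cases
        case 1
        have "passed g' c' t1 = m"
          using passed_Some[where g="g'" and t="t1" and c=c', OF g't(1)] c'0[OF s(1)] c'1[of t1] t12 by (simp add: m_def)
        then show ?thesis using 1 t12 by simp
      next
        case 2
        have "passed g' c' t2 = B"
          using passed_Some[where g="g'" and t="t2" and c=c', OF g't(2)] c'0[OF s(2)] c'1[of t2] t12 by (simp add: m_def tri_cancel)
        then show ?thesis using 2 t12 by simp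
      next
        case 3
        then have "passed g' c' t = c' t" using t g'1[of t] by (simp add: passed_None)
        then show ?thesis using c'1[of t] t 3 by auto
      qed
    qed
    ultimately show "coloring_on g' c' (a i) (b i)" if "i < 2" for i
      using that by (auto simp: less_2_iff)
    fix t assume "t \<notin> (\<Union>i<2. {a i<..<b i})"
    then have "t \<notin> {a 1<..<b 1}" by (auto simp: less_2_iff)
    then show "c' t = c t" using t12 by (auto simp: c'_def)
  qed
  then show ?thesis using c ab[of 1] t12 by (auto simp: colorable_def c'_def intro!: exI[of _ c'])
qed

lemma colorable_bigon_remove:
  assumes col: "colorable g' p q"
  shows "colorable g p q"
proof -
  obtain c where c: "coloring_on g' c 0 1" "c 0 = p" "c 1 = q" using col by (auto simp: colorable_def)
  have c0: "c t = c (a 0)" if "t \<in> {a 0..b 0}" for t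
    using coloring_on_const[OF coloring_on_subset[OF c(1)] _ that] g'0 ab[of 0] that by auto
  have steps: "c t = (if t \<le> t1 then c (a 1) else if t \<le> t2 then passed g' c t1 else passed g' c t2)" if "t \<in> {a 1..b 1}" for t
    using coloring_on_steps_dest[OF coloring_on_subset[OF c(1)], of "a 1" "b 1" t1 t2 t] t12 ab[of 1] g'1 that by auto
  have cb: "c (b 1) = c (a 1)"
    using steps[of "b 1"] steps[of t1] steps[of t2] t12 c0[OF s(1)] c0[OF s(2)] passed_Some[where g="g'" and t="t1", OF g't(1)] passed_Some[where g="g'" and t="t2", OF g't(2)]
    by (simp add: tri_cancel)
  define c' where "c' = (\<lambda>t. if t \<in> {a 1..b 1} then c (a 1) else c t)"
  have c'0: "c' t = c (a 0)" if "t \<in> {a 0..b 0}" for t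
    using that c0[of t] dis by (auto simp: c'_def disjoint_iff)
  have "coloring_on g c' 0 1"
  proof (rule coloring_glue[OF c(1) agree_outside_sym[OF ao]])
    have "coloring_on g c' (a 0) (b 0)"
      by (rule coloring_on_stepsI[of _ _ _ 0 "c (a 0)" 0 "c (a 0)" "c (a 0)"])
         (auto simp: c'0 passed_None g[of 0])
    moreover have "coloring_on g c' (a 1) (b 1)"
      by (rule coloring_on_stepsI[of _ _ _ 0 "c (a 1)" 0 "c (a 1)" "c (a 1)"])
         (auto simp: c'_def passed_None g[of 1])
    ultimately show "coloring_on g c' (a i) (b i)" if "i < 2" for i
      using that by (auto simp: less_2_iff)
    fix t assume "t \<notin> (\<Union>i<2. {a i<..<b i})"
    then have "t \<notin> {a 1<..<b 1}" by (auto simp: less_2_iff)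
    then show "c' t = c t" using cb by (auto simp: c'_def)
  qed
  then show ?thesis using c ab[of 1] by (auto simp: colorable_def c'_def intro!: exI[of _ c'])
qed

end

text \<open>Strand \<open>0\<close> has color \<open>x\<close>, strand \<open>1\<close> starts with \<open>y\<close> and strand \<open>2\<close> with \<open>z\<close>. The two sides are the last color of
  strand \<open>2\<close> before and after move III, where \<open>o1\<close> and \<open>o2\<close> say whether strands \<open>1\<close> and \<open>2\<close> meet strand \<open>0\<close> first. The
  hypothesis ties the orders to the signs \<open>d\<close> and \<open>d'\<close>, which turns the equation into self-distributivity.\<close>

lemma triangle_identity:
  assumes "(o1 \<longleftrightarrow> o2) \<longleftrightarrow> (d \<longleftrightarrow> d')"
  shows "(if o2 then tri f (tri d' z x) (if o1 then tri d y x else y)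
          else tri d' (tri f z (if o1 then tri d y x else y)) x) =
         (if o2 then tri d' (tri f z (if o1 then y else tri d y x)) x
          else tri f (tri d' z x) (if o1 then y else tri d y x))"
proof -
  have 1: "tri d (tri f z w) x = tri f (tri d z x) (tri d w x)" for z w d by (rule tri_distrib)
  show ?thesis
  proof (cases "d' = d")
    case True
    then show ?thesis using assms by (simp add: 1)
  next
    case False
    then have d': "d' = (\<not> d)" by blast
    then show ?thesis using assms by (auto simp: 1 tri_cancel)
  qed
qed

text \<open>Only the middle piece of strand \<open>2\<close> and the place where strand \<open>1\<close> changes its color are new; by
  \<open>triangle_identity\<close> strand \<open>2\<close> still leaves the disk with its old color.\<close>

lemma colorable_triangle:
  fixes a b :: "nat \<Rightarrow> real" and p q :: "nat \<Rightarrow> nat \<Rightarrow> real" and d :: "nat \<Rightarrow> nat \<Rightarrow> bool"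
  assumes ao: "agree_outside 3 a b g g'" and ab: "\<And>i. i < 3 \<Longrightarrow> 0 < a i \<and> a i < b i \<and> b i < 1"
    and dis: "\<And>i j. i < 3 \<Longrightarrow> j < 3 \<Longrightarrow> i \<noteq> j \<Longrightarrow> {a i..b i} \<inter> {a j..b j} = {}"
    and g: "\<And>i j. i < j \<Longrightarrow> j < 3 \<Longrightarrow> g (p j i) = Some (d i j, p i j)"
      "\<And>i j. i < 3 \<Longrightarrow> j < 3 \<Longrightarrow> i \<noteq> j \<Longrightarrow> p i j \<in> {a i<..<b i}"
      "\<And>i t. i < 3 \<Longrightarrow> t \<in> {a i..b i} \<Longrightarrow> (\<And>j. j < i \<Longrightarrow> t \<noteq> p i j) \<Longrightarrow> g t = None"
    and g': "\<And>i j. i < j \<Longrightarrow> j < 3 \<Longrightarrow> g' (q j i) = Some (d i j, q i j)"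
      "\<And>i j. i < 3 \<Longrightarrow> j < 3 \<Longrightarrow> i \<noteq> j \<Longrightarrow> q i j \<in> {a i<..<b i}"
      "\<And>i t. i < 3 \<Longrightarrow> t \<in> {a i..b i} \<Longrightarrow> (\<And>j. j < i \<Longrightarrow> t \<noteq> q i j) \<Longrightarrow> g' t = None"
    and ord: "p 1 0 < p 1 2 \<longleftrightarrow> q 1 2 < q 1 0" "p 2 0 < p 2 1 \<longleftrightarrow> q 2 1 < q 2 0"
      "p 1 0 \<noteq> p 1 2" "p 2 0 \<noteq> p 2 1" "q 1 0 \<noteq> q 1 2" "q 2 0 \<noteq> q 2 1"
    and sgn: "(p 1 0 < p 1 2 \<longleftrightarrow> p 2 0 < p 2 1) \<longleftrightarrow> (d 0 1 \<longleftrightarrow> d 0 2)"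
    and col: "colorable g x y"
  shows "colorable g' x y"
proof -
  obtain c where c: "coloring_on g c 0 1" "c 0 = x" "c 1 = y" using col by (auto simp: colorable_def)
  have cs: "coloring_on g c (a i) (b i)" if "i < 3" for i
    using coloring_on_subset[OF c(1)] ab[OF that] by auto
  define A B C where "A = c (a 0)" and "B = c (a 1)" and "C = c (a 2)"
  define B' where "B' = tri (d 0 1) B A"
  define X where "X = (if p 1 0 < p 1 2 then B' else B)"
  define X' where "X' = (if p 1 0 < p 1 2 then B else B')"
  define Mid where "Mid = (if p 2 0 < p 2 1 then tri (d 1 2) C X' else tri (d 0 2) C A)"
  define Fin where "Fin = (if p 2 0 < p 2 1 then tri (d 0 2) Mid A else tri (d 1 2) Mid X')"
  have g0: "g t = None" "g' t = None" if "t \<in> {a 0..b 0}" for t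
    using g(3)[of 0 t] g'(3)[of 0 t] that by auto
  have g1: "t \<noteq> p 1 0 \<Longrightarrow> g t = None" "t \<noteq> q 1 0 \<Longrightarrow> g' t = None" if "t \<in> {a 1..b 1}" for t
    using g(3)[of 1 t] g'(3)[of 1 t] that by auto
  have g2: "t \<noteq> p 2 0 \<Longrightarrow> t \<noteq> p 2 1 \<Longrightarrow> g t = None" "t \<noteq> q 2 0 \<Longrightarrow> t \<noteq> q 2 1 \<Longrightarrow> g' t = None" if "t \<in> {a 2..b 2}" for t
  proof -
    show "g t = None" if ne: "t \<noteq> p 2 0" "t \<noteq> p 2 1"
      by (rule g(3)[of 2]) (use that \<open>t \<in> {a 2..b 2}\<close> in \<open>auto simp: less_2_iff\<close>)
    show "g' t = None" if ne: "t \<noteq> q 2 0" "t \<noteq> q 2 1"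
      by (rule g'(3)[of 2]) (use that \<open>t \<in> {a 2..b 2}\<close> in \<open>auto simp: less_2_iff\<close>)
  qed
  have P: "p 0 1 \<in> {a 0<..<b 0}" "p 0 2 \<in> {a 0<..<b 0}" "p 1 0 \<in> {a 1<..<b 1}" "p 1 2 \<in> {a 1<..<b 1}"
      "p 2 0 \<in> {a 2<..<b 2}" "p 2 1 \<in> {a 2<..<b 2}" using g(2) by simp_all
  have Q: "q 0 1 \<in> {a 0<..<b 0}" "q 0 2 \<in> {a 0<..<b 0}" "q 1 0 \<in> {a 1<..<b 1}" "q 1 2 \<in> {a 1<..<b 1}"
      "q 2 0 \<in> {a 2<..<b 2}" "q 2 1 \<in> {a 2<..<b 2}" using g'(2) by simp_all
  have c0: "c t = A" if "t \<in> {a 0..b 0}" for t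
    unfolding A_def using coloring_on_const[OF cs[of 0] _ that] g0 by auto
  have c1: "c t = (if t \<le> p 1 0 then B else B')" if "t \<in> {a 1..b 1}" for t
  proof -
    have 1: "c t = (if t \<le> p 1 0 then B else passed g c (p 1 0))" if "t \<in> {a 1..b 1}" for t
      using coloring_on_steps_dest[OF cs[of 1], of "p 1 0" "p 1 0" t] P g1 that by (auto simp: B_def)
    have "passed g c (p 1 0) = B'"
      using passed_Some[where g="g" and t="p 1 0" and c=c, OF g(1)[of 0 1]] 1[of "p 1 0"] c0[of "p 0 1"] P by (simp add: B'_def)
    with 1[OF that] show ?thesis by simp
  qed
  have X: "c (p 1 2) = X" using c1[of "p 1 2"] P ord(3) by (auto simp: X_def)
  have cb2: "c (b 2) = Fin"
  proof -
    define u u' where "u = min (p 2 0) (p 2 1)" and "u' = max (p 2 0) (p 2 1)"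
    have steps: "c t = (if t \<le> u then C else if t \<le> u' then passed g c u else passed g c u')" if "t \<in> {a 2..b 2}" for t
      using coloring_on_steps_dest[OF cs[of 2], of u u' t] P g2 that
      by (auto simp: C_def u_def u'_def min_def max_def split: if_splits)
    have 0: "passed g c (p 2 0) = tri (d 0 2) (c (p 2 0)) A"
      using passed_Some[where g="g" and t="p 2 0" and c=c, OF g(1)[of 0 2]] c0[of "p 0 2"] P by simp
    have 1: "passed g c (p 2 1) = tri (d 1 2) (c (p 2 1)) X"
      using passed_Some[where g="g" and t="p 2 1" and c=c, OF g(1)[of 1 2]] X by simp
    have "c (b 2) = (if p 2 0 < p 2 1 then tri (d 1 2) (tri (d 0 2) C A) X else tri (d 0 2) (tri (d 1 2) C X) A)"
      using steps[of "b 2"] steps[of "p 2 0"] steps[of "p 2 1"] P ord(4) 0 1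
      by (auto simp: u_def u'_def min_def max_def split: if_splits)
    also have "\<dots> = Fin"
      unfolding Fin_def Mid_def X_def X'_def B'_def
      using triangle_identity[OF sgn, of "d 1 2" C A B] by simp
    finally show ?thesis .
  qed
  define c' where "c' = (\<lambda>t. if t \<in> {a 1<..<b 1} then (if t \<le> q 1 0 then B else B')
     else if t \<in> {a 2<..<b 2} then (if t \<le> min (q 2 0) (q 2 1) then C else if t \<le> max (q 2 0) (q 2 1) then Mid else Fin)
     else c t)"
  have out: "c' t = c t" if "t \<notin> (\<Union>i<3. {a i<..<b i})" for t
  proof -
    have "t \<notin> {a 1<..<b 1}" "t \<notin> {a 2<..<b 2}" using that by (auto simp: less_3_iff)
    then show ?thesis by (auto simp: c'_def)
  qed
  have c'0: "c' t = A" if "t \<in> {a 0..b 0}" for t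
  proof -
    have "t \<notin> {a 1..b 1}" "t \<notin> {a 2..b 2}" using that dis[of 0 1] dis[of 0 2] by (auto simp: disjoint_iff)
    then have "c' t = c t" by (auto simp: c'_def)
    with c0[OF that] show ?thesis by simp
  qed
  have c'1: "c' t = (if t \<le> q 1 0 then B else if t \<le> q 1 0 then B else B')" if "t \<in> {a 1..b 1}" for t
  proof -
    have "t \<notin> {a 2..b 2}" using that dis[of 1 2] by (auto simp: disjoint_iff)
    moreover have "c (a 1) = B" "c (b 1) = B'" using c1[of "b 1"] P by (auto simp: B_def)
    ultimately show ?thesis using that Q by (auto simp: c'_def)
  qed
  have c'2: "c' t = (if t \<le> min (q 2 0) (q 2 1) then C else if t \<le> max (q 2 0) (q 2 1) then Mid else Fin)" if "t \<in> {a 2..b 2}" for t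
  proof -
    have "t \<notin> {a 1..b 1}" using that dis[of 1 2] by (auto simp: disjoint_iff)
    moreover have "c (a 2) = C" "c (b 2) = Fin" using cb2 by (auto simp: C_def)
    ultimately show ?thesis using that Q by (auto simp: c'_def)
  qed
  have X': "c' (q 1 2) = X'" using c'1[of "q 1 2"] Q ord(1,3,5) by (auto simp: X'_def)
  have "coloring_on g' c' 0 1"
  proof (rule coloring_glue[OF c(1) ao out])
    have "coloring_on g' c' (a 0) (b 0)"
      by (rule coloring_on_stepsI[of _ _ _ 0 A 0 A A]) (auto simp: c'0 passed_None g0)
    moreover have "coloring_on g' c' (a 1) (b 1)"
    proof (rule coloring_on_stepsI[OF c'1])
      fix t assume t: "t \<in> {a 1..<b 1}"
      show "passed g' c' t = (if t < q 1 0 then B else if t < q 1 0 then B else B')"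
      proof (cases "t = q 1 0")
        case True
        have "passed g' c' (q 1 0) = B'"
          using passed_Some[where g="g'" and t="q 1 0" and c=c', OF g'(1)[of 0 1]] c'1[of "q 1 0"] c'0[of "q 0 1"] Q
          by (simp add: B'_def)
        then show ?thesis unfolding True by simp
      next
        case False
        then have "passed g' c' t = c' t" using t g1(2)[of t] by (simp add: passed_None)
        then show ?thesis using c'1[of t] t False by auto
      qed
    qed
    moreover have "coloring_on g' c' (a 2) (b 2)"
    proof (rule coloring_on_stepsI[OF c'2])
      fix t assume t: "t \<in> {a 2..<b 2}"
      have 0: "passed g' c' t = tri (d 0 2) (c' t) A" if "t = q 2 0" unfolding that
        using passed_Some[where g="g'" and t="q 2 0" and c=c', OF g'(1)[of 0 2]] c'0[of "q 0 2"] Q by simp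
      have 1: "passed g' c' t = tri (d 1 2) (c' t) X'" if "t = q 2 1" unfolding that
        using passed_Some[where g="g'" and t="q 2 1" and c=c', OF g'(1)[of 1 2]] X' Q by simp
      have 2: "passed g' c' t = c' t" if "t \<noteq> q 2 0" "t \<noteq> q 2 1" using t that g2(2)[of t] by (simp add: passed_None)
      show "passed g' c' t = (if t < min (q 2 0) (q 2 1) then C else if t < max (q 2 0) (q 2 1) then Mid else Fin)"
        using c'2[of t] t 0 1 2 ord(2,4,6)
        by (auto simp: Mid_def Fin_def min_def max_def split: if_splits)
    qed
    ultimately show "coloring_on g' c' (a i) (b i)" if "i < 3" for i
      using that by (auto simp: less_3_iff)
  qed
  moreover have "c' 0 = x" "c' 1 = y"
    using c ab[of 1] ab[of 2] by (auto simp: c'_def)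
  ultimately show ?thesis by (auto simp: colorable_def)
qed

end

section \<open>Signs of crossings on an oriented surface\<close>

text \<open>The differential of a smooth map on an arbitrary set is not unique, but its effect on velocities of curves in
  the set is. So the chain rule is stated for curves, with a derivative that is linear and continuous in the base point.\<close>

lemma smooth_on_push:
  fixes f :: "'a::euclidean_space \<Rightarrow> 'b::euclidean_space"
  assumes f: "smooth_on A f" and x: "x \<in> A"
  obtains U L where "open U" "x \<in> U" "\<And>y. y \<in> U \<Longrightarrow> linear (L y)" "\<And>v. continuous_on U (\<lambda>y. L y v)"
    "\<And>(g :: real \<Rightarrow> 'a) r T v. g r \<in> U \<Longrightarrow> g r \<in> A \<Longrightarrow> (g has_vector_derivative v) (at r within T) \<Longrightarrow>
       \<forall>\<^sub>F u in at r within T. g u \<in> A \<Longrightarrow> r \<in> T \<Longrightarrow> ((\<lambda>u. f (g u)) has_vector_derivative L (g r) v) (at r within T)"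
proof -
  have "\<exists>U h. open U \<and> x \<in> U \<and> (\<forall>k. Ck_on k h U) \<and> (\<forall>y\<in>U \<inter> A. h y = f y)"
    using f x unfolding smooth_on_def by (rule bspec)
  then obtain U h where U: "open U" "x \<in> U" and ck: "\<And>k. Ck_on k h U" and h: "\<And>y. y \<in> U \<inter> A \<Longrightarrow> h y = f y"
    by metis
  have d: "h differentiable (at y)" if "y \<in> U" for y using ck[of "Suc 0"] that by simp
  have c: "continuous_on U (\<lambda>y. frechet_derivative h (at y) v)" for v using ck[of "Suc 0"] by simp
  have hd: "(h has_derivative frechet_derivative h (at y)) (at y)" if "y \<in> U" for y
    using d[OF that] by (simp add: frechet_derivative_works)
  show ?thesis
  proof (rule that[of U "\<lambda>y. frechet_derivative h (at y)"])
    show "linear (frechet_derivative h (at y))" if "y \<in> U" for y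
      using hd[OF that] has_derivative_linear by blast
    fix g :: "real \<Rightarrow> 'a" and r T v
    assume g: "g r \<in> U" "g r \<in> A" "(g has_vector_derivative v) (at r within T)" "\<forall>\<^sub>F u in at r within T. g u \<in> A" "r \<in> T"
    have "((\<lambda>u. h (g u)) has_vector_derivative frechet_derivative h (at (g r)) v) (at r within T)"
      using vector_derivative_diff_chain_within[of g v r T h "frechet_derivative h (at (g r))"] g(3)
        has_derivative_at_withinI[OF hd[OF g(1)]]
      by (simp add: comp_def)
    moreover have "\<forall>\<^sub>F u in at r within T. f (g u) = h (g u)"
    proof -
      have "(g \<longlongrightarrow> g r) (at r within T)"
        using g(3) has_vector_derivative_continuous continuous_within by blast
      then have "\<forall>\<^sub>F u in at r within T. g u \<in> U" using U g(1) topological_tendstoD by blast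
      with g(4) show ?thesis by eventually_elim (use h in auto)
    qed
    ultimately show "((\<lambda>u. f (g u)) has_vector_derivative frechet_derivative h (at (g r)) v) (at r within T)"
      unfolding has_vector_derivative_def using h g(1,2,5)
      by (elim has_derivative_transform_eventually) (auto elim: eventually_mono)
  qed (use U c in auto)
qed

lemma smooth_on_imp_continuous_on:
  assumes "smooth_on A f" shows "continuous_on A f"
  unfolding continuous_on_eq_continuous_within
proof
  fix x assume x: "x \<in> A"
  have "\<exists>U h. open U \<and> x \<in> U \<and> (\<forall>k. Ck_on k h U) \<and> (\<forall>y\<in>U \<inter> A. h y = f y)"
    using assms x unfolding smooth_on_def by (rule bspec)
  then obtain U h where U: "open U" "x \<in> U" and ck: "\<And>k. Ck_on k h U" and h: "\<And>y. y \<in> U \<inter> A \<Longrightarrow> h y = f y"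
    by metis
  have "continuous_on U h" using ck[of 0] by simp
  then have "continuous_on (A \<inter> U) f"
    using h by (subst continuous_on_cong[of _ "A \<inter> U" f h]) (auto intro: continuous_on_subset)
  then have "continuous (at x within A \<inter> U) f" using x U by (simp add: continuous_on_eq_continuous_within)
  moreover have "at x within A \<inter> U = at x within A" using U by (intro at_within_nhd[of x U]) auto
  ultimately show "continuous (at x within A) f" by simp
qed

lemma continuous_on_local:
  fixes f :: "'a::t2_space \<Rightarrow> 'b::topological_space"
  assumes "\<And>x. x \<in> A \<Longrightarrow> \<exists>U. open U \<and> x \<in> U \<and> continuous_on (A \<inter> U) f"
  shows "continuous_on A f"
  unfolding continuous_on_eq_continuous_within
proof
  fix x assume x: "x \<in> A"
  then obtain U where U: "open U" "x \<in> U" "continuous_on (A \<inter> U) f" using assms by blast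
  then have "continuous (at x within A \<inter> U) f" using x by (simp add: continuous_on_eq_continuous_within)
  moreover have "at x within A \<inter> U = at x within A" using U by (intro at_within_nhd[of x U]) auto
  ultimately show "continuous (at x within A) f" by simp
qed

lemma has_velocity_unique:
  assumes "(\<gamma> has_vector_derivative v) (at t within {0..1})" "t \<in> {0..1}"
  shows "velocity \<gamma> t = v"
  using vector_derivative_within_cbox[of 0 1 t \<gamma> v] assms by auto

lemma smooth_curve_has_velocity:
  fixes \<gamma> :: "real \<Rightarrow> 'a::euclidean_space"
  assumes "smooth_on {0..1} \<gamma>" "t \<in> {0..1}"
  shows "(\<gamma> has_vector_derivative velocity \<gamma> t) (at t within {0..1})"
proof -
  obtain U L where U: "open U" "t \<in> U" and
    push: "\<And>(g :: real \<Rightarrow> real) r T v. g r \<in> U \<Longrightarrow> g r \<in> {0..1} \<Longrightarrow> (g has_vector_derivative v) (at r within T) \<Longrightarrow>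
       \<forall>\<^sub>F u in at r within T. g u \<in> {0..1} \<Longrightarrow> r \<in> T \<Longrightarrow> ((\<lambda>u. \<gamma> (g u)) has_vector_derivative L (g r) v) (at r within T)"
    using smooth_on_push[OF assms] by metis
  have "((\<lambda>u. \<gamma> (id u)) has_vector_derivative L (id t) 1) (at t within {0..1})"
    by (rule push) (use U assms in \<open>auto simp: eventually_at_filter id_def intro!: derivative_eq_intros\<close>)
  then have "(\<gamma> has_vector_derivative L t 1) (at t within {0..1})" by simp
  moreover from has_velocity_unique[OF this assms(2)] have "velocity \<gamma> t = L t 1" .
  ultimately show ?thesis by simp
qed

definition tangent :: "'a::euclidean_space set \<Rightarrow> 'a \<Rightarrow> 'a \<Rightarrow> bool" where
  "tangent S x v \<longleftrightarrow> (\<exists>f t. f t = x \<and> (f has_vector_derivative v) (at (t::real)) \<and> (\<forall>\<^sub>F r in nhds t. f r \<in> S))"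

definition indep2 :: "'a::real_vector \<Rightarrow> 'a \<Rightarrow> bool" where
  "indep2 v w \<longleftrightarrow> (\<forall>a b. a *\<^sub>R v + b *\<^sub>R w = 0 \<longrightarrow> a = 0 \<and> b = 0)"

lemma dim_pair_indep2:
  fixes v w :: "'a::euclidean_space"
  assumes "dim {v, w} = 2" shows "indep2 v w"
  unfolding indep2_def
proof (intro allI impI, rule ccontr)
  fix a b assume eq: "a *\<^sub>R v + b *\<^sub>R w = 0" and "\<not> (a = 0 \<and> b = 0)"
  then consider "a \<noteq> 0" | "b \<noteq> 0" by blast
  then have "\<exists>x. {v, w} \<subseteq> span {x}"
  proof cases
    case 1
    then have "v = (- b / a) *\<^sub>R w" using eq
      by (metis add_eq_0_iff2 divideR_right minus_divide_left scaleR_minus_left divide_inverse_commute scaleR_scaleR)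
    then have "v \<in> span {w}" by (metis span_base singletonI span_scale)
    then show ?thesis by (auto intro!: exI[of _ w] span_base)
  next
    case 2
    then have "w = (- a / b) *\<^sub>R v" using eq
      by (metis add_eq_0_iff divideR_right minus_divide_left scaleR_minus_left divide_inverse_commute scaleR_scaleR)
    then have "w \<in> span {v}" by (metis span_base singletonI span_scale)
    then show ?thesis by (auto intro!: exI[of _ v] span_base)
  qed
  then obtain x where "{v, w} \<subseteq> span {x}" by blast
  then have "dim {v, w} \<le> card {x}" by (rule dim_le_card) auto
  with assms show False by simp
qed

lemma indep2_linear_preimage:
  assumes "linear L" "indep2 (L v) (L w)" shows "indep2 v w"
  using assms unfolding indep2_def by (metis linear_add linear_scale linear_0)

text \<open>An oriented surface is given by a continuous family of area forms of the ambient space that are nondegenerate on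
  pairs of velocities of curves in the surface. This treats the plane and the sphere alike, without charts.\<close>

locale oriented_surface =
  fixes S :: "'a::euclidean_space set" and vol :: "'a \<Rightarrow> 'a \<Rightarrow> 'a \<Rightarrow> real"
  assumes vol_continuous: "continuous_on UNIV (\<lambda>(x, v, w). vol x v w)"
    and vol_linear: "vol x (a *\<^sub>R u + b *\<^sub>R v) w = a * vol x u w + b * vol x v w"
    and vol_swap: "vol x w v = - vol x v w"
    and vol_nondegenerate: "x \<in> S \<Longrightarrow> tangent S x v \<Longrightarrow> tangent S x w \<Longrightarrow> indep2 v w \<Longrightarrow> vol x v w \<noteq> 0"
begin

lemma vol_same [simp]: "vol x v v = 0"
  using vol_swap[of x v v] by simp

lemma vol_combination: "vol x (a *\<^sub>R u + b *\<^sub>R v) (c *\<^sub>R u + d *\<^sub>R v) = (a * d - b * c) * vol x u v"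
proof -
  have 2: "vol x w (c *\<^sub>R u + d *\<^sub>R v) = c * vol x w u + d * vol x w v" for w
    using vol_linear[of x c u d v w] vol_swap[of x w "c *\<^sub>R u + d *\<^sub>R v"] vol_swap[of x w u] vol_swap[of x w v]
    by (simp add: algebra_simps)
  show ?thesis using vol_swap[of x u v] by (simp add: vol_linear 2 algebra_simps)
qed

lemma vol_scale: "vol x (a *\<^sub>R v) (b *\<^sub>R w) = a * b * vol x v w"
  using vol_combination[of x a v 0 w 0 b] by simp

lemma continuous_on_vol:
  assumes "continuous_on A x" "continuous_on A v" "continuous_on A w"
  shows "continuous_on A (\<lambda>t. vol (x t) (v t) (w t))"
proof -
  have "continuous_on A ((\<lambda>(x, v, w). vol x v w) \<circ> (\<lambda>t. (x t, v t, w t)))"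
    by (intro continuous_on_compose continuous_on_subset[OF vol_continuous] continuous_intros assms) auto
  then show ?thesis by (simp add: comp_def)
qed

end

lemma connected_same_sign:
  fixes f :: "'a::topological_space \<Rightarrow> real"
  assumes "connected A" "continuous_on A f" "\<And>x. x \<in> A \<Longrightarrow> f x \<noteq> 0" "x \<in> A" "y \<in> A"
  shows "f x > 0 \<longleftrightarrow> f y > 0"
proof -
  have "connected (f ` A)" using assms by (intro connected_continuous_image)
  then have iv: "is_interval (f ` A)" by (simp add: is_interval_connected_1)
  have False if "a \<in> A" "b \<in> A" "f a > 0" "\<not> f b > 0" for a b
  proof -
    have "0 \<in> f ` A" using iv that unfolding is_interval_1 by (metis image_eqI less_eq_real_def linorder_not_less)
    with assms(3) show False by auto
  qed
  with assms show ?thesis by blast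
qed

abbreviation "vel D t \<equiv> velocity (curve D) t"

definition crosses :: "'a diagram \<Rightarrow> real \<Rightarrow> real \<Rightarrow> bool" where
  "crosses D s t \<longleftrightarrow> s \<in> {0..1} \<and> t \<in> {0..1} \<and> s \<noteq> t \<and> curve D s = curve D t"

lemma crosses_sym: "crosses D s t \<Longrightarrow> crosses D t s"
  by (auto simp: crosses_def)

lemma
  assumes D: "knotoid_diagram S D" and c: "crosses D s t"
  shows crosses_unique: "crosses D s' t \<Longrightarrow> s' = s"
    and crosses_interior: "s \<in> {0<..<1}" "t \<in> {0<..<1}"
    and crosses_over: "s \<in> over D \<longleftrightarrow> t \<notin> over D"
    and crosses_indep: "indep2 (vel D s) (vel D t)"
proof -
  have g: "generic_immersion S (curve D)" using D by (simp add: knotoid_diagram_def)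
  then have "crossing_params (curve D) \<subseteq> {0<..<1}" by (simp add: generic_immersion_def)
  moreover have "s \<in> crossing_params (curve D)" "t \<in> crossing_params (curve D)"
    using c crosses_sym[OF c] unfolding crosses_def crossing_params_def by blast+
  ultimately show "s \<in> {0<..<1}" "t \<in> {0<..<1}" by auto
  show "s \<in> over D \<longleftrightarrow> t \<notin> over D" using D c by (auto simp: knotoid_diagram_def crosses_def)
  have "dim {vel D s, vel D t} = 2" "\<forall>u\<in>{0..1}. curve D u = curve D s \<longrightarrow> u = s \<or> u = t"
    using g c unfolding generic_immersion_def crosses_def by blast+
  then show "indep2 (vel D s) (vel D t)" "crosses D s' t \<Longrightarrow> s' = s"
    using c by (auto simp: crosses_def dim_pair_indep2)
qed

lemma diagram_smooth:
  assumes "knotoid_diagram S D"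
  shows "smooth_on {0..1} (curve D)" "curve D ` {0..1} \<subseteq> S"
  using assms by (auto simp: knotoid_diagram_def generic_immersion_def)

lemma diagram_has_velocity:
  assumes "knotoid_diagram S D" "t \<in> {0..1}"
  shows "(curve D has_vector_derivative vel D t) (at t within {0..1})"
  using smooth_curve_has_velocity[OF diagram_smooth(1)[OF assms(1)] assms(2)] .

lemma at_within_01: "t \<in> {0<..<1} \<Longrightarrow> at t within {0..1} = at (t::real)"
  by (intro at_within_interior) (auto simp: interior_atLeastAtMost_real)

lemma eventually_01: "t \<in> {0<..<1} \<Longrightarrow> \<forall>\<^sub>F u in nhds t. u \<in> {0..1::real}"
  by (rule eventually_mono[OF eventually_nhds_in_open[of "{0<..<1}"]]) auto

lemma tangent_curve:
  assumes "(\<gamma> has_vector_derivative v) (at t within {0..1})" "t \<in> {0<..<1}" "\<gamma> ` {0..1} \<subseteq> S"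
  shows "tangent S (\<gamma> t) v"
  unfolding tangent_def
proof (intro exI conjI)
  show "\<forall>\<^sub>F r in nhds t. \<gamma> r \<in> S"
    by (rule eventually_mono[OF eventually_01[OF assms(2)]]) (use assms(3) in blast)
  show "(\<gamma> has_vector_derivative v) (at t)" using assms(1) at_within_01[OF assms(2)] by simp
qed simp

lemma eventually_within: "(\<And>x. x \<in> A \<Longrightarrow> P x) \<Longrightarrow> \<forall>\<^sub>F x in at r within A. P x"
  by (simp add: eventually_at_filter)

context oriented_surface begin

text \<open>For an over-passage \<open>s\<close> and an under-passage \<open>t\<close> this is the usual sign: the over-strand and the under-strand, in this order,
  form a positive frame at a positive crossing.\<close>

definition crossing_sign :: "'a diagram \<Rightarrow> real \<Rightarrow> real \<Rightarrow> bool" where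
  "crossing_sign D s t \<longleftrightarrow> vol (curve D t) (vel D s) (vel D t) > 0"

definition gauss :: "'a diagram \<Rightarrow> real \<Rightarrow> (bool \<times> real) option" where
  "gauss D t = (if \<exists>s. crosses D s t \<and> s \<in> over D
     then let s = (THE s. crosses D s t) in Some (crossing_sign D s t, s) else None)"

lemma gauss_eq_Some:
  assumes D: "knotoid_diagram S D"
  shows "gauss D t = Some (e, s) \<longleftrightarrow> crosses D s t \<and> s \<in> over D \<and> e = crossing_sign D s t"
proof -
  have the: "(THE s. crosses D s t) = s'" if "crosses D s' t" for s'
    using that crosses_unique[OF D that] by blast
  show ?thesis
  proof (cases "\<exists>s. crosses D s t \<and> s \<in> over D")
    case True
    then obtain s' where s': "crosses D s' t" "s' \<in> over D" by blast
    have "gauss D t = Some (crossing_sign D s' t, s')"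
      using True the[OF s'(1)] by (simp add: gauss_def)
    then have "gauss D t = Some (e, s) \<longleftrightarrow> s = s' \<and> e = crossing_sign D s' t" by auto
    then show ?thesis using s' crosses_unique[OF D s'(1)] by metis
  next
    case False
    then show ?thesis by (auto simp: gauss_def)
  qed
qed

lemma gauss_eq_None: "gauss D t = None \<longleftrightarrow> (\<forall>s. crosses D s t \<longrightarrow> s \<notin> over D)"
  by (auto simp: gauss_def Let_def)

lemma crossing_sign_nonzero:
  assumes D: "knotoid_diagram S D" and c: "crosses D s t"
  shows "vol (curve D t) (vel D s) (vel D t) \<noteq> 0"
proof (rule vol_nondegenerate)
  note i = crosses_interior[OF D c] and sm = diagram_smooth[OF D]
  have i': "s \<in> {0..1}" "t \<in> {0..1}" using i by auto
  have eq: "curve D s = curve D t" using c by (simp add: crosses_def)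
  show "tangent S (curve D t) (vel D s)" unfolding eq[symmetric]
    by (rule tangent_curve[OF diagram_has_velocity[OF D i'(1)] i(1) sm(2)])
  show "tangent S (curve D t) (vel D t)"
    by (rule tangent_curve[OF diagram_has_velocity[OF D i'(2)] i(2) sm(2)])
  show "curve D t \<in> S" using sm i' by auto
  show "indep2 (vel D s) (vel D t)" by (rule crosses_indep[OF D c])
qed

text \<open>During the isotopy the velocities of the two strands at the crossing move continuously, and they stay independent because
  the inverse diffeomorphism maps them back to the original ones. So the area that they span keeps its sign.\<close>

lemma isotopy_crossing_sign:
  assumes D: "knotoid_diagram S D" and H: "ambient_isotopy S H"
    and E: "\<And>t. t \<in> {0..1} \<Longrightarrow> curve E t = H 1 (curve D t)" and c: "crosses D s t"
  shows "crossing_sign E s t = crossing_sign D s t"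
proof -
  define \<gamma> where "\<gamma> = curve D"
  note st = crosses_interior[OF D c]
  have st01: "s \<in> {0..1}" "t \<in> {0..1}" and eq: "\<gamma> s = \<gamma> t" using c by (auto simp: crosses_def \<gamma>_def)
  have \<gamma>S: "\<gamma> u \<in> S" if "u \<in> {0..1}" for u using diagram_smooth(2)[OF D] that by (auto simp: \<gamma>_def)
  have d\<gamma>: "(\<gamma> has_vector_derivative velocity \<gamma> r) (at r within {0..1})" if "r \<in> {0..1}" for r
    using diagram_has_velocity[OF D that] by (simp add: \<gamma>_def)
  have Hs: "smooth_on ({0..1} \<times> S) (\<lambda>(\<tau>, x). H \<tau> x)" and Hd: "\<And>\<tau>. \<tau> \<in> {0..1} \<Longrightarrow> diffeo S S (H \<tau>)" and H0: "\<And>x. x \<in> S \<Longrightarrow> H 0 x = x"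
    using H by (auto simp: ambient_isotopy_def)
  define V where "V = (\<lambda>r \<tau>. velocity (\<lambda>u. H \<tau> (\<gamma> u)) r)"
  have loc: "\<exists>W M. open W \<and> \<tau>0 \<in> W \<and> continuous_on W M \<and> (\<forall>\<tau>\<in>{0..1} \<inter> W.
      ((\<lambda>u. H \<tau> (\<gamma> u)) has_vector_derivative M \<tau>) (at r within {0..1}))"
    if r: "r \<in> {0..1}" and \<tau>0: "\<tau>0 \<in> {0..1}" for r \<tau>0
  proof -
    have in_prod: "(\<tau>0, \<gamma> r) \<in> {0..1} \<times> S" using \<gamma>S r \<tau>0 by auto
    obtain U L where U: "open U" "(\<tau>0, \<gamma> r) \<in> U" "\<And>v. continuous_on U (\<lambda>y. L y v)" and
      push: "\<And>g r T v. g r \<in> U \<Longrightarrow> g r \<in> {0..1} \<times> S \<Longrightarrow> (g has_vector_derivative v) (at (r::real) within T) \<Longrightarrow>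
        \<forall>\<^sub>F u in at r within T. g u \<in> {0..1} \<times> S \<Longrightarrow> r \<in> T \<Longrightarrow>
        ((\<lambda>u. (\<lambda>(\<tau>, x). H \<tau> x) (g u)) has_vector_derivative L (g r) v) (at r within T)"
      using smooth_on_push[OF Hs in_prod] by metis
    define W where "W = (\<lambda>\<tau>. (\<tau>, \<gamma> r)) -` U"
    show ?thesis
    proof (intro exI[of _ W] exI[of _ "\<lambda>\<tau>. L (\<tau>, \<gamma> r) (0, velocity \<gamma> r)"] conjI ballI)
      show "open W" unfolding W_def using U by (intro open_vimage continuous_intros)
      show "\<tau>0 \<in> W" using U by (simp add: W_def)
      show "continuous_on W (\<lambda>\<tau>. L (\<tau>, \<gamma> r) (0, velocity \<gamma> r))"
        by (rule continuous_on_compose2[OF U(3)]) (auto simp: W_def intro!: continuous_intros)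
      fix \<tau> assume \<tau>: "\<tau> \<in> {0..1} \<inter> W"
      have d: "((\<lambda>u. (\<tau>, \<gamma> u)) has_vector_derivative (0, velocity \<gamma> r)) (at r within {0..1})"
        by (intro has_vector_derivative_Pair d\<gamma> r has_vector_derivative_const)
      have "((\<lambda>u. (\<lambda>(\<tau>, x). H \<tau> x) (\<tau>, \<gamma> u)) has_vector_derivative L (\<tau>, \<gamma> r) (0, velocity \<gamma> r)) (at r within {0..1})"
        by (rule push[OF _ _ d]) (use \<tau> r \<gamma>S in \<open>auto simp: W_def intro!: eventually_within\<close>)
      then show "((\<lambda>u. H \<tau> (\<gamma> u)) has_vector_derivative L (\<tau>, \<gamma> r) (0, velocity \<gamma> r)) (at r within {0..1})"
        by simp
    qed
  qed
  have dV: "((\<lambda>u. H \<tau> (\<gamma> u)) has_vector_derivative V r \<tau>) (at r within {0..1})" if "r \<in> {0..1}" "\<tau> \<in> {0..1}" for r \<tau>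
    using loc[OF that] that unfolding V_def by (metis IntI has_velocity_unique)
  have contV: "continuous_on {0..1} (V r)" if r: "r \<in> {0..1}" for r
  proof (rule continuous_on_local)
    fix \<tau>0 :: real assume "\<tau>0 \<in> {0..1}"
    from loc[OF r this] obtain W M where W: "open W" "\<tau>0 \<in> W" "continuous_on W M"
      "\<And>\<tau>. \<tau> \<in> {0..1} \<inter> W \<Longrightarrow> ((\<lambda>u. H \<tau> (\<gamma> u)) has_vector_derivative M \<tau>) (at r within {0..1})" by blast
    have "V r \<tau> = M \<tau>" if "\<tau> \<in> {0..1} \<inter> W" for \<tau>
      unfolding V_def using W(4)[OF that] r by (rule has_velocity_unique)
    then have "continuous_on ({0..1} \<inter> W) (V r)"
      using W(3) by (subst continuous_on_cong[of _ "{0..1} \<inter> W" _ M]) (auto intro: continuous_on_subset)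
    with W show "\<exists>U. open U \<and> \<tau>0 \<in> U \<and> continuous_on ({0..1} \<inter> U) (V r)" by blast
  qed
  define J where "J = (\<lambda>\<tau>. vol (H \<tau> (\<gamma> t)) (V s \<tau>) (V t \<tau>))"
  have "continuous_on {0..1} ((\<lambda>(\<tau>, x). H \<tau> x) \<circ> (\<lambda>\<tau>. (\<tau>, \<gamma> t)))"
    by (intro continuous_on_compose continuous_on_subset[OF smooth_on_imp_continuous_on[OF Hs]] continuous_intros)
       (use \<gamma>S st01 in auto)
  then have contJ: "continuous_on {0..1} J"
    unfolding J_def using contV st01 by (intro continuous_on_vol) (simp_all add: comp_def)
  have nzJ: "J \<tau> \<noteq> 0" if \<tau>: "\<tau> \<in> {0..1}" for \<tau>
    unfolding J_def
  proof (rule vol_nondegenerate)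
    have bij: "bij_betw (H \<tau>) S S" and K: "smooth_on S (inv_into S (H \<tau>))" using Hd[OF \<tau>] by (auto simp: diffeo_def)
    have HS: "H \<tau> x \<in> S" if "x \<in> S" for x using bij that by (auto simp: bij_betw_def)
    have KH: "inv_into S (H \<tau>) (H \<tau> x) = x" if "x \<in> S" for x using bij that by (auto simp: bij_betw_def)
    have im: "(\<lambda>u. H \<tau> (\<gamma> u)) ` {0..1} \<subseteq> S" using HS \<gamma>S by auto
    show "H \<tau> (\<gamma> t) \<in> S" using im st01 by auto
    show "tangent S (H \<tau> (\<gamma> t)) (V t \<tau>)"
      by (rule tangent_curve[OF dV[OF st01(2) \<tau>] st(2) im])
    show "tangent S (H \<tau> (\<gamma> t)) (V s \<tau>)"
      using tangent_curve[OF dV[OF st01(1) \<tau>] st(1) im] eq by simp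
    obtain U L where U: "open U" "H \<tau> (\<gamma> t) \<in> U" "\<And>y. y \<in> U \<Longrightarrow> linear (L y)" and
      push: "\<And>g r T v. g r \<in> U \<Longrightarrow> g r \<in> S \<Longrightarrow> (g has_vector_derivative v) (at (r::real) within T) \<Longrightarrow>
        \<forall>\<^sub>F u in at r within T. g u \<in> S \<Longrightarrow> r \<in> T \<Longrightarrow>
        ((\<lambda>u. inv_into S (H \<tau>) (g u)) has_vector_derivative L (g r) v) (at r within T)"
      using smooth_on_push[OF K \<open>H \<tau> (\<gamma> t) \<in> S\<close>] by metis
    have LV: "L (H \<tau> (\<gamma> t)) (V r \<tau>) = velocity \<gamma> r" if r: "r \<in> {s, t}" for r
    proof -
      have r01: "r \<in> {0..1}" and \<gamma>r: "\<gamma> r = \<gamma> t" using r st01 eq by auto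
      have "((\<lambda>u. inv_into S (H \<tau>) (H \<tau> (\<gamma> u))) has_vector_derivative L (H \<tau> (\<gamma> r)) (V r \<tau>)) (at r within {0..1})"
        by (rule push[OF _ _ dV[OF r01 \<tau>]]) (use U \<gamma>r HS \<gamma>S r01 st01 in \<open>auto intro!: eventually_within\<close>)
      then have "(\<gamma> has_vector_derivative L (H \<tau> (\<gamma> r)) (V r \<tau>)) (at r within {0..1})"
        by (rule has_vector_derivative_transform[rotated 2]) (use r01 KH \<gamma>S in auto)
      from has_velocity_unique[OF this r01] \<gamma>r show ?thesis by simp
    qed
    show "indep2 (V s \<tau>) (V t \<tau>)"
    proof (rule indep2_linear_preimage[OF U(3)[OF U(2)]])
      have "L (H \<tau> (\<gamma> t)) (V s \<tau>) = vel D s" "L (H \<tau> (\<gamma> t)) (V t \<tau>) = vel D t"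
        using LV[of s] LV[of t] unfolding \<gamma>_def by blast+
      then show "indep2 (L (H \<tau> (\<gamma> t)) (V s \<tau>)) (L (H \<tau> (\<gamma> t)) (V t \<tau>))"
        using crosses_indep[OF D c] by (simp only:)
    qed
  qed
  have "J 0 > 0 \<longleftrightarrow> J 1 > 0"
    by (rule connected_same_sign[OF _ contJ nzJ]) (auto simp: connected_Icc)
  moreover have "V r 0 = velocity \<gamma> r" if "r \<in> {0..1}" for r
  proof -
    have "((\<lambda>u. H 0 (\<gamma> u)) has_vector_derivative velocity \<gamma> r) (at r within {0..1})"
      using d\<gamma>[OF that] by (rule has_vector_derivative_transform[rotated 2]) (use that H0 \<gamma>S in auto)
    from has_velocity_unique[OF this that] show ?thesis by (simp add: V_def)
  qed
  moreover have "vel E r = V r 1" if "r \<in> {0..1}" for r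
  proof -
    have "(curve E has_vector_derivative V r 1) (at r within {0..1})"
      using dV[OF that, of 1] by (rule has_vector_derivative_transform[rotated 2]) (use that E in \<open>auto simp: \<gamma>_def\<close>)
    from has_velocity_unique[OF this that] show ?thesis .
  qed
  ultimately show ?thesis
    using E st01 H0 \<gamma>S by (simp add: crossing_sign_def J_def \<gamma>_def)
qed

lemma gauss_isotopy:
  assumes D: "knotoid_diagram S D" and E: "knotoid_diagram S E" and H: "ambient_isotopy S H"
    and eq: "\<And>t. t \<in> {0..1} \<Longrightarrow> curve E t = H 1 (curve D t)" and over: "over E = over D"
  shows "gauss E = gauss D"
proof -
  have inj: "inj_on (H 1) S" using H by (auto simp: ambient_isotopy_def diffeo_def bij_betw_def)
  have cr: "crosses E s t \<longleftrightarrow> crosses D s t" for s t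
    using inj diagram_smooth(2)[OF D] eq unfolding crosses_def inj_on_def by (metis image_subset_iff)
  have "gauss E t = Some (e, s) \<longleftrightarrow> gauss D t = Some (e, s)" for t e s
    unfolding gauss_eq_Some[OF D] gauss_eq_Some[OF E] cr over
    using isotopy_crossing_sign[OF D H eq] by auto
  then show ?thesis by (intro ext) (metis not_None_eq surj_pair)
qed

end

lemma reparametrization_mono:
  fixes \<psi> :: "real \<Rightarrow> real"
  assumes "diffeo {0..1} {0..1} \<psi>" "\<psi> 0 = (0::real)"
  shows "continuous_on {0..1} \<psi>" "\<psi> ` {0..1} = {0..1}" "strict_mono_on {0..1} \<psi>" "\<psi> 1 = 1"
proof -
  show c: "continuous_on {0..1} \<psi>" using assms by (auto simp: diffeo_def smooth_on_imp_continuous_on)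
  have bij: "bij_betw \<psi> {0..1} {0..1}" using assms by (simp add: diffeo_def)
  then show im: "\<psi> ` {0..1} = {0..1}" by (simp add: bij_betw_def)
  have in01: "\<psi> x \<in> {0..1}" if "x \<in> {0..1}" for x using im that by blast
  from bij have "inj_on \<psi> {0..1}" by (simp add: bij_betw_def)
  then have "strict_mono_on {0..1} \<psi> \<or> strict_antimono_on {0..1} \<psi>"
    using injective_eq_monotone_map[of "{0..1}" \<psi>] c by (auto simp: is_interval_cc)
  moreover have "\<not> strict_antimono_on {0..1} \<psi>"
  proof
    assume "strict_antimono_on {0..1} \<psi>"
    then have "\<psi> 1 < \<psi> 0" by (rule monotone_onD) auto
    then show False using in01[of 1] assms(2) by simp
  qed
  ultimately show mono: "strict_mono_on {0..1} \<psi>" by simp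
  show "\<psi> 1 = 1"
  proof -
    have "(1::real) \<in> \<psi> ` {0..1}" unfolding im by simp
    then obtain x where x: "x \<in> {0..1}" "\<psi> x = 1" by auto
    then have "\<psi> x \<le> \<psi> 1" using strict_mono_on_leD[OF mono, of x 1] by auto
    then show ?thesis using x in01[of 1] by auto
  qed
qed

lemma diffeo_inverse:
  assumes "diffeo A B f" shows "diffeo B A (inv_into A f)"
proof -
  have bij: "bij_betw f A B" using assms by (simp add: diffeo_def)
  have "smooth_on A (inv_into B (inv_into A f))"
    using assms inv_into_inv_into_eq[OF bij] unfolding diffeo_def smooth_on_def by (metis IntD2)
  then show ?thesis using assms bij_betw_inv_into[OF bij] by (simp add: diffeo_def)
qed

context quandle begin

lemma colorable_reparametrization:
  assumes c\<psi>: "continuous_on {0..1} \<psi>" and mono: "strict_mono_on {0..1} \<psi>" and \<psi>01: "\<psi> 0 = (0::real)" "\<psi> 1 = (1::real)"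
    and g: "\<And>t. t \<in> {0..1} \<Longrightarrow> g' t = None \<Longrightarrow> g (\<psi> t) = None"
      "\<And>t e s. t \<in> {0..1} \<Longrightarrow> g' t = Some (e, s) \<Longrightarrow> g (\<psi> t) = Some (e, \<psi> s)"
    and col: "colorable g p q"
  shows "colorable g' p q"
proof -
  obtain c where c: "coloring_on g c 0 1" "c 0 = p" "c 1 = q" using col by (auto simp: colorable_def)
  have less: "\<psi> x < \<psi> y" if "x \<in> {0..1}" "y \<in> {0..1}" "x < y" for x y
    using strict_mono_onD[OF mono that] .
  have lim: "(\<psi> \<longlongrightarrow> \<psi> t) (at t within {0..1})" if "t \<in> {0..1}" for t
    using c\<psi> that by (simp add: continuous_on)
  have left: "\<forall>\<^sub>F x in at_left t. P (\<psi> x)" if t: "t \<in> {0<..1}" and P: "\<forall>\<^sub>F y in at_left (\<psi> t). P y" for t P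
  proof -
    have F: "at_left t = at t within {0..<t}" using t by (intro at_within_nhd[of t "{0<..}"]) auto
    have "filterlim \<psi> (at_left (\<psi> t)) (at t within {0..<t})"
      unfolding filterlim_at
    proof
      show "\<forall>\<^sub>F x in at t within {0..<t}. \<psi> x \<in> {..<\<psi> t} \<and> \<psi> x \<noteq> \<psi> t"
        by (rule eventually_within) (use less t in force)
      show "(\<psi> \<longlongrightarrow> \<psi> t) (at t within {0..<t})"
        by (rule tendsto_within_subset[OF lim]) (use t in auto)
    qed
    then show ?thesis using P unfolding F filterlim_iff by blast
  qed
  have right: "\<forall>\<^sub>F x in at_right t. P (\<psi> x)" if t: "t \<in> {0..<1}" and P: "\<forall>\<^sub>F y in at_right (\<psi> t). P y" for t P
  proof -
    have F: "at_right t = at t within {t<..1}" using t by (intro at_within_nhd[of t "{..<1}"]) auto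
    have "filterlim \<psi> (at_right (\<psi> t)) (at t within {t<..1})"
      unfolding filterlim_at
    proof
      show "\<forall>\<^sub>F x in at t within {t<..1}. \<psi> x \<in> {\<psi> t<..} \<and> \<psi> x \<noteq> \<psi> t"
        by (rule eventually_within) (use less t in force)
      show "(\<psi> \<longlongrightarrow> \<psi> t) (at t within {t<..1})"
        by (rule tendsto_within_subset[OF lim]) (use t in auto)
    qed
    then show ?thesis using P unfolding F filterlim_iff by blast
  qed
  have "coloring_on g' (c \<circ> \<psi>) 0 1"
    unfolding coloring_on_def
  proof safe
    fix t :: real assume t: "t \<in> {0<..1}"
    then have "\<psi> t \<in> {0<..1}" using less[of 0 t] less[of t 1] \<psi>01 by (cases "t = 1") auto
    then have "\<forall>\<^sub>F y in at_left (\<psi> t). c y = c (\<psi> t)" using c by (auto simp: coloring_on_def)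
    from left[OF t this] show "\<forall>\<^sub>F x in at_left t. (c \<circ> \<psi>) x = (c \<circ> \<psi>) t" by simp
  next
    fix t :: real assume t: "t \<in> {0..<1}"
    then have "\<psi> t \<in> {0..<1}" using less[of 0 t] less[of t 1] \<psi>01 by (cases "t = 0") auto
    then have "\<forall>\<^sub>F y in at_right (\<psi> t). c y = passed g c (\<psi> t)" using c by (auto simp: coloring_on_def)
    from right[OF t this] have *: "\<forall>\<^sub>F x in at_right t. (c \<circ> \<psi>) x = passed g c (\<psi> t)" by simp
    have "passed g c (\<psi> t) = passed g' (c \<circ> \<psi>) t"
    proof (cases "g' t")
      case None
      then show ?thesis using g(1)[of t] t by (simp add: passed_def)
    next
      case (Some es)
      obtain e s where "es = (e, s)" by (cases es)
      then show ?thesis using Some g(2)[of t e s] t by (simp add: passed_def)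
    qed
    with * show "\<forall>\<^sub>F x in at_right t. (c \<circ> \<psi>) x = passed g' (c \<circ> \<psi>) t" by simp
  qed
  then show ?thesis using c \<psi>01 by (auto simp: colorable_def intro!: exI[of _ "c \<circ> \<psi>"])
qed

end

context oriented_surface begin

text \<open>A reparametrization that fixes \<open>0\<close> is increasing. So it multiplies velocities by positive numbers, zero being
  excluded as both curves are immersed.\<close>

lemma gauss_reparametrization:
  assumes D: "knotoid_diagram S D" and E: "knotoid_diagram S E" and \<psi>: "diffeo {0..1} {0..1} \<psi>" "\<psi> 0 = 0"
    and eq: "\<And>t. t \<in> {0..1} \<Longrightarrow> curve E t = curve D (\<psi> t) \<and> (t \<in> over E \<longleftrightarrow> \<psi> t \<in> over D)" and t: "t \<in> {0..1}"
  shows "gauss E t = None \<Longrightarrow> gauss D (\<psi> t) = None"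
    and "gauss E t = Some (e, s) \<Longrightarrow> gauss D (\<psi> t) = Some (e, \<psi> s)"
proof -
  note r = reparametrization_mono[OF \<psi>]
  have in01: "\<psi> x \<in> {0..1}" if "x \<in> {0..1}" for x using r(2) that by blast
  have inj: "inj_on \<psi> {0..1}" using \<psi> by (simp add: diffeo_def bij_betw_def)
  have cr: "crosses D (\<psi> s) (\<psi> t)" if "crosses E s t" for s t
  proof -
    have st: "s \<in> {0..1}" "t \<in> {0..1}" "s \<noteq> t" "curve E s = curve E t" using that unfolding crosses_def by blast+
    then have "\<psi> s \<noteq> \<psi> t" using inj by (meson inj_onD)
    moreover have "curve D (\<psi> s) = curve D (\<psi> t)" using st(4) eq[OF st(1)] eq[OF st(2)] by simp
    ultimately show ?thesis using in01 st(1,2) unfolding crosses_def by blast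
  qed
  show "gauss D (\<psi> t) = None" if none: "gauss E t = None"
    unfolding gauss_eq_None
  proof (intro allI impI)
    fix s assume s: "crosses D s (\<psi> t)"
    then have "s \<in> \<psi> ` {0..1}" using r(2) by (simp add: crosses_def)
    then obtain s' where s': "s' \<in> {0..1}" "s = \<psi> s'" by auto
    then have "crosses E s' t" using s t eq by (auto simp: crosses_def)
    then have "s' \<notin> over E" using none by (auto simp: gauss_eq_None)
    then show "s \<notin> over D" using s' eq by auto
  qed
  assume "gauss E t = Some (e, s)"
  then have *: "crosses E s t" "s \<in> over E" "e = crossing_sign E s t" using gauss_eq_Some[OF E] by blast+
  have sd: "\<exists>k>0. vel E u = k *\<^sub>R vel D (\<psi> u)" if u: "u \<in> {0<..<1}" for u
  proof -
    have u01: "u \<in> {0..1}" using u by auto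
    have dpsi: "(\<psi> has_vector_derivative velocity \<psi> u) (at u within {0..1})"
      using \<psi> u01 by (intro smooth_curve_has_velocity) (auto simp: diffeo_def)
    have "(curve D \<circ> \<psi> has_vector_derivative velocity \<psi> u *\<^sub>R vel D (\<psi> u)) (at u within {0..1})"
      by (rule vector_diff_chain_within[OF dpsi]) (use diagram_has_velocity[OF D in01[OF u01]] r(2) in simp)
    then have "(curve E has_vector_derivative velocity \<psi> u *\<^sub>R vel D (\<psi> u)) (at u within {0..1})"
      by (rule has_vector_derivative_transform[rotated 2]) (use u01 eq in auto)
    from has_velocity_unique[OF this u01] have v: "vel E u = velocity \<psi> u *\<^sub>R vel D (\<psi> u)" .
    have "vel E u \<noteq> 0" using E u01 by (auto simp: knotoid_diagram_def generic_immersion_def)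
    then have "velocity \<psi> u \<noteq> 0" using v by auto
    moreover have "\<not> velocity \<psi> u < 0"
    proof
      assume neg: "velocity \<psi> u < 0"
      have "(\<psi> has_real_derivative velocity \<psi> u) (at u within {0..1})"
        using dpsi by (simp add: has_real_derivative_iff_has_vector_derivative)
      from has_real_derivative_neg_dec_right[OF this neg] obtain d where
        d: "d > 0" "\<And>h. h > 0 \<Longrightarrow> u + h \<in> {0..1} \<Longrightarrow> h < d \<Longrightarrow> \<psi> (u + h) < \<psi> u" by blast
      define h where "h = min (d / 2) (1 - u)"
      have h: "h > 0" "u + h \<in> {0..1}" "h < d" using d(1) u by (auto simp: h_def min_def)
      have "\<psi> u < \<psi> (u + h)" using strict_mono_onD[OF r(3), of u "u + h"] h u01 by auto
      with d(2)[OF h] show False by simp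
    qed
    ultimately show ?thesis using v by (intro exI[of _ "velocity \<psi> u"]) auto
  qed
  note i = crosses_interior[OF E *(1)]
  obtain k1 where k1: "k1 > 0" "vel E s = k1 *\<^sub>R vel D (\<psi> s)" using sd[OF i(1)] by blast
  obtain k2 where k2: "k2 > 0" "vel E t = k2 *\<^sub>R vel D (\<psi> t)" using sd[OF i(2)] by blast
  have "k1 * k2 > 0" using k1(1) k2(1) by simp
  then have "crossing_sign E s t = crossing_sign D (\<psi> s) (\<psi> t)"
    unfolding crossing_sign_def k1(2) k2(2) vol_scale conjunct1[OF eq[OF t]]
    by (meson mult_pos_pos zero_less_mult_pos)
  moreover have "\<psi> s \<in> over D" using *(2) eq[of s] i(1) by auto
  ultimately show "gauss D (\<psi> t) = Some (e, \<psi> s)"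
    using *(3) cr[OF *(1)] by (simp add: gauss_eq_Some[OF D])
qed

end

section \<open>The disk of a Reidemeister move\<close>

definition cx :: "real^2 \<Rightarrow> complex" where "cx p = Complex (p $ 1) (p $ 2)"

lemma cx_linear: "linear cx"
  by (rule linearI) (simp_all add: cx_def complex_eq_iff)

lemma cmod_cx [simp]: "cmod (cx p) = norm p"
  by (simp add: cx_def cmod_def norm_vec_def L2_set_def sum_2)

lemma cx_inj: "inj cx"
  by (auto simp: inj_def cx_def vec_eq_iff forall_2)

lemma vec2_expand: "(p :: real^2) = (p $ 1) *\<^sub>R axis 1 1 + (p $ 2) *\<^sub>R axis 2 1"
  by (simp add: vec_eq_iff forall_2 axis_def)

lemma has_vector_derivative_cx: "(f has_vector_derivative v) F \<Longrightarrow> ((\<lambda>u. cx (f u)) has_vector_derivative cx v) F"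
  using bounded_linear.has_vector_derivative[OF linear_conv_bounded_linear[THEN iffD1, OF cx_linear]] .

definition curve_in :: "'a set \<Rightarrow> 'a::real_normed_vector \<Rightarrow> (real \<Rightarrow> 'a) \<Rightarrow> real \<Rightarrow> 'a \<Rightarrow> bool" where
  "curve_in B y \<gamma> r v \<longleftrightarrow> \<gamma> r = y \<and> (\<gamma> has_vector_derivative v) (at r) \<and> (\<forall>\<^sub>F u in nhds r. \<gamma> u \<in> B)"

text \<open>The chart \<open>\<xi>\<close> identifies the disk of a move with the unit disk in the complex plane, where the topological results
  apply. The embedding may reverse the orientation, but it does so everywhere or nowhere as the disk is connected; \<open>\<eta>\<close> records
  which. Areas of pairs of velocities are multiplied by \<open>\<eta>\<close> and a positive factor.\<close>

lemma (in oriented_surface) disk_chart: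
  assumes \<phi>: "smooth_disk S \<phi>"
  obtains \<xi> :: "'a \<Rightarrow> complex" and \<eta> :: real where "\<eta> = 1 \<or> \<eta> = - 1" "inj_on \<xi> (\<phi> ` cball 0 1)"
    "continuous_on (\<phi> ` cball 0 1) \<xi>"
    "\<And>y. y \<in> \<phi> ` cball 0 1 \<Longrightarrow> cmod (\<xi> y) \<le> 1"
    "\<And>y. y \<in> \<phi> ` cball 0 1 \<Longrightarrow> y \<in> \<phi> ` ball 0 1 \<longleftrightarrow> cmod (\<xi> y) < 1"
    "\<And>y. y \<in> \<phi> ` ball 0 1 \<Longrightarrow> \<exists>M. (\<forall>\<gamma> r v. curve_in (\<phi> ` ball 0 1) y \<gamma> r v \<longrightarrow> ((\<lambda>u. \<xi> (\<gamma> u)) has_vector_derivative M v) (at r)) \<and>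
       (\<exists>\<kappa>>0. \<forall>\<gamma> r v \<delta> q w. curve_in (\<phi> ` ball 0 1) y \<gamma> r v \<longrightarrow> curve_in (\<phi> ` ball 0 1) y \<delta> q w \<longrightarrow>
          vol y v w = \<eta> * \<kappa> * Im (cnj (M v) * M w))"
proof -
  obtain U where U: "open U" "cball 0 1 \<subseteq> U" "\<phi> ` U \<subseteq> S" and d: "diffeo U (\<phi> ` U) \<phi>"
    using \<phi> by (auto simp: smooth_disk_def)
  define K where "K = inv_into U \<phi>"
  have inj: "inj_on \<phi> U" and s\<phi>: "smooth_on U \<phi>" and sK: "smooth_on (\<phi> ` U) K"
    using d by (auto simp: diffeo_def bij_betw_def K_def)
  have K\<phi>: "K (\<phi> p) = p" if "p \<in> U" for p using inj that by (simp add: K_def)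
  have \<phi>K: "\<phi> (K y) = y" "K y \<in> U" if "y \<in> \<phi> ` U" for y
    using that by (auto simp: K_def f_inv_into_f inv_into_into)
  define F where "F = (\<lambda>i p. vector_derivative (\<lambda>r. \<phi> (p + r *\<^sub>R axis i 1)) (at 0))"
  define J where "J = (\<lambda>p. vol (\<phi> p) (F 1 p) (F 2 p))"
  have evU: "\<forall>\<^sub>F r in nhds 0. p + r *\<^sub>R e \<in> U" if "p \<in> U" for p e :: "real^2"
  proof -
    have "((\<lambda>r::real. p + r *\<^sub>R e) \<longlongrightarrow> p + 0 *\<^sub>R e) (nhds 0)" by (intro tendsto_intros filterlim_ident)
    then show ?thesis using topological_tendstoD U(1) that by fastforce
  qed
  have push\<phi>: "\<exists>N L. open N \<and> p0 \<in> N \<and> N \<subseteq> U \<and> (\<forall>p\<in>N. linear (L p)) \<and> (\<forall>v. continuous_on N (\<lambda>p. L p v)) \<and>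
     (\<forall>g r v. g r \<in> N \<longrightarrow> (g has_vector_derivative v) (at (r::real)) \<longrightarrow> (\<forall>\<^sub>F u in nhds r. g u \<in> U) \<longrightarrow>
        ((\<lambda>u. \<phi> (g u)) has_vector_derivative L (g r) v) (at r))" if p0: "p0 \<in> U" for p0
  proof -
    from smooth_on_push[OF s\<phi> p0] obtain N L where N: "open N" "p0 \<in> N" "\<And>y. y \<in> N \<Longrightarrow> linear (L y)"
      "\<And>v. continuous_on N (\<lambda>y. L y v)"
      "\<And>(g :: real \<Rightarrow> real^2) r T v. g r \<in> N \<Longrightarrow> g r \<in> U \<Longrightarrow> (g has_vector_derivative v) (at r within T) \<Longrightarrow>
       \<forall>\<^sub>F u in at r within T. g u \<in> U \<Longrightarrow> r \<in> T \<Longrightarrow> ((\<lambda>u. \<phi> (g u)) has_vector_derivative L (g r) v) (at r within T)"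
      by metis
    show ?thesis
    proof (intro exI[of _ "N \<inter> U"] exI[of _ L] conjI ballI allI impI)
      show "continuous_on (N \<inter> U) (\<lambda>p. L p v)" for v using N(4) by (rule continuous_on_subset) auto
      fix g :: "real \<Rightarrow> real^2" and r v
      assume "g r \<in> N \<inter> U" "(g has_vector_derivative v) (at r)" "\<forall>\<^sub>F u in nhds r. g u \<in> U"
      then show "((\<lambda>u. \<phi> (g u)) has_vector_derivative L (g r) v) (at r)"
        by (intro N(5)) (auto simp: eventually_at_filter elim: eventually_mono)
    qed (use N U p0 in auto)
  qed
  have pushK: "\<exists>M. linear M \<and> (\<forall>g r v. curve_in (\<phi> ` U) y g r v \<longrightarrow> ((\<lambda>u. K (g u)) has_vector_derivative M v) (at r))"
    if y: "y \<in> \<phi> ` U" for y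
  proof -
    from smooth_on_push[OF sK y] obtain N L where N: "open N" "y \<in> N" "\<And>y. y \<in> N \<Longrightarrow> linear (L y)"
      "\<And>(g :: real \<Rightarrow> 'a) r T v. g r \<in> N \<Longrightarrow> g r \<in> \<phi> ` U \<Longrightarrow> (g has_vector_derivative v) (at r within T) \<Longrightarrow>
       \<forall>\<^sub>F u in at r within T. g u \<in> \<phi> ` U \<Longrightarrow> r \<in> T \<Longrightarrow> ((\<lambda>u. K (g u)) has_vector_derivative L (g r) v) (at r within T)"
      by metis
    show ?thesis
    proof (intro exI[of _ "L y"] conjI allI impI)
      show "linear (L y)" using N by blast
      fix g :: "real \<Rightarrow> 'a" and r v assume g: "curve_in (\<phi> ` U) y g r v"
      have "((\<lambda>u. K (g u)) has_vector_derivative L (g r) v) (at r)"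
        by (rule N(4)) (use g N(2) y in \<open>auto simp: curve_in_def eventually_at_filter elim: eventually_mono\<close>)
      then show "((\<lambda>u. K (g u)) has_vector_derivative L y v) (at r)" using g by (simp add: curve_in_def)
    qed
  qed
  have dline: "((\<lambda>r::real. p + r *\<^sub>R e) has_vector_derivative e) (at 0)" for p e :: "real^2"
    by (auto intro!: derivative_eq_intros)
  have FL: "F i p = L p (axis i 1)" "((\<lambda>r. \<phi> (p + r *\<^sub>R axis i 1)) has_vector_derivative F i p) (at 0)"
    if "p \<in> N" "N \<subseteq> U" and L: "\<forall>g r v. g r \<in> N \<longrightarrow> (g has_vector_derivative v) (at (r::real)) \<longrightarrow> (\<forall>\<^sub>F u in nhds r. g u \<in> U) \<longrightarrow>
        ((\<lambda>u. \<phi> (g u)) has_vector_derivative L (g r) v) (at r)" for N L p i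
  proof -
    have "((\<lambda>r. \<phi> (p + r *\<^sub>R axis i 1)) has_vector_derivative L (p + 0 *\<^sub>R axis i 1) (axis i 1)) (at 0)"
      using L[rule_format, of "\<lambda>r. p + r *\<^sub>R axis i 1" 0 "axis i 1"] evU[of p] that dline by auto
    then show "F i p = L p (axis i 1)" "((\<lambda>r. \<phi> (p + r *\<^sub>R axis i 1)) has_vector_derivative F i p) (at 0)"
      by (auto simp: F_def vector_derivative_at)
  qed
  have contF: "continuous_on U (F i)" for i
  proof (rule continuous_on_local)
    fix p0 assume "p0 \<in> U"
    then obtain N L where N: "open N" "p0 \<in> N" "N \<subseteq> U" "\<And>v. continuous_on N (\<lambda>p. L p v)" and
      L: "\<forall>g r v. g r \<in> N \<longrightarrow> (g has_vector_derivative v) (at (r::real)) \<longrightarrow> (\<forall>\<^sub>F u in nhds r. g u \<in> U) \<longrightarrow>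
        ((\<lambda>u. \<phi> (g u)) has_vector_derivative L (g r) v) (at r)" using push\<phi> by metis
    have "continuous_on (U \<inter> N) (F i)"
      using FL(1)[OF _ N(3) L] N(4)
      by (subst continuous_on_cong[of _ "U \<inter> N" _ "\<lambda>p. L p (axis i 1)"]) (auto intro: continuous_on_subset)
    with N show "\<exists>N. open N \<and> p0 \<in> N \<and> continuous_on (U \<inter> N) (F i)" by blast
  qed
  have contJ: "continuous_on U J"
    unfolding J_def by (intro continuous_on_vol contF smooth_on_imp_continuous_on[OF s\<phi>])
  have nzJ: "J p \<noteq> 0" if p: "p \<in> U" for p
    unfolding J_def
  proof (rule vol_nondegenerate)
    obtain N L where N: "open N" "p \<in> N" "N \<subseteq> U" "\<And>v. continuous_on N (\<lambda>p. L p v)" and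
      L: "\<forall>g r v. g r \<in> N \<longrightarrow> (g has_vector_derivative v) (at (r::real)) \<longrightarrow> (\<forall>\<^sub>F u in nhds r. g u \<in> U) \<longrightarrow>
        ((\<lambda>u. \<phi> (g u)) has_vector_derivative L (g r) v) (at r)" using push\<phi>[OF p] by metis
    note dF = FL(2)[OF N(2,3) L]
    show "\<phi> p \<in> S" using p U by auto
    have ev: "\<forall>\<^sub>F r in nhds 0. \<phi> (p + r *\<^sub>R axis i 1) \<in> \<phi> ` U" for i
      using evU[OF p] by (rule eventually_mono) auto
    then have evS: "\<forall>\<^sub>F r in nhds 0. \<phi> (p + r *\<^sub>R axis i 1) \<in> S" for i
      by (rule eventually_mono) (use U in auto)
    have tan: "tangent S (\<phi> p) (F i p)" for i
      unfolding tangent_def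
      by (intro exI[of _ "\<lambda>r. \<phi> (p + r *\<^sub>R axis i 1)"] exI[of _ 0] conjI dF evS) simp
    show "tangent S (\<phi> p) (F 1 p)" "tangent S (\<phi> p) (F 2 p)" by (rule tan)+
    obtain M where M: "linear M" "\<And>g r v. curve_in (\<phi> ` U) (\<phi> p) g r v \<Longrightarrow> ((\<lambda>u. K (g u)) has_vector_derivative M v) (at r)"
      using pushK[of "\<phi> p"] p by blast
    have MF: "M (F i p) = axis i 1" for i
    proof -
      have "((\<lambda>r. K (\<phi> (p + r *\<^sub>R axis i 1))) has_vector_derivative M (F i p)) (at 0)"
        by (rule M(2)) (use dF ev in \<open>auto simp: curve_in_def\<close>)
      moreover have "((\<lambda>r. K (\<phi> (p + r *\<^sub>R axis i 1))) has_vector_derivative axis i 1) (at 0)"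
        unfolding has_vector_derivative_def
      proof (rule has_derivative_transform_eventually[OF dline[of p "axis i 1", unfolded has_vector_derivative_def]])
        show "\<forall>\<^sub>F r in at 0. p + r *\<^sub>R axis i 1 = K (\<phi> (p + r *\<^sub>R axis i 1))"
          using evU[OF p, of "axis i 1"] by (auto simp: eventually_at_filter K\<phi> elim: eventually_mono)
      qed (use p in \<open>auto simp: K\<phi>\<close>)
      ultimately show ?thesis by (rule vector_derivative_unique_at)
    qed
    have "indep2 (axis 1 1 :: real^2) (axis 2 1)"
      by (auto simp: indep2_def vec_eq_iff forall_2 axis_def)
    then show "indep2 (F 1 p) (F 2 p)" by (intro indep2_linear_preimage[OF M(1)]) (simp add: MF)
  qed
  define \<xi> where "\<xi> = (\<lambda>y. cx (K y))"
  define \<eta> where "\<eta> = sgn (J 0)"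
  have zeroU: "0 \<in> U" using subsetD[OF U(2), of 0] by simp
  have sgnJ: "sgn (J p) = \<eta>" if "p \<in> cball 0 1" for p
  proof -
    have "J p > 0 \<longleftrightarrow> J 0 > 0"
      by (rule connected_same_sign[of "cball 0 1"])
         (use that nzJ U contJ in \<open>auto intro: continuous_on_subset simp: convex_connected\<close>)
    then show ?thesis using nzJ[of p] nzJ[OF zeroU] that subsetD[OF U(2), of p] by (auto simp: \<eta>_def sgn_if)
  qed
  have sub: "\<phi> ` cball 0 1 \<subseteq> \<phi> ` U" "\<phi> ` ball 0 1 \<subseteq> \<phi> ` U" using U(2) ball_subset_cball by blast+
  show ?thesis
  proof (rule that[of \<eta> \<xi>])
    show "\<eta> = 1 \<or> \<eta> = - 1" using nzJ[OF zeroU] by (auto simp: \<eta>_def sgn_if)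
    show "inj_on \<xi> (\<phi> ` cball 0 1)"
    proof (rule inj_onI)
      fix x y assume "x \<in> \<phi> ` cball 0 1" "y \<in> \<phi> ` cball 0 1" "\<xi> x = \<xi> y"
      then show "x = y" using sub \<phi>K cx_inj by (metis \<xi>_def injD subsetD)
    qed
    have "continuous_on (\<phi> ` cball 0 1) (cx \<circ> K)"
      by (rule continuous_on_compose[OF continuous_on_subset[OF smooth_on_imp_continuous_on[OF sK] sub(1)]
            linear_continuous_on[OF linear_conv_bounded_linear[THEN iffD1, OF cx_linear]]])
    then show "continuous_on (\<phi> ` cball 0 1) \<xi>" by (simp add: \<xi>_def comp_def)
    fix y
    show "cmod (\<xi> y) \<le> 1" if "y \<in> \<phi> ` cball 0 1" using that K\<phi> U by (auto simp: \<xi>_def subset_iff)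
    show "y \<in> \<phi> ` ball 0 1 \<longleftrightarrow> cmod (\<xi> y) < 1" if y: "y \<in> \<phi> ` cball 0 1"
    proof -
      obtain p where p: "y = \<phi> p" "p \<in> cball 0 1" using y by blast
      then have "p \<in> U" using U by auto
      have "y \<in> \<phi> ` ball 0 1 \<longleftrightarrow> p \<in> ball 0 1"
        unfolding p(1) using \<open>p \<in> U\<close> U(2) ball_subset_cball by (intro inj_on_image_mem_iff[OF inj]) blast+
      then show ?thesis using p K\<phi>[OF \<open>p \<in> U\<close>] by (simp add: \<xi>_def)
    qed
    assume y: "y \<in> \<phi> ` ball 0 1"
    then obtain p where p: "y = \<phi> p" "p \<in> ball 0 1" by blast
    then have pU: "p \<in> U" "p \<in> cball 0 1" using U ball_subset_cball by auto
    obtain M where M: "linear M" "\<And>g r v. curve_in (\<phi> ` U) y g r v \<Longrightarrow> ((\<lambda>u. K (g u)) has_vector_derivative M v) (at r)"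
      using pushK[of y] pU p by blast
    obtain N L where N: "open N" "p \<in> N" "N \<subseteq> U" "linear (L p)" and
      L: "\<forall>g r v. g r \<in> N \<longrightarrow> (g has_vector_derivative v) (at (r::real)) \<longrightarrow> (\<forall>\<^sub>F u in nhds r. g u \<in> U) \<longrightarrow>
        ((\<lambda>u. \<phi> (g u)) has_vector_derivative L (g r) v) (at r)" using push\<phi>[OF pU(1)] by metis
    have ci: "curve_in (\<phi> ` U) y \<gamma> r v" if "curve_in (\<phi> ` ball 0 1) y \<gamma> r v" for \<gamma> r v
      using that sub by (auto simp: curve_in_def elim!: eventually_mono)
    have v_eq: "v = (M v $ 1) *\<^sub>R F 1 p + (M v $ 2) *\<^sub>R F 2 p" if c: "curve_in (\<phi> ` ball 0 1) y \<gamma> r v" for \<gamma> r v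
    proof -
      note c' = ci[OF c]
      have "K (\<gamma> r) = p" using c p K\<phi> pU by (auto simp: curve_in_def)
      moreover have "\<forall>\<^sub>F u in nhds r. K (\<gamma> u) \<in> U" using c' \<phi>K by (auto simp: curve_in_def elim!: eventually_mono)
      ultimately have "((\<lambda>u. \<phi> (K (\<gamma> u))) has_vector_derivative L p (M v)) (at r)"
        using L[rule_format, of "\<lambda>u. K (\<gamma> u)" r "M v"] M(2)[OF c'] N by auto
      moreover have "((\<lambda>u. \<phi> (K (\<gamma> u))) has_vector_derivative v) (at r)"
        unfolding has_vector_derivative_def
      proof (rule has_derivative_transform_eventually)
        show "(\<gamma> has_derivative (\<lambda>x. x *\<^sub>R v)) (at r)" using c by (simp add: curve_in_def has_vector_derivative_def)
        show "\<forall>\<^sub>F u in at r. \<gamma> u = \<phi> (K (\<gamma> u))"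
          using c' \<phi>K by (auto simp: curve_in_def eventually_at_filter elim!: eventually_mono)
        show "\<gamma> r = \<phi> (K (\<gamma> r))" using c y sub \<phi>K by (auto simp: curve_in_def)
      qed simp
      ultimately have "L p (M v) = v" by (rule vector_derivative_unique_at)
      moreover have "L p (M v) = (M v $ 1) *\<^sub>R L p (axis 1 1) + (M v $ 2) *\<^sub>R L p (axis 2 1)"
        by (subst vec2_expand[of "M v"]) (simp add: linear_add[OF N(4)] linear_scale[OF N(4)])
      ultimately show ?thesis by (simp add: FL(1)[OF N(2,3) L])
    qed
    show "\<exists>M. (\<forall>\<gamma> r v. curve_in (\<phi> ` ball 0 1) y \<gamma> r v \<longrightarrow> ((\<lambda>u. \<xi> (\<gamma> u)) has_vector_derivative M v) (at r)) \<and>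
       (\<exists>\<kappa>>0. \<forall>\<gamma> r v \<delta> q w. curve_in (\<phi> ` ball 0 1) y \<gamma> r v \<longrightarrow> curve_in (\<phi> ` ball 0 1) y \<delta> q w \<longrightarrow>
          vol y v w = \<eta> * \<kappa> * Im (cnj (M v) * M w))"
    proof (intro exI[of _ "\<lambda>v. cx (M v)"] exI[of _ "\<bar>J p\<bar>"] conjI allI impI)
      show "((\<lambda>u. \<xi> (\<gamma> u)) has_vector_derivative cx (M v)) (at r)" if "curve_in (\<phi> ` ball 0 1) y \<gamma> r v" for \<gamma> r v
        unfolding \<xi>_def by (rule has_vector_derivative_cx[OF M(2)[OF ci[OF that]]])
      show "\<bar>J p\<bar> > 0" using nzJ pU by simp
      fix \<gamma> r v \<delta> q w assume *: "curve_in (\<phi> ` ball 0 1) y \<gamma> r v" "curve_in (\<phi> ` ball 0 1) y \<delta> q w"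
      have "vol y v w = (M v $ 1 * M w $ 2 - M v $ 2 * M w $ 1) * J p"
        by (subst v_eq[OF *(1)], subst v_eq[OF *(2)]) (simp add: vol_combination J_def p)
      also have "J p = \<eta> * \<bar>J p\<bar>" using sgnJ[OF pU(2)] by (metis mult_sgn_abs)
      also have "M v $ 1 * M w $ 2 - M v $ 2 * M w $ 1 = Im (cnj (cx (M v)) * cx (M w))"
        by (simp add: cx_def)
      finally show "vol y v w = \<eta> * \<bar>J p\<bar> * Im (cnj (cx (M v)) * cx (M w))" by simp
    qed
  qed
qed

text \<open>Two diagrams that agree outside a disk, together with a chart of the disk. Here \<open>B\<close> is the closed disk and
  \<open>B'\<close> the open one. The hypotheses are symmetric in \<open>D\<close> and \<open>E\<close>, so every consequence is available for both.\<close>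

locale disk_move = oriented_surface +
  fixes n :: nat and a b :: "nat \<Rightarrow> real" and D E :: "'a diagram"
    and B B' :: "'a set" and \<xi> :: "'a \<Rightarrow> complex" and \<eta> :: real
  assumes D: "knotoid_diagram S D" and E: "knotoid_diagram S E"
    and ab: "\<And>i. i < n \<Longrightarrow> 0 < a i \<and> a i < b i \<and> b i < 1"
    and dis: "\<And>i j t. i < n \<Longrightarrow> j < n \<Longrightarrow> t \<in> {a i..b i} \<Longrightarrow> t \<in> {a j..b j} \<Longrightarrow> i = j"
    and D_closed: "\<And>t. t \<in> {0..1} \<Longrightarrow> curve D t \<in> B \<longleftrightarrow> (\<exists>i<n. t \<in> {a i..b i})"
    and D_open: "\<And>t. t \<in> {0..1} \<Longrightarrow> curve D t \<in> B' \<longleftrightarrow> (\<exists>i<n. t \<in> {a i<..<b i})"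
    and E_closed: "\<And>t. t \<in> {0..1} \<Longrightarrow> curve E t \<in> B \<longleftrightarrow> (\<exists>i<n. t \<in> {a i..b i})"
    and E_open: "\<And>t. t \<in> {0..1} \<Longrightarrow> curve E t \<in> B' \<longleftrightarrow> (\<exists>i<n. t \<in> {a i<..<b i})"
    and agree: "\<And>t. t \<in> {0..1} \<Longrightarrow> (\<And>i. i < n \<Longrightarrow> t \<notin> {a i<..<b i}) \<Longrightarrow> curve D t = curve E t \<and> (t \<in> over D \<longleftrightarrow> t \<in> over E)"
    and \<eta>: "\<eta> = 1 \<or> \<eta> = - 1" and \<xi>_inj: "inj_on \<xi> B" and \<xi>_cont: "continuous_on B \<xi>"
    and \<xi>_le: "\<And>y. y \<in> B \<Longrightarrow> cmod (\<xi> y) \<le> 1" and \<xi>_less: "\<And>y. y \<in> B \<Longrightarrow> y \<in> B' \<longleftrightarrow> cmod (\<xi> y) < 1"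
    and \<xi>_deriv: "\<And>y. y \<in> B' \<Longrightarrow> \<exists>M. (\<forall>\<gamma> r v. curve_in B' y \<gamma> r v \<longrightarrow> ((\<lambda>u. \<xi> (\<gamma> u)) has_vector_derivative M v) (at r)) \<and>
       (\<exists>\<kappa>>0. \<forall>\<gamma> r v \<delta> q w. curve_in B' y \<gamma> r v \<longrightarrow> curve_in B' y \<delta> q w \<longrightarrow>
          vol y v w = \<eta> * \<kappa> * Im (cnj (M v) * M w))"
begin

lemma disk_move_sym: "disk_move S vol n a b E D B B' \<xi> \<eta>"
proof unfold_locales
  show "curve E t = curve D t \<and> (t \<in> over E \<longleftrightarrow> t \<in> over D)"
    if "t \<in> {0..1}" "\<And>i. i < n \<Longrightarrow> t \<notin> {a i<..<b i}" for t
    using agree[OF that] by auto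
qed (fact E D ab dis E_closed E_open D_closed D_open \<eta> \<xi>_inj \<xi>_cont \<xi>_le \<xi>_less \<xi>_deriv)+

lemma strand_01: "i < n \<Longrightarrow> t \<in> {a i..b i} \<Longrightarrow> t \<in> {0<..<1} \<and> t \<in> {0..1}"
  using ab[of i] by auto

definition "chart_curve t = \<xi> (curve D t)"

lemma strand_in_disk: "i < n \<Longrightarrow> t \<in> {a i..b i} \<Longrightarrow> curve D t \<in> B"
  using D_closed strand_01 by blast

lemma strand_boundary: "i < n \<Longrightarrow> t \<in> {a i..b i} \<Longrightarrow> curve D t \<in> B' \<longleftrightarrow> t \<in> {a i<..<b i}"
  using D_open[of t] strand_01[of i t] dis[of i _ t] by (metis atLeastAtMost_iff greaterThanLessThan_iff less_imp_le)

lemma chart_curve_eq: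
  "i < n \<Longrightarrow> j < n \<Longrightarrow> s \<in> {a i..b i} \<Longrightarrow> t \<in> {a j..b j} \<Longrightarrow> chart_curve s = chart_curve t \<longleftrightarrow> curve D s = curve D t"
  using \<xi>_inj strand_in_disk by (auto simp: chart_curve_def inj_on_eq_iff)

lemma proper_arc_strand:
  assumes i: "i < n" and inj: "inj_on (curve D) {a i..b i}"
  shows "proper_arc (a i) (b i) chart_curve"
  unfolding proper_arc_def
proof (intro conjI)
  show "a i < b i" using ab i by blast
  have "continuous_on {a i..b i} (curve D)"
    using smooth_on_imp_continuous_on[OF diagram_smooth(1)[OF D]]
    by (rule continuous_on_subset) (use strand_01[OF i] in blast)
  then have "continuous_on {a i..b i} (\<xi> \<circ> curve D)"
    using strand_in_disk[OF i] by (intro continuous_on_compose continuous_on_subset[OF \<xi>_cont]) auto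
  then show "continuous_on {a i..b i} chart_curve" by (simp add: chart_curve_def comp_def)
  show "inj_on chart_curve {a i..b i}"
    using inj chart_curve_eq[OF i i] by (auto simp: inj_on_def)
  have "cmod (chart_curve t) = 1" if "t = a i \<or> t = b i" for t
  proof -
    have t: "t \<in> {a i..b i}" using that ab[OF i] by auto
    have "\<not> cmod (\<xi> (curve D t)) < 1"
      using strand_boundary[OF i t] \<xi>_less[OF strand_in_disk[OF i t]] that by auto
    then show ?thesis using \<xi>_le[OF strand_in_disk[OF i t]] by (simp add: chart_curve_def)
  qed
  then show "cmod (chart_curve (a i)) = 1" "cmod (chart_curve (b i)) = 1" by blast+
  show "\<forall>t\<in>{a i<..<b i}. cmod (chart_curve t) < 1"
  proof
    fix t assume t: "t \<in> {a i<..<b i}"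
    then have t': "t \<in> {a i..b i}" by auto
    then show "cmod (chart_curve t) < 1"
      using strand_boundary[OF i t'] \<xi>_less[OF strand_in_disk[OF i t']] t by (simp add: chart_curve_def)
  qed
qed

lemma strand_curve_in:
  assumes i: "i < n" and t: "t \<in> {a i<..<b i}"
  shows "curve_in B' (curve D t) (curve D) t (vel D t)"
proof -
  have t': "t \<in> {0<..<1}" "t \<in> {0..1}" using strand_01[OF i, of t] t by auto
  have "\<forall>\<^sub>F u in nhds t. u \<in> {a i<..<b i}" using t by (intro eventually_nhds_in_open) auto
  then have "\<forall>\<^sub>F u in nhds t. curve D u \<in> B'"
    by (rule eventually_mono) (metis i strand_boundary atLeastAtMost_iff greaterThanLessThan_iff less_imp_le)
  moreover have "(curve D has_vector_derivative vel D t) (at t)"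
    using diagram_has_velocity[OF D t'(2)] at_within_01[OF t'(1)] by simp
  ultimately show ?thesis by (simp add: curve_in_def)
qed

lemma strand_crossing:
  assumes ij: "i < n" "j < n" and st: "s \<in> {a i<..<b i}" "t \<in> {a j<..<b j}" and c: "crosses D s t"
  obtains v w where "transverse_crossing chart_curve chart_curve s t v w"
    "crossing_sign D s t \<longleftrightarrow> \<eta> * Im (cnj v * w) > 0"
proof -
  have eq: "curve D s = curve D t" using c by (simp add: crosses_def)
  have y: "curve D t \<in> B'" using strand_boundary[OF ij(2), of t] st by auto
  have c1: "curve_in B' (curve D t) (curve D) s (vel D s)" using strand_curve_in[OF ij(1) st(1)] by (simp add: eq)
  have c2: "curve_in B' (curve D t) (curve D) t (vel D t)" by (rule strand_curve_in[OF ij(2) st(2)])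
  obtain M \<kappa> where M: "\<forall>\<gamma> r v. curve_in B' (curve D t) \<gamma> r v \<longrightarrow> ((\<lambda>u. \<xi> (\<gamma> u)) has_vector_derivative M v) (at r)"
    and \<kappa>: "\<kappa> > 0" "\<forall>\<gamma> r v \<delta> q w. curve_in B' (curve D t) \<gamma> r v \<longrightarrow> curve_in B' (curve D t) \<delta> q w \<longrightarrow>
          vol (curve D t) v w = \<eta> * \<kappa> * Im (cnj (M v) * M w)"
    using \<xi>_deriv[OF y] by metis
  have d: "(chart_curve has_vector_derivative M (vel D s)) (at s)" "(chart_curve has_vector_derivative M (vel D t)) (at t)"
    using M c1 c2 unfolding chart_curve_def[abs_def] by blast+
  have v: "vol (curve D t) (vel D s) (vel D t) = \<eta> * \<kappa> * Im (cnj (M (vel D s)) * M (vel D t))"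
    using \<kappa>(2) c1 c2 by blast
  show ?thesis
  proof (rule that[of "M (vel D s)" "M (vel D t)"])
    show "transverse_crossing chart_curve chart_curve s t (M (vel D s)) (M (vel D t))"
      using d eq crossing_sign_nonzero[OF D c] unfolding v transverse_crossing_def by (auto simp: chart_curve_def)
    show "crossing_sign D s t \<longleftrightarrow> \<eta> * Im (cnj (M (vel D s)) * M (vel D t)) > 0"
      unfolding crossing_sign_def v using \<kappa>(1) \<eta> by (auto simp: zero_less_mult_iff)
  qed
qed

lemma crosses_strand:
  assumes "crosses D s t" "i < n" "t \<in> {a i..b i}"
  shows "\<exists>j<n. s \<in> {a j..b j}"
  using assms strand_in_disk[OF assms(2,3)] D_closed[of s] by (auto simp: crosses_def)

lemma crosses_strand_open:
  assumes "crosses D s t" "i < n" "s \<in> {a i<..<b i}"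
  shows "\<exists>j<n. t \<in> {a j<..<b j}"
  using assms strand_boundary[OF assms(2), of s] D_open[of t] by (auto simp: crosses_def)

text \<open>A crossing on the boundary of the disk lies on two ends of strands, which do not move; so it would be present before and
  after the move, and the description of each move excludes this.\<close>

lemma crosses_endpoint:
  assumes c: "crosses D s t" and i: "i < n" and t: "t = a i \<or> t = b i"
  shows "\<exists>j<n. s = a j \<or> s = b j" "crosses E s t"
proof -
  have t': "t \<in> {a i..b i}" using t ab[OF i] by auto
  have not_open: "t \<notin> {a j<..<b j}" if "j < n" for j using dis[OF i that t'] t that by auto
  obtain j where j: "j < n" "s \<in> {a j..b j}" using crosses_strand[OF c i t'] by blast
  have s_not_open: "s \<notin> {a k<..<b k}" if "k < n" for k using crosses_strand_open[OF c that] not_open by blast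
  show "\<exists>j<n. s = a j \<or> s = b j" using j s_not_open[OF j(1)] by (intro exI[of _ j]) auto
  have "curve D s = curve E s" "curve D t = curve E t"
    using agree[of s] agree[of t] s_not_open not_open c by (auto simp: crosses_def)
  then show "crosses E s t" using c by (simp add: crosses_def)
qed

lemma vel_outside:
  assumes t: "t \<in> {0<..<1}" "\<And>i. i < n \<Longrightarrow> t \<notin> {a i..b i}"
  shows "vel E t = vel D t"
proof -
  have t01: "t \<in> {0..1}" using t by auto
  have "open (- (\<Union>i<n. {a i..b i}))" by (intro open_Compl closed_UN) auto
  then have "\<forall>\<^sub>F u in nhds t. u \<in> - (\<Union>i<n. {a i..b i})" by (rule eventually_nhds_in_open) (use t in auto)
  with eventually_01[OF t(1)] have ev: "\<forall>\<^sub>F u in nhds t. curve D u = curve E u"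
    by eventually_elim (use agree in force)
  have "(curve D has_vector_derivative vel D t) (at t within {0..1})" by (rule diagram_has_velocity[OF D t01])
  then have "(curve E has_vector_derivative vel D t) (at t within {0..1})"
    unfolding has_vector_derivative_def
  proof (rule has_derivative_transform_eventually)
    show "\<forall>\<^sub>F u in at t within {0..1}. curve D u = curve E u"
      using ev by (auto simp: eventually_at_filter elim: eventually_mono)
    show "curve D t = curve E t" using ev by (rule eventually_nhds_x_imp_x)
  qed (rule t01)
  then show ?thesis using t01 by (rule has_velocity_unique)
qed

lemma crosses_outside:
  assumes c: "crosses D s t" and t: "\<And>i. i < n \<Longrightarrow> t \<notin> {a i<..<b i}"
  shows "\<And>i. i < n \<Longrightarrow> s \<notin> {a i<..<b i}" "crosses E s t"
proof -
  show s: "\<And>i. i < n \<Longrightarrow> s \<notin> {a i<..<b i}" using crosses_strand_open[OF c] t by blast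
  have "curve D s = curve E s" "curve D t = curve E t" using agree[of s] agree[of t] s t c by (auto simp: crosses_def)
  then show "crosses E s t" using c by (simp add: crosses_def)
qed

end

context disk_move begin

text \<open>Outside the closed strands the curves agree near every parameter, so velocities and crossing signs agree as well. The
  ends of the strands are no crossings, by hypothesis.\<close>

lemma agree_outside_gauss:
  assumes no_endpoint: "\<And>i s t. i < n \<Longrightarrow> t = a i \<or> t = b i \<Longrightarrow> \<not> crosses D s t"
  shows "agree_outside n a b (gauss D) (gauss E)"
  unfolding agree_outside_def
proof (intro ballI)
  interpret sym: disk_move S vol n a b E D B B' \<xi> \<eta> by (rule disk_move_sym)
  fix t assume "t \<in> {0..<1} - (\<Union>i<n. {a i..<b i})"
  then have t: "t \<in> {0..<1}" "\<And>i. i < n \<Longrightarrow> t \<notin> {a i..<b i}" by auto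
  have no_endpoint': "\<not> crosses E s t" if "i < n" "t = a i \<or> t = b i" for i s t
    using sym.crosses_endpoint(2)[of s t i] no_endpoint[OF that] that by blast
  show "gauss E t = gauss D t \<and> (\<forall>e s. gauss D t = Some (e, s) \<longrightarrow> s \<notin> (\<Union>i<n. {a i<..<b i}))"
  proof (cases "\<exists>i<n. t = b i")
    case True
    then show ?thesis using no_endpoint no_endpoint' by (metis gauss_eq_None option.distinct(1))
  next
    case False
    then have t_out: "t \<notin> {a i..b i}" if "i < n" for i using t(2)[OF that] that by auto
    then have t_open: "t \<notin> {a i<..<b i}" if "i < n" for i using that by fastforce
    have cr: "crosses E s t \<longleftrightarrow> crosses D s t" for s
      using crosses_outside(2)[OF _ t_open] sym.crosses_outside(2)[OF _ t_open] by blast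
    have s_open: "s \<notin> {a i<..<b i}" if "crosses D s t" "i < n" for s i
      using crosses_outside(1)[OF that(1) t_open that(2)] .
    have s_out: "s \<notin> {a i..b i}" if "crosses D s t" "i < n" for s i
    proof
      assume "s \<in> {a i..b i}"
      then have "s = a i \<or> s = b i" using s_open[OF that] by auto
      then show False using no_endpoint[OF that(2)] crosses_sym[OF that(1)] by blast
    qed
    have over: "s \<in> over E \<longleftrightarrow> s \<in> over D" if "crosses D s t" for s
      using agree[of s] s_open[OF that] that by (auto simp: crosses_def)
    have sgn: "crossing_sign E s t = crossing_sign D s t" if c: "crosses D s t" for s
    proof -
      note i = crosses_interior[OF D c]
      have "curve D t = curve E t" using agree[of t] t_open i by auto
      then show ?thesis
        using vel_outside[OF i(1) s_out[OF c]] vel_outside[OF i(2) t_out] by (simp add: crossing_sign_def)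
    qed
    have iff: "gauss E t = Some (e, s) \<longleftrightarrow> gauss D t = Some (e, s)" for e s
      unfolding gauss_eq_Some[OF D] gauss_eq_Some[OF E] cr using over sgn by blast
    have "gauss E t = gauss D t" by (metis iff not_None_eq surj_pair)
    moreover have "s \<notin> (\<Union>i<n. {a i<..<b i})" if "gauss D t = Some (e, s)" for e s
      using that s_open gauss_eq_Some[OF D] by blast
    ultimately show ?thesis by blast
  qed
qed

end

lemma (in oriented_surface) same_outside_disk_move:
  assumes D: "knotoid_diagram S D" and E: "knotoid_diagram S E" and so: "same_outside_disk S n a b D E"
  obtains B B' \<xi> \<eta> where "disk_move S vol n a b D E B B' \<xi> \<eta>"
proof -
  obtain \<phi> where \<phi>: "smooth_disk S \<phi>" and sD: "strands_in_disk \<phi> n a b (curve D)" and sE: "strands_in_disk \<phi> n a b (curve E)"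
    and ag: "\<forall>t\<in>{0..1} - (\<Union>i<n. {a i<..<b i}). curve D t = curve E t \<and> (t \<in> over D \<longleftrightarrow> t \<in> over E)"
    using so unfolding same_outside_disk_def by blast
  have st: "(\<forall>t\<in>{0..1}. curve F t \<in> \<phi> ` cball 0 1 \<longleftrightarrow> (\<exists>i<n. t \<in> {a i..b i})) \<and>
     (\<forall>t\<in>{0..1}. curve F t \<in> \<phi> ` ball 0 1 \<longleftrightarrow> (\<exists>i<n. t \<in> {a i<..<b i}))"
    if "strands_in_disk \<phi> n a b (curve F)" for F
  proof -
    have "{t\<in>{0..1}. curve F t \<in> \<phi> ` cball 0 1} = (\<Union>i<n. {a i..b i})"
      "{t\<in>{0..1}. curve F t \<in> \<phi> ` ball 0 1} = (\<Union>i<n. {a i<..<b i})"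
      using that unfolding strands_in_disk_def by blast+
    then show ?thesis by (auto simp: set_eq_iff)
  qed
  show ?thesis
  proof (rule disk_chart[OF \<phi>], goal_cases)
    case c: (1 \<xi> \<eta>)
    have "disk_move S vol n a b D E (\<phi> ` cball 0 1) (\<phi> ` ball 0 1) \<xi> \<eta>"
    proof unfold_locales
      show "0 < a i \<and> a i < b i \<and> b i < 1" if "i < n" for i using sD that by (simp add: strands_in_disk_def)
      show "i = j" if "i < n" "j < n" "t \<in> {a i..b i}" "t \<in> {a j..b j}" for i j t
        using sD that unfolding strands_in_disk_def disjoint_family_on_def by blast
      show "curve D t = curve E t \<and> (t \<in> over D \<longleftrightarrow> t \<in> over E)"
        if "t \<in> {0..1}" "\<And>i. i < n \<Longrightarrow> t \<notin> {a i<..<b i}" for t using ag that by blast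
      show "curve D t \<in> \<phi> ` cball 0 1 \<longleftrightarrow> (\<exists>i<n. t \<in> {a i..b i})" if "t \<in> {0..1}" for t using st[OF sD] that by blast
      show "curve D t \<in> \<phi> ` ball 0 1 \<longleftrightarrow> (\<exists>i<n. t \<in> {a i<..<b i})" if "t \<in> {0..1}" for t using st[OF sD] that by blast
      show "curve E t \<in> \<phi> ` cball 0 1 \<longleftrightarrow> (\<exists>i<n. t \<in> {a i..b i})" if "t \<in> {0..1}" for t using st[OF sE] that by blast
      show "curve E t \<in> \<phi> ` ball 0 1 \<longleftrightarrow> (\<exists>i<n. t \<in> {a i<..<b i})" if "t \<in> {0..1}" for t using st[OF sE] that by blast
    qed (fact D E c)+
    then show ?thesis by (rule that)
  qed
qed

section \<open>Invariance under Reidemeister moves\<close>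

locale surface_quandle = oriented_surface S vol + quandle tri
  for S :: "'a::euclidean_space set" and vol and tri :: "bool \<Rightarrow> 'q \<Rightarrow> 'q \<Rightarrow> 'q"
begin

lemma card_1_pair:
  assumes "card {(s, t) \<in> M. P s t} = 1"
  obtains s t where "(s, t) \<in> M" "P s t" "\<And>s' t'. (s', t') \<in> M \<Longrightarrow> P s' t' \<Longrightarrow> s' = s \<and> t' = t"
proof -
  obtain x where x: "{(s, t) \<in> M. P s t} = {x}" using assms by (rule card_1_singletonE)
  obtain s t where st: "x = (s, t)" by (cases x)
  have "(s', t') \<in> M \<and> P s' t' \<longleftrightarrow> s' = s \<and> t' = t" for s' t'
    using x[unfolded st set_eq_iff, rule_format, of "(s', t')"] by simp
  then show ?thesis using that by blast
qed

lemma reidemeister_I_colorable: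
  assumes D: "knotoid_diagram S D" and E: "knotoid_diagram S E" and R: "reidemeister_I S D E"
  shows "colorable (gauss D) p q \<longleftrightarrow> colorable (gauss E) p q"
proof -
  obtain a b where so: "same_outside_disk S 1 a b D E" and inj: "inj_on (curve D) {a 0..b 0}"
    and card: "card {(s, t) \<in> meetings (curve E) {a 0..b 0} {a 0..b 0}. s < t} = 1"
    using R unfolding reidemeister_I_def by blast
  obtain B B' \<xi> \<eta> where dm: "disk_move S vol 1 a b D E B B' \<xi> \<eta>" using same_outside_disk_move[OF D E so] by blast
  interpret m: disk_move S vol 1 a b D E B B' \<xi> \<eta> by (rule dm)
  interpret sym: disk_move S vol 1 a b E D B B' \<xi> \<eta> by (rule m.disk_move_sym)
  have ab: "0 < a 0" "a 0 < b 0" "b 0 < 1" using m.ab[of 0] by auto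
  have strand: "s \<in> {a 0..b 0}" if "crosses D s t" "t \<in> {a 0..b 0}" for s t
    using m.crosses_strand[OF that(1), of 0] that(2) by auto
  have strandE: "s \<in> {a 0..b 0}" if "crosses E s t" "t \<in> {a 0..b 0}" for s t
    using sym.crosses_strand[OF that(1), of 0] that(2) by auto
  have noD: "\<not> crosses D s t" if t: "t \<in> {a 0..b 0}" for s t
  proof
    assume c: "crosses D s t"
    then have "s \<in> {a 0..b 0}" "curve D s = curve D t" "s \<noteq> t" using strand[OF c t] by (auto simp: crosses_def)
    with inj t show False by (meson inj_onD)
  qed
  have no_end: "\<not> crosses D s t" if "i < 1" "t = a i \<or> t = b i" for i s t
    using noD[of t s] that ab by auto
  have no_endE: "\<not> crosses E s t" if "t = a 0 \<or> t = b 0" for s t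
    using sym.crosses_endpoint(2)[of s t 0] no_end[of 0 t s] that by auto
  have ao: "agree_outside 1 a b (gauss D) (gauss E)" by (rule m.agree_outside_gauss[OF no_end])
  have gD: "gauss D t = None" if "t \<in> {a 0..b 0}" for t
    using noD[OF that] by (auto simp: gauss_eq_None)
  obtain s t where st: "s \<in> {a 0..b 0}" "t \<in> {a 0..b 0}" "s < t" "curve E s = curve E t"
    and only: "\<And>s' t'. s' \<in> {a 0..b 0} \<Longrightarrow> t' \<in> {a 0..b 0} \<Longrightarrow> curve E s' = curve E t' \<Longrightarrow> s' < t' \<Longrightarrow> s' = s \<and> t' = t"
  proof -
    from card obtain s t where "(s, t) \<in> meetings (curve E) {a 0..b 0} {a 0..b 0}" "s < t"
      "\<And>s' t'. (s', t') \<in> meetings (curve E) {a 0..b 0} {a 0..b 0} \<Longrightarrow> s' < t' \<Longrightarrow> s' = s \<and> t' = t"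
      by (rule card_1_pair) blast
    then show ?thesis using that[of s t] unfolding meetings_def by blast
  qed
  have st01: "s \<in> {0..1}" "t \<in> {0..1}" using st ab by auto
  have c: "crosses E s t" using st st01 by (simp add: crosses_def)
  have pair: "s' = s \<and> t' = t \<or> s' = t \<and> t' = s" if "crosses E s' t'" "t' \<in> {a 0..b 0}" for s' t'
  proof -
    have *: "s' \<in> {a 0..b 0}" "curve E s' = curve E t'" "s' \<noteq> t'" using strandE[OF that] that by (auto simp: crosses_def)
    show ?thesis
    proof (cases "s' < t'")
      case True
      then show ?thesis using only[OF *(1) that(2) *(2)] by blast
    next
      case False
      then show ?thesis using only[OF that(2) *(1)] * by force
    qed
  qed
  \<comment> \<open>\<open>u\<close> is the under-passage, \<open>v\<close> the over-passage of the new crossing\<close>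
  obtain u v where uv: "crosses E v u" "v \<in> over E" "u \<in> {a 0..b 0}" "v \<in> {a 0..b 0}"
    using c crosses_sym[OF c] crosses_over[OF E c] st by blast
  have gu: "gauss E u = Some (crossing_sign E v u, v)" using uv by (simp add: gauss_eq_Some[OF E])
  have u_open: "u \<in> {a 0<..<b 0}"
  proof -
    have "u \<noteq> a 0" "u \<noteq> b 0" using no_endE[of u v] uv(1) by blast+
    with uv show ?thesis by auto
  qed
  have gE: "gauss E x = None" if x: "x \<in> {a 0..b 0}" "x \<noteq> u" for x
    unfolding gauss_eq_None
  proof (intro allI impI)
    fix y assume y: "crosses E y x"
    have "y = u" "x = v" using pair[OF y x(1)] pair[OF uv(1,3)] x(2) by auto
    then show "y \<notin> over E" using crosses_over[OF E uv(1)] uv(2) by blast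
  qed
  have gE': "s' \<in> {a 0..b 0}" if "x \<in> {a 0..b 0}" "gauss E x = Some (e, s')" for x e s'
    using that gE[of x] gu uv(4) by (cases "x = u") auto
  show ?thesis
  proof
    show "colorable (gauss E) p q" if "colorable (gauss D) p q"
      using colorable_loop_add[OF ao ab gD gE' that] .
    show "colorable (gauss D) p q" if "colorable (gauss E) p q"
      using colorable_loop_remove[OF ao ab gD gu u_open uv(4) gE that] .
  qed
qed

lemma card_2_pairs:
  assumes "card M = 2" and inj: "\<And>s t s' t'. (s, t) \<in> M \<Longrightarrow> (s', t') \<in> M \<Longrightarrow> t = t' \<Longrightarrow> s = s'"
  obtains s1 t1 s2 t2 where "M = {(s1, t1), (s2, t2)}" "t1 < (t2 :: real)"
proof -
  obtain x y where xy: "M = {x, y}" "x \<noteq> y" using assms(1) by (auto simp: card_2_iff)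
  obtain s1 t1 where x: "x = (s1, t1)" by (cases x)
  obtain s2 t2 where y: "y = (s2, t2)" by (cases y)
  have "t1 \<noteq> t2" using inj[of s1 t1 s2 t2] xy x y by auto
  then consider "t1 < t2" | "t2 < t1" by force
  then show ?thesis using that[of s1 t1 s2 t2] that[of s2 t2 s1 t1] xy x y by (metis insert_commute)
qed

lemma sgn_opposite: "x \<noteq> 0 \<Longrightarrow> y \<noteq> 0 \<Longrightarrow> \<eta> = 1 \<or> \<eta> = - 1 \<Longrightarrow> sgn x = - sgn y \<longleftrightarrow> ((\<eta> * x > 0) \<longleftrightarrow> \<not> (\<eta> * y > (0::real)))"
  and sgn_same: "x \<noteq> 0 \<Longrightarrow> y \<noteq> 0 \<Longrightarrow> \<eta> = 1 \<or> \<eta> = - 1 \<Longrightarrow> sgn x = sgn y \<longleftrightarrow> ((\<eta> * x > 0) \<longleftrightarrow> (\<eta> * y > (0::real)))"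
  by (auto simp: sgn_if)

lemma reidemeister_II_colorable:
  assumes D: "knotoid_diagram S D" and E: "knotoid_diagram S E" and R: "reidemeister_II S D E"
  shows "colorable (gauss D) p q \<longleftrightarrow> colorable (gauss E) p q"
proof -
  obtain a b where so: "same_outside_disk S 2 a b D E"
    and inj: "\<And>i. i < 2 \<Longrightarrow> inj_on (curve D) {a i..b i}" "\<And>i. i < 2 \<Longrightarrow> inj_on (curve E) {a i..b i}"
    and disj: "meetings (curve D) {a 0..b 0} {a 1..b 1} = {}"
    and card: "card (meetings (curve E) {a 0..b 0} {a 1..b 1}) = 2"
    and ov: "\<forall>(s, t) \<in> meetings (curve E) {a 0..b 0} {a 1..b 1}. s \<in> over E"
    using R unfolding reidemeister_II_def by blast
  obtain B B' \<xi> \<eta> where dm: "disk_move S vol 2 a b D E B B' \<xi> \<eta>" using same_outside_disk_move[OF D E so] by blast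
  interpret m: disk_move S vol 2 a b D E B B' \<xi> \<eta> by (rule dm)
  interpret sym: disk_move S vol 2 a b E D B B' \<xi> \<eta> by (rule m.disk_move_sym)
  have ab: "0 < a i \<and> a i < b i \<and> b i < 1" if "i < 2" for i using m.ab that .
  have two: "(0::nat) < 2" "(1::nat) < 2" by auto
  have dis: "{a 0..b 0} \<inter> {a 1..b 1} = {}" using m.dis[OF two] by fastforce
  have noD: "\<not> crosses D s t" if i: "i < 2" "t \<in> {a i..b i}" for i s t
  proof
    assume c: "crosses D s t"
    obtain j where j: "j < 2" "s \<in> {a j..b j}" using m.crosses_strand[OF c i] by blast
    have eq: "curve D s = curve D t" "s \<noteq> t" using c by (auto simp: crosses_def)
    show False
    proof (cases "i = j")
      case True
      then show False using inj(1)[OF i(1)] i j eq by (meson inj_onD)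
    next
      case False
      then consider "i = 0" "j = 1" | "i = 1" "j = 0" using i(1) j(1) by (auto simp: less_2_iff)
      then show False
      proof cases
        case 1
        then have "(t, s) \<in> meetings (curve D) {a 0..b 0} {a 1..b 1}" using i(2) j(2) eq(1) by (simp add: meetings_def)
        with disj show False by blast
      next
        case 2
        then have "(s, t) \<in> meetings (curve D) {a 0..b 0} {a 1..b 1}" using i(2) j(2) eq(1) by (simp add: meetings_def)
        with disj show False by blast
      qed
    qed
  qed
  have no_end: "\<not> crosses D s t" if "i < 2" "t = a i \<or> t = b i" for i s t
    using noD[OF that(1), of t s] that ab[OF that(1)] by auto
  have no_endE: "\<not> crosses E s t" if "i < 2" "t = a i \<or> t = b i" for i s t
    using sym.crosses_endpoint(2)[of s t i] no_end[of i t s] that by blast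
  have ao: "agree_outside 2 a b (gauss D) (gauss E)" by (rule m.agree_outside_gauss[OF no_end])
  have gD: "gauss D t = None" if "i < 2" "t \<in> {a i..b i}" for i t
    using noD[OF that] by (auto simp: gauss_eq_None)
  obtain s1 t1 s2 t2 where M: "meetings (curve E) {a 0..b 0} {a 1..b 1} = {(s1, t1), (s2, t2)}" "t1 < t2"
    using card
  proof (rule card_2_pairs)
    fix s t s' t' assume "(s, t) \<in> meetings (curve E) {a 0..b 0} {a 1..b 1}" "(s', t') \<in> meetings (curve E) {a 0..b 0} {a 1..b 1}" "t = t'"
    then have "s \<in> {a 0..b 0}" "s' \<in> {a 0..b 0}" "curve E s = curve E s'" by (auto simp: meetings_def)
    then show "s = s'" using inj(2)[OF two(1)] by (meson inj_onD)
  qed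
  have mem: "(s1, t1) \<in> meetings (curve E) {a 0..b 0} {a 1..b 1}" "(s2, t2) \<in> meetings (curve E) {a 0..b 0} {a 1..b 1}"
    unfolding M(1) by auto
  have cr: "crosses E s t \<and> s \<in> over E \<and> s \<in> {a 0<..<b 0} \<and> t \<in> {a 1<..<b 1}"
    if "(s, t) \<in> meetings (curve E) {a 0..b 0} {a 1..b 1}" for s t
  proof -
    have st: "s \<in> {a 0..b 0}" "t \<in> {a 1..b 1}" "curve E s = curve E t" using that by (auto simp: meetings_def)
    have c: "crosses E s t"
      using st m.strand_01[OF two(1) st(1)] m.strand_01[OF two(2) st(2)] dis by (auto simp: crosses_def)
    have "t \<noteq> a 1" "t \<noteq> b 1" using no_endE[OF two(2), of t s] c by blast+
    moreover have "s \<noteq> a 0" "s \<noteq> b 0" using no_endE[OF two(1), of s t] crosses_sym[OF c] by blast+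
    ultimately show ?thesis using c st ov that by auto
  qed
  have gE0: "gauss E t = None" if t: "t \<in> {a 0..b 0}" for t
    unfolding gauss_eq_None
  proof (intro allI impI)
    fix s assume c: "crosses E s t"
    obtain j where j: "j < 2" "s \<in> {a j..b j}" using sym.crosses_strand[OF c two(1) t] by blast
    have eq: "curve E s = curve E t" "s \<noteq> t" using c by (auto simp: crosses_def)
    have "j \<noteq> 0" using inj(2)[OF two(1)] t j eq by (metis inj_onD)
    then have "s \<in> {a 1..b 1}" using j by (auto simp: less_2_iff)
    then have "(t, s) \<in> meetings (curve E) {a 0..b 0} {a 1..b 1}" using t eq by (auto simp: meetings_def)
    then show "s \<notin> over E" using cr[of t s] crosses_over[OF E c] by blast
  qed
  have gE1: "gauss E t = None" if t: "t \<in> {a 1..b 1}" "t \<noteq> t1" "t \<noteq> t2" for t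
    unfolding gauss_eq_None
  proof (intro allI impI)
    fix s assume c: "crosses E s t"
    obtain j where j: "j < 2" "s \<in> {a j..b j}" using sym.crosses_strand[OF c two(2) t(1)] by blast
    have eq: "curve E s = curve E t" "s \<noteq> t" using c by (auto simp: crosses_def)
    have "j \<noteq> 1" using inj(2)[OF two(2)] t(1) j eq by (metis inj_onD)
    then have "s \<in> {a 0..b 0}" using j by (auto simp: less_2_iff)
    then have "(s, t) \<in> meetings (curve E) {a 0..b 0} {a 1..b 1}" using t(1) eq by (auto simp: meetings_def)
    then show "s \<notin> over E" using M t by auto
  qed
  note c1 = cr[OF mem(1)] and c2 = cr[OF mem(2)]
  obtain v1 w1 where w1: "transverse_crossing sym.chart_curve sym.chart_curve s1 t1 v1 w1"
    "crossing_sign E s1 t1 \<longleftrightarrow> \<eta> * Im (cnj v1 * w1) > 0"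
    using sym.strand_crossing[OF two, of s1 t1] c1 by blast
  obtain v2 w2 where w2: "transverse_crossing sym.chart_curve sym.chart_curve s2 t2 v2 w2"
    "crossing_sign E s2 t2 \<longleftrightarrow> \<eta> * Im (cnj v2 * w2) > 0"
    using sym.strand_crossing[OF two, of s2 t2] c2 by blast
  have ends: "sym.chart_curve t = m.chart_curve t" if "i < 2" "t = a i \<or> t = b i" for i t
  proof -
    have t: "t \<in> {a i..b i}" using that ab[OF that(1)] by auto
    have "t \<notin> {a j<..<b j}" if "j < 2" for j
      using m.dis[OF \<open>i < 2\<close> that t] \<open>t = a i \<or> t = b i\<close> by auto
    then have "curve D t = curve E t" using m.agree[of t] m.strand_01[OF that(1) t] by blast
    then show ?thesis by (simp add: sym.chart_curve_def m.chart_curve_def)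
  qed
  have "sgn (Im (cnj v1 * w1)) = - sgn (Im (cnj v2 * w2))"
  proof (rule two_crossings_opposite_signs)
    show "proper_arc (a 0) (b 0) m.chart_curve" "proper_arc (a 1) (b 1) m.chart_curve"
      using m.proper_arc_strand[OF two(1) inj(1)[OF two(1)]] m.proper_arc_strand[OF two(2) inj(1)[OF two(2)]] .
    show "proper_arc (a 0) (b 0) sym.chart_curve" "proper_arc (a 1) (b 1) sym.chart_curve"
      using sym.proper_arc_strand[OF two(1) inj(2)[OF two(1)]] sym.proper_arc_strand[OF two(2) inj(2)[OF two(2)]] .
    show "sym.chart_curve (a 0) = m.chart_curve (a 0)" "sym.chart_curve (b 0) = m.chart_curve (b 0)"
      "sym.chart_curve (a 1) = m.chart_curve (a 1)" "sym.chart_curve (b 1) = m.chart_curve (b 1)"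
      using ends[OF two(1)] ends[OF two(2)] by blast+
    show "m.chart_curve ` {a 0..b 0} \<inter> m.chart_curve ` {a 1..b 1} = {}"
    proof safe
      fix x y assume xy: "x \<in> {a 0..b 0}" "y \<in> {a 1..b 1}" "m.chart_curve x = m.chart_curve y"
      then have "curve D x = curve D y" using m.chart_curve_eq[OF two] by blast
      then have "(x, y) \<in> meetings (curve D) {a 0..b 0} {a 1..b 1}" using xy by (auto simp: meetings_def)
      then show "m.chart_curve x \<in> {}" using disj by blast
    qed
    have "{(s, t). s \<in> {a 0..b 0} \<and> t \<in> {a 1..b 1} \<and> sym.chart_curve s = sym.chart_curve t} =
        meetings (curve E) {a 0..b 0} {a 1..b 1}"
      unfolding meetings_def using sym.chart_curve_eq[OF two] by blast
    then show "{(s, t). s \<in> {a 0..b 0} \<and> t \<in> {a 1..b 1} \<and> sym.chart_curve s = sym.chart_curve t} = {(s1, t1), (s2, t2)}"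
      using M(1) by simp
    show "(s1, t1) \<noteq> (s2, t2)" using M(2) by simp
  qed (fact w1(1) w2(1))+
  then have opp: "crossing_sign E s2 t2 \<longleftrightarrow> \<not> crossing_sign E s1 t1"
    using w1 w2 m.\<eta> by (subst (asm) sgn_opposite[of _ _ \<eta>]) (auto simp: transverse_crossing_def)
  have g: "gauss E t1 = Some (crossing_sign E s1 t1, s1)" "gauss E t2 = Some (\<not> crossing_sign E s1 t1, s2)"
    using c1 c2 opp by (auto simp: gauss_eq_Some[OF E])
  have t12: "a 1 < t1" "t2 < b 1" "s1 \<in> {a 0..b 0}" "s2 \<in> {a 0..b 0}" using c1 c2 by auto
  show ?thesis
  proof
    show "colorable (gauss E) p q" if "colorable (gauss D) p q"
      by (rule colorable_bigon_add[OF ao ab dis gD gE0 t12(1) M(2) t12(2-4) g gE1 that])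
    show "colorable (gauss D) p q" if "colorable (gauss E) p q"
      by (rule colorable_bigon_remove[OF ao ab dis gD gE0 t12(1) M(2) t12(2-4) g gE1 that])
  qed
qed

lemma reidemeister_IIIE:
  assumes "reidemeister_III S D E"
  obtains a b p q where "same_outside_disk S 3 a b D E"
    "\<And>i. i < 3 \<Longrightarrow> inj_on (curve D) {a i..b i}" "\<And>i. i < 3 \<Longrightarrow> inj_on (curve E) {a i..b i}"
    "\<And>i j. i < 3 \<Longrightarrow> j < 3 \<Longrightarrow> i < j \<Longrightarrow> meetings (curve D) {a i..b i} {a j..b j} = {(p i j, p j i)} \<and> p i j \<in> over D"
    "\<And>i j. i < 3 \<Longrightarrow> j < 3 \<Longrightarrow> i < j \<Longrightarrow> meetings (curve E) {a i..b i} {a j..b j} = {(q i j, q j i)} \<and> q i j \<in> over E"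
    "\<And>i j k. i < 3 \<Longrightarrow> j < 3 \<Longrightarrow> k < 3 \<Longrightarrow> distinct [i, j, k] \<Longrightarrow> p i j < p i k \<longleftrightarrow> q i k < q i j"
proof -
  from assms show ?thesis
    unfolding reidemeister_III_def
  proof (elim exE conjE, goal_cases)
    case (1 a b p q)
    show ?thesis
    proof (rule that[of a b p q])
      show "same_outside_disk S 3 a b D E" by (fact 1(1))
      show "inj_on (curve D) {a i..b i}" "inj_on (curve E) {a i..b i}" if "i < 3" for i using 1(2) that by simp_all
      show "meetings (curve D) {a i..b i} {a j..b j} = {(p i j, p j i)} \<and> p i j \<in> over D"
        "meetings (curve E) {a i..b i} {a j..b j} = {(q i j, q j i)} \<and> q i j \<in> over E"
        if "i < 3" "j < 3" "i < j" for i j using 1(3) that by simp_all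
      show "p i j < p i k \<longleftrightarrow> q i k < q i j" if "i < 3" "j < 3" "k < 3" "distinct [i, j, k]" for i j k
        by (rule 1(4)[THEN spec, THEN mp, THEN spec, THEN mp, THEN spec, THEN mp, THEN mp]) (fact that)+
    qed
  qed
qed

text \<open>Move III is its own inverse, so one direction of the invariance suffices.\<close>

lemma reidemeister_III_sym:
  assumes "reidemeister_III S D E" shows "reidemeister_III S E D"
proof -
  show ?thesis
  proof (rule reidemeister_IIIE[OF assms], goal_cases)
    case *: (1 a b p q)
  show ?thesis
    unfolding reidemeister_III_def
  proof (rule exI[of _ a], rule exI[of _ b], rule exI[of _ q], rule exI[of _ p], intro conjI)
    show "same_outside_disk S 3 a b E D" using *(1) unfolding same_outside_disk_def by metis
    show "\<forall>i<3. inj_on (curve E) {a i..b i} \<and> inj_on (curve D) {a i..b i}" using *(2,3) by simp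
    show "\<forall>i<3. \<forall>j<3. i < j \<longrightarrow>
           meetings (curve E) {a i..b i} {a j..b j} = {(q i j, q j i)} \<and> q i j \<in> over E \<and>
           meetings (curve D) {a i..b i} {a j..b j} = {(p i j, p j i)} \<and> p i j \<in> over D"
      using *(4,5) by simp
    show "\<forall>i<3. \<forall>j<3. \<forall>k<3. distinct [i, j, k] \<longrightarrow> (q i j < q i k \<longleftrightarrow> p i k < p i j)"
    proof (intro allI impI)
      fix i j k :: nat assume "i < 3" "j < 3" "k < 3" "distinct [i, j, k]"
      then show "q i j < q i k \<longleftrightarrow> p i k < p i j" using *(6)[of i k j] by auto
    qed
  qed
  qed
qed

text \<open>A crossing on the boundary of the disk would be the first (or last) one on its strand before and after the move,
  while the move reverses the order of the two crossings on each strand. Hence all crossings are interior, and the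
  results on arcs in the disk apply.\<close>

lemma reidemeister_III_colorable:
  assumes D: "knotoid_diagram S D" and E: "knotoid_diagram S E" and R: "reidemeister_III S D E"
    and col: "colorable (gauss D) x y"
  shows "colorable (gauss E) x y"
proof -
  show ?thesis
  proof (rule reidemeister_IIIE[OF R], goal_cases)
    case III: (1 a b p q)
    note so = III(1) and inj = III(2,3) and meetD = III(4) and meetE = III(5) and ord = III(6)
    obtain B B' \<xi> \<eta> where dm: "disk_move S vol 3 a b D E B B' \<xi> \<eta>" using same_outside_disk_move[OF D E so] by blast
    interpret m: disk_move S vol 3 a b D E B B' \<xi> \<eta> by (rule dm)
    interpret sym: disk_move S vol 3 a b E D B B' \<xi> \<eta> by (rule m.disk_move_sym)
    have ab: "0 < a i \<and> a i < b i \<and> b i < 1" if "i < 3" for i using m.ab that .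
    have dis: "{a i..b i} \<inter> {a j..b j} = {}" if "i < 3" "j < 3" "i \<noteq> j" for i j
      using m.dis[OF that(1,2)] that(3) by fastforce
    have meet: "p i j \<in> {a i..b i} \<and> curve F (p i j) = curve F (p j i) \<and>
        (\<forall>s t. s \<in> {a i..b i} \<longrightarrow> t \<in> {a j..b j} \<longrightarrow> curve F s = curve F t \<longrightarrow> s = p i j \<and> t = p j i) \<and> (i < j \<longrightarrow> p i j \<in> over F)"
      if "i < 3" "j < 3" "i \<noteq> j" and
        M: "\<And>i j. i < 3 \<Longrightarrow> j < 3 \<Longrightarrow> i < j \<Longrightarrow> meetings (curve F) {a i..b i} {a j..b j} = {(p i j, p j i)} \<and> p i j \<in> over F"
      for i j F and p :: "nat \<Rightarrow> nat \<Rightarrow> real"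
    proof (cases "i < j")
      case True
      then have "meetings (curve F) {a i..b i} {a j..b j} = {(p i j, p j i)}" "p i j \<in> over F" using M[of i j] that by blast+
      then show ?thesis unfolding meetings_def set_eq_iff by auto
    next
      case False
      then have eq: "meetings (curve F) {a j..b j} {a i..b i} = {(p j i, p i j)}" using M[of j i] that by force
      have *: "s \<in> {a j..b j} \<and> t \<in> {a i..b i} \<and> curve F s = curve F t \<longleftrightarrow> s = p j i \<and> t = p i j" for s t
        using eq[unfolded meetings_def set_eq_iff, rule_format, of "(s, t)"] by simp
      have "t = p i j \<and> s = p j i" if "t \<in> {a i..b i}" "s \<in> {a j..b j}" "curve F t = curve F s" for s t
        using *[of s t] that by auto
      then show ?thesis using False *[of "p j i" "p i j"] by auto
    qed
    have P: "p i j \<in> {a i..b i}" "curve D (p i j) = curve D (p j i)" "i < j \<Longrightarrow> p i j \<in> over D"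
        "\<And>s t. s \<in> {a i..b i} \<Longrightarrow> t \<in> {a j..b j} \<Longrightarrow> curve D s = curve D t \<Longrightarrow> s = p i j \<and> t = p j i"
      if "i < 3" "j < 3" "i \<noteq> j" for i j
      using meet[OF that meetD] by blast+
    have Q: "q i j \<in> {a i..b i}" "curve E (q i j) = curve E (q j i)" "i < j \<Longrightarrow> q i j \<in> over E"
        "\<And>s t. s \<in> {a i..b i} \<Longrightarrow> t \<in> {a j..b j} \<Longrightarrow> curve E s = curve E t \<Longrightarrow> s = q i j \<and> t = q j i"
      if "i < 3" "j < 3" "i \<noteq> j" for i j
      using meet[OF that meetE] by blast+
    have cross: "crosses D (p i j) (p j i)" "crosses E (q i j) (q j i)" if "i < 3" "j < 3" "i \<noteq> j" for i j
    proof -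
      have "p i j \<noteq> p j i" "q i j \<noteq> q j i" using P(1)[of i j] P(1)[of j i] Q(1)[of i j] Q(1)[of j i] dis[OF that] that by auto
      then show "crosses D (p i j) (p j i)" "crosses E (q i j) (q j i)"
        using P(1)[of i j] P(1)[of j i] P(2)[of i j] Q(1)[of i j] Q(1)[of j i] Q(2)[of i j] m.strand_01 that
        unfolding crosses_def by blast+
    qed
    have pne: "p i j \<noteq> p i k" "q i j \<noteq> q i k" if "i < 3" "j < 3" "k < 3" "distinct [i, j, k]" for i j k
    proof -
      have ne: "i \<noteq> j" "i \<noteq> k" "j \<noteq> k" using that by auto
      show "p i j \<noteq> p i k"
      proof
        assume eq: "p i j = p i k"
        have "crosses D (p j i) (p i j)" "crosses D (p k i) (p i j)" using cross(1) ne that eq by (metis, metis)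
        then have "p j i = p k i" using crosses_unique[OF D] by blast
        then show False using P(1)[of j i] P(1)[of k i] dis[of j k] ne that by auto
      qed
      show "q i j \<noteq> q i k"
      proof
        assume eq: "q i j = q i k"
        have "crosses E (q j i) (q i j)" "crosses E (q k i) (q i j)" using cross(2) ne that eq by (metis, metis)
        then have "q j i = q k i" using crosses_unique[OF E] by blast
        then show False using Q(1)[of j i] Q(1)[of k i] dis[of j k] ne that by auto
      qed
    qed
    have third: "\<exists>k<3. distinct [i, j, k]" if "i < 3" "j < 3" "i \<noteq> j" for i j :: nat
    proof -
      define k where "k = 3 - i - j"
      have "k \<noteq> i" "k \<noteq> j" "k < 3" unfolding k_def using that by presburger+
      then show ?thesis using that by (intro exI[of _ k]) auto
    qed
    have no_end: "\<not> crosses D s t" if i: "i < 3" and t: "t = a i \<or> t = b i" for i s t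
    proof
      assume c: "crosses D s t"
      have t': "t \<in> {a i..b i}" using t ab[OF i] by auto
      have cE: "crosses E s t" by (rule m.crosses_endpoint(2)[OF c i t])
      obtain j where j: "j < 3" "s \<in> {a j..b j}" using m.crosses_strand[OF c i t'] by blast
      have eq: "curve D s = curve D t" "curve E s = curve E t" "s \<noteq> t" using c cE by (auto simp: crosses_def)
      have ij: "i \<noteq> j" using inj(1)[OF i] t' j eq by (metis inj_onD)
      have pq: "t = p i j" "t = q i j" using P(4)[OF i j(1) ij t' j(2)] Q(4)[OF i j(1) ij t' j(2)] eq by auto
      obtain k where k: "k < 3" "distinct [i, j, k]" using third[OF i j(1) ij] by blast
      have k': "distinct [i, k, j]" "i \<noteq> k" using k by auto
      have "p i k \<in> {a i..b i}" "q i k \<in> {a i..b i}" using P(1)[OF i k(1)] Q(1)[OF i k(1)] k' by auto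
      then show False
        using ord[OF i j(1) k] ord[OF i k(1) j(1) k'(1)] pne[OF i j(1) k] pq t by auto
    qed
    have no_endE: "\<not> crosses E s t" if "i < 3" "t = a i \<or> t = b i" for i s t
      using sym.crosses_endpoint(2)[of s t i] no_end[of i t s] that by blast
    have ao: "agree_outside 3 a b (gauss D) (gauss E)" by (rule m.agree_outside_gauss[OF no_end])
    have P': "p i j \<in> {a i<..<b i}" and Q': "q i j \<in> {a i<..<b i}" if "i < 3" "j < 3" "i \<noteq> j" for i j
    proof -
      have "crosses D (p j i) (p i j)" "crosses E (q j i) (q i j)" using cross that by (metis, metis)
      then have "p i j \<noteq> a i" "p i j \<noteq> b i" "q i j \<noteq> a i" "q i j \<noteq> b i"
        using no_end[OF that(1)] no_endE[OF that(1)] by blast+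
      then show "p i j \<in> {a i<..<b i}" "q i j \<in> {a i<..<b i}" using P(1)[OF that] Q(1)[OF that] by auto
    qed
    define d where "d = (\<lambda>i j. crossing_sign D (p i j) (p j i))"
    have arcD: "proper_arc (a i) (b i) m.chart_curve" and arcE: "proper_arc (a i) (b i) sym.chart_curve" if "i < 3" for i
      using m.proper_arc_strand[OF that inj(1)[OF that]] sym.proper_arc_strand[OF that inj(2)[OF that]] .
    have sD: "\<exists>v w. single_crossing (a i) (b i) m.chart_curve (a j) (b j) m.chart_curve (p i j) (p j i) v w \<and>
        (d i j \<longleftrightarrow> \<eta> * Im (cnj v * w) > 0)" if ij: "i < 3" "j < 3" "i \<noteq> j" for i j
    proof -
      have ji: "j \<noteq> i" using ij by simp
      obtain v w where vw: "transverse_crossing m.chart_curve m.chart_curve (p i j) (p j i) v w"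
        "crossing_sign D (p i j) (p j i) \<longleftrightarrow> \<eta> * Im (cnj v * w) > 0"
        using m.strand_crossing[OF ij(1,2) P'[OF ij] P'[OF ij(2,1) ji] cross(1)[OF ij]] by blast
      have "t' = p j i" if "s' \<in> {a i..b i}" "t' \<in> {a j..b j}" "m.chart_curve s' = m.chart_curve t'" for s' t'
        using P(4)[OF ij that(1,2)] m.chart_curve_eq[OF ij(1,2) that(1,2)] that(3) by blast
      then show ?thesis using vw P'[OF ij] P'[OF ij(2,1) ji] unfolding single_crossing_def d_def by blast
    qed
    have sE: "\<exists>v w. single_crossing (a i) (b i) sym.chart_curve (a j) (b j) sym.chart_curve (q i j) (q j i) v w \<and>
        (crossing_sign E (q i j) (q j i) \<longleftrightarrow> \<eta> * Im (cnj v * w) > 0)" if ij: "i < 3" "j < 3" "i \<noteq> j" for i j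
    proof -
      have ji: "j \<noteq> i" using ij by simp
      obtain v w where vw: "transverse_crossing sym.chart_curve sym.chart_curve (q i j) (q j i) v w"
        "crossing_sign E (q i j) (q j i) \<longleftrightarrow> \<eta> * Im (cnj v * w) > 0"
        using sym.strand_crossing[OF ij(1,2) Q'[OF ij] Q'[OF ij(2,1) ji] cross(2)[OF ij]] by blast
      have "t' = q j i" if "s' \<in> {a i..b i}" "t' \<in> {a j..b j}" "sym.chart_curve s' = sym.chart_curve t'" for s' t'
        using Q(4)[OF ij that(1,2)] sym.chart_curve_eq[OF ij(1,2) that(1,2)] that(3) by blast
      then show ?thesis using vw Q'[OF ij] Q'[OF ij(2,1) ji] unfolding single_crossing_def by blast
    qed
    have ends: "sym.chart_curve t = m.chart_curve t" if "i < 3" "t = a i \<or> t = b i" for i t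
    proof -
      have t: "t \<in> {a i..b i}" using that ab[OF that(1)] by auto
      have "t \<notin> {a j<..<b j}" if "j < 3" for j
        using m.dis[OF \<open>i < 3\<close> that t] \<open>t = a i \<or> t = b i\<close> by auto
      then have "curve D t = curve E t" using m.agree[of t] m.strand_01[OF that(1) t] by blast
      then show ?thesis by (simp add: sym.chart_curve_def m.chart_curve_def)
    qed
    have nz: "Im (cnj v * w) \<noteq> 0" if "single_crossing a' b' f c' d' g s t v w" for a' b' f c' d' g s t v w
      using that by (simp add: single_crossing_def transverse_crossing_def)
    have dE: "crossing_sign E (q i j) (q j i) = d i j" if ij: "i < 3" "j < 3" "i \<noteq> j" for i j
    proof -
      obtain v w where 1: "single_crossing (a i) (b i) m.chart_curve (a j) (b j) m.chart_curve (p i j) (p j i) v w"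
        "d i j \<longleftrightarrow> \<eta> * Im (cnj v * w) > 0" using sD[OF ij] by blast
      obtain v' w' where 2: "single_crossing (a i) (b i) sym.chart_curve (a j) (b j) sym.chart_curve (q i j) (q j i) v' w'"
        "crossing_sign E (q i j) (q j i) \<longleftrightarrow> \<eta> * Im (cnj v' * w') > 0" using sE[OF ij] by blast
      have "sgn (Im (cnj v * w)) = sgn (Im (cnj v' * w'))"
        using single_crossing_same_sign[OF arcD[OF ij(1)] arcD[OF ij(2)] arcE[OF ij(1)] arcE[OF ij(2)] _ _ _ _ 1(1) 2(1)]
          ends[OF ij(1)] ends[OF ij(2)] by blast
      then show ?thesis using sgn_same[OF nz[OF 1(1)] nz[OF 2(1)] m.\<eta>] 1(2) 2(2) by blast
    qed
    have lt: "(0::nat) < 3" "(1::nat) < 3" "(2::nat) < 3" by auto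
    have sgn: "(p 1 0 < p 1 2 \<longleftrightarrow> p 2 0 < p 2 1) \<longleftrightarrow> (d 0 1 \<longleftrightarrow> d 0 2)"
    proof -
      obtain v w where 1: "single_crossing (a 0) (b 0) m.chart_curve (a 1) (b 1) m.chart_curve (p 0 1) (p 1 0) v w"
        "d 0 1 \<longleftrightarrow> \<eta> * Im (cnj v * w) > 0" using sD[OF lt(1,2)] by auto
      obtain v' w' where 2: "single_crossing (a 0) (b 0) m.chart_curve (a 2) (b 2) m.chart_curve (p 0 2) (p 2 0) v' w'"
        "d 0 2 \<longleftrightarrow> \<eta> * Im (cnj v' * w') > 0" using sD[OF lt(1,3)] by auto
      have X: "p 1 2 \<in> {a 1..b 1}" "p 2 1 \<in> {a 2..b 2}" "m.chart_curve (p 1 2) = m.chart_curve (p 2 1)"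
        using P(1)[of 1 2] P(1)[of 2 1] P(2)[of 1 2] by (simp_all add: m.chart_curve_def)
      have "(p 1 0 < p 1 2 \<longleftrightarrow> p 2 0 < p 2 1) \<longleftrightarrow> sgn (Im (cnj v * w)) = sgn (Im (cnj v' * w'))"
        by (rule triangle_orders[OF arcD[OF lt(1)] arcD[OF lt(2)] arcD[OF lt(3)] 1(1) 2(1) X])
           (use pne(1)[of 1 0 2] pne(1)[of 2 0 1] in auto)
      then show ?thesis using sgn_same[OF nz[OF 1(1)] nz[OF 2(1)] m.\<eta>] 1(2) 2(2) by blast
    qed
    have gD: "gauss D t = None" if i: "i < 3" and t: "t \<in> {a i..b i}" and ne: "\<And>j. j < i \<Longrightarrow> t \<noteq> p i j" for i t
      unfolding gauss_eq_None
    proof (intro allI impI)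
      fix s assume c: "crosses D s t"
      obtain j where j: "j < 3" "s \<in> {a j..b j}" using m.crosses_strand[OF c i t] by blast
      have eq: "curve D t = curve D s" "t \<noteq> s" using c by (auto simp: crosses_def)
      have ij: "i \<noteq> j" using inj(1)[OF i] t j eq by (metis inj_onD)
      have pq: "t = p i j" using P(4)[OF i j(1) ij t j(2) eq(1)] by blast
      then have "i < j" using ne[of j] ij by force
      then have "t \<in> over D" using P(3)[OF i j(1) ij] pq by simp
      then show "s \<notin> over D" using crosses_over[OF D c] by blast
    qed
    have gE: "gauss E t = None" if i: "i < 3" and t: "t \<in> {a i..b i}" and ne: "\<And>j. j < i \<Longrightarrow> t \<noteq> q i j" for i t
      unfolding gauss_eq_None
    proof (intro allI impI)
      fix s assume c: "crosses E s t"
      obtain j where j: "j < 3" "s \<in> {a j..b j}" using sym.crosses_strand[OF c i t] by blast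
      have eq: "curve E t = curve E s" "t \<noteq> s" using c by (auto simp: crosses_def)
      have ij: "i \<noteq> j" using inj(2)[OF i] t j eq by (metis inj_onD)
      have pq: "t = q i j" using Q(4)[OF i j(1) ij t j(2) eq(1)] by blast
      then have "i < j" using ne[of j] ij by force
      then have "t \<in> over E" using Q(3)[OF i j(1) ij] pq by simp
      then show "s \<notin> over E" using crosses_over[OF E c] by blast
    qed
    have SD: "gauss D (p j i) = Some (d i j, p i j)" if "i < j" "j < 3" for i j
    proof -
      have "i < 3" "i \<noteq> j" using that by auto
      then show ?thesis using cross(1)[of i j] P(3)[of i j] that by (simp add: gauss_eq_Some[OF D] d_def)
    qed
    have SE: "gauss E (q j i) = Some (d i j, q i j)" if "i < j" "j < 3" for i j
    proof -
      have ij: "i < 3" "j < 3" "i \<noteq> j" using that by auto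
      then show ?thesis using cross(2)[OF ij] Q(3)[OF ij] dE[OF ij] that by (simp add: gauss_eq_Some[OF E])
    qed
    show ?thesis
    proof (rule colorable_triangle[OF ao ab dis SD P' gD SE Q' gE _ _ _ _ _ _ sgn col])
      show "p 1 0 < p 1 2 \<longleftrightarrow> q 1 2 < q 1 0" "p 2 0 < p 2 1 \<longleftrightarrow> q 2 1 < q 2 0"
        using ord[of 1 0 2] ord[of 2 0 1] by auto
      show "p 1 0 \<noteq> p 1 2" "p 2 0 \<noteq> p 2 1" "q 1 0 \<noteq> q 1 2" "q 2 0 \<noteq> q 2 1"
        using pne[of 1 0 2] pne[of 2 0 1] by auto
    qed
  qed
qed

lemma reparametrization_colorable:
  assumes D: "knotoid_diagram S D" and E: "knotoid_diagram S E" and \<psi>: "diffeo {0..1} {0..1} \<psi>" "\<psi> 0 = 0"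
    and eq: "\<And>t. t \<in> {0..1} \<Longrightarrow> curve E t = curve D (\<psi> t) \<and> (t \<in> over E \<longleftrightarrow> \<psi> t \<in> over D)"
    and col: "colorable (gauss D) p q"
  shows "colorable (gauss E) p q"
proof -
  note r = reparametrization_mono[OF \<psi>]
  show ?thesis
  proof (rule colorable_reparametrization[OF r(1,3) \<psi>(2) r(4) _ _ col])
    show "gauss D (\<psi> t) = None" if "t \<in> {0..1}" "gauss E t = None" for t
      by (rule gauss_reparametrization(1)[OF D E \<psi> eq that])
    show "gauss D (\<psi> t) = Some (e, \<psi> s)" if "t \<in> {0..1}" "gauss E t = Some (e, s)" for t e s
      by (rule gauss_reparametrization(2)[OF D E \<psi> eq that])
  qed
qed

lemma elementary_move_colorable:
  assumes "elementary_move S D E"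
  shows "colorable (gauss D) p q \<longleftrightarrow> colorable (gauss E) p q"
  using assms
proof cases
  case (reparametrization \<psi>)
  define \<psi>' where "\<psi>' = inv_into {0..1} \<psi>"
  note r = reparametrization_mono[OF reparametrization(3,4)]
  have inj: "inj_on \<psi> {0..1}" using reparametrization(3) by (simp add: diffeo_def bij_betw_def)
  have \<psi>': "\<psi>' t \<in> {0..1}" "\<psi> (\<psi>' t) = t" if "t \<in> {0..1}" for t
    unfolding \<psi>'_def using inv_into_into[of t \<psi> "{0..1}"] f_inv_into_f[of t \<psi> "{0..1}"] that r(2) by simp_all
  have d: "diffeo {0..1} {0..1} \<psi>'" unfolding \<psi>'_def by (rule diffeo_inverse[OF reparametrization(3)])
  have 0: "\<psi>' 0 = 0" using inj reparametrization(4) inv_into_f_f[OF inj, of 0] by (simp add: \<psi>'_def)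
  show ?thesis
  proof
    assume "colorable (gauss D) p q"
    then show "colorable (gauss E) p q"
      using reparametrization_colorable[OF reparametrization(1-4)] reparametrization(5) by blast
  next
    assume "colorable (gauss E) p q"
    moreover have "curve D t = curve E (\<psi>' t) \<and> (t \<in> over D \<longleftrightarrow> \<psi>' t \<in> over E)" if "t \<in> {0..1}" for t
      using reparametrization(5) \<psi>'[OF that] by metis
    ultimately show "colorable (gauss D) p q"
      using reparametrization_colorable[OF reparametrization(2,1) d 0] by blast
  qed
next
  case (isotopy H)
  have "gauss E = gauss D"
    by (rule gauss_isotopy[OF isotopy(1-3)]) (use isotopy(4,5) in auto)
  then show ?thesis by simp
next
  case reidemeister
  then show ?thesis
    using reidemeister_I_colorable reidemeister_II_colorable reidemeister_III_colorable reidemeister_III_sym by metis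
qed

theorem diagram_equiv_colorable:
  assumes "diagram_equiv S D E"
  shows "colorable (gauss D) p q \<longleftrightarrow> colorable (gauss E) p q"
  using assms unfolding diagram_equiv_def
  by (induction rule: equivclp_induct) (auto simp: elementary_move_colorable)

end

section \<open>The coloring quandle and the two trefoils\<close>

type_synonym color = "(int \<times> int) \<times> (int \<times> int)"

fun area :: "int \<times> int \<Rightarrow> int \<times> int \<Rightarrow> int" where
  "area (x, y) (x', y') = x * y' - y * x'"

text \<open>The color \<open>(u, v)\<close> stands for the matrix with rows \<open>u\<close> and \<open>v\<close>. For matrices of determinant \<open>1\<close> the operation is
  \<open>x\<^bsup>-\<epsilon>\<^esup> g (h\<^bsup>-1\<^esup> x\<^bsup>\<epsilon>\<^esup> h)\<close> with the shear \<open>x = (1 1; 0 1)\<close>: the conjugate \<open>h\<^bsup>-1\<^esup> x\<^bsup>\<epsilon>\<^esup> h\<close> acts on rows as the transvection along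
  the second row \<open>w\<close> of \<open>h\<close>. The factor \<open>area u v\<close>, the determinant, makes the quandle laws hold for all matrices.\<close>

definition cross_under :: "bool \<Rightarrow> color \<Rightarrow> color \<Rightarrow> color" where
  "cross_under e x y = (case (x, y) of ((u, v), (_, w)) \<Rightarrow>
     let \<epsilon> = (if e then 1 else - 1);
         shear = (\<lambda>z. (fst z + \<epsilon> * area z w * fst w, snd z + \<epsilon> * area z w * snd w));
         v' = shear v; u' = shear u
     in ((fst u' - \<epsilon> * area u v * fst v', snd u' - \<epsilon> * area u v * snd v'), v'))"

lemma cross_under_simp:
  "cross_under e ((a, b), (c, d)) ((a', b'), (c', d')) =
    (let \<epsilon> = (if e then 1 else - 1); k = a * d - b * c;
         c'' = c + \<epsilon> * (c * d' - d * c') * c'; d'' = d + \<epsilon> * (c * d' - d * c') * d'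
     in ((a + \<epsilon> * (a * d' - b * c') * c' - \<epsilon> * k * c'', b + \<epsilon> * (a * d' - b * c') * d' - \<epsilon> * k * d''), (c'', d'')))"
  by (simp add: cross_under_def Let_def)

lemma quandle_cross_under: "quandle cross_under"
proof
  fix e d :: bool and x y z :: color
  obtain a b c d' where x: "x = ((a, b), (c, d'))" by (metis surj_pair)
  obtain a1 b1 c1 d1 where y: "y = ((a1, b1), (c1, d1))" by (metis surj_pair)
  obtain a2 b2 c2 d2 where z: "z = ((a2, b2), (c2, d2))" by (metis surj_pair)
  show "cross_under e x x = x"
    unfolding x by (cases e; simp add: cross_under_simp Let_def; intro conjI; algebra)
  show "cross_under (\<not> e) (cross_under e x y) y = x"
    unfolding x y by (cases e; simp add: cross_under_simp Let_def; intro conjI; algebra)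
  show "cross_under e (cross_under d x y) z = cross_under d (cross_under e x z) (cross_under e y z)"
    unfolding x y z by (cases e; cases d; simp add: cross_under_simp Let_def; intro conjI; algebra)
qed

definition base_color :: color where "base_color = ((1, 0), (0, 1))"
text \<open>This is the matrix \<open>-x\<^bsup>6\<^esup>\<close>.\<close>

definition longitude_color :: color where "longitude_color = ((- 1, - 6), (0, - 1))"

lemma negative_trefoil_colors:
  "cross_under False base_color ((0, - 1), (1, 3)) = ((- 1, - 5), (1, 4))"
  "cross_under False ((- 1, - 5), (1, 4)) base_color = ((0, - 1), (1, 3))"
  "cross_under False ((0, - 1), (1, 3)) ((- 1, - 5), (1, 4)) = longitude_color"
  by (simp_all add: cross_under_simp Let_def base_color_def longitude_color_def)

text \<open>The second rows alone force \<open>c\<^sup>2 + c = 0\<close> for the first entry \<open>c\<close> of the second row of \<open>x\<close>. For \<open>c = 0\<close> the second row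
  stays \<open>(0, 1)\<close> along the knotoid, so that the last one is not \<open>(0, -1)\<close>; for \<open>c = -1\<close> the first row of the last color comes out as \<open>(-1, 6)\<close>
  instead of \<open>(-1, -6)\<close>.\<close>

lemma positive_trefoil_no_colors:
  assumes "x = cross_under True base_color y" "y = cross_under True x longitude_color"
    "longitude_color = cross_under True y x"
  shows False
proof -
  obtain a b c d where x: "x = ((a, b), (c, d))" by (metis surj_pair)
  obtain a' b' c' d' where y: "y = ((a', b'), (c', d'))" by (metis surj_pair)
  note eqs = assms[unfolded x y base_color_def longitude_color_def cross_under_simp Let_def]
  have E1: "a = 1 + d' * c' - c" "b = d' * d' - d" "c = - c' * c'" "d = 1 - c' * d'"
    using arg_cong[OF eqs(1), of "\<lambda>z. fst (fst z)"] arg_cong[OF eqs(1), of "\<lambda>z. snd (fst z)"]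
      arg_cong[OF eqs(1), of "\<lambda>z. fst (snd z)"] arg_cong[OF eqs(1), of "\<lambda>z. snd (snd z)"]
    by simp_all
  have E2: "c' = c" "d' = d + c" "b' = b + a - (a * d - b * c) * d'"
    using arg_cong[OF eqs(2), of "\<lambda>z. fst (snd z)"] arg_cong[OF eqs(2), of "\<lambda>z. snd (snd z)"]
      arg_cong[OF eqs(2), of "\<lambda>z. snd (fst z)"]
    by simp_all
  have E2b: "a' = a - (a * d - b * c) * c'"
    using arg_cong[OF eqs(2), of "\<lambda>z. fst (fst z)"] E2(1) by simp
  have E3: "- 1 = d' + (c' * d - d' * c) * d"
    using arg_cong[OF eqs(3), of "\<lambda>z. snd (snd z)"] by simp
  have E3b: "- 6 = b' + (a' * d - b' * c) * d - (a' * d' - b' * c') * (d' + (c' * d - d' * c) * d)"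
    using arg_cong[OF eqs(3), of "\<lambda>z. snd (fst z)"] by simp
  have "c * (c + 1) = 0" using E1(3) E2(1) by algebra
  then consider "c = 0" | "c = - 1" by auto
  then show False
  proof cases
    case 1
    then show False using 1 E2(1,2) E3 E1(4) by simp
  next
    case 2
    have h1: "c' = - 1" "d' = d - 1" using E2(1,2) 2 by simp_all
    have h2: "a = 3 - d" "b = (d - 1) * (d - 1) - d" using E1(1,2) 2 unfolding h1 by simp_all
    note h = h1 h2
    have a': "a' = a + (a * d + b)" using E2b h(1) 2 by simp
    have b': "b' = b + a - (a * d + b) * (d - 1)" using E2(3) h(2) 2 by simp
    have "- 6 = b' + (a' * d + b') * d - (a' * (d - 1) + b') * (d - 1 + (- d + (d - 1)) * d)"
      using E3b unfolding h(1,2) 2 by simp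
    then show False unfolding a' b' h(3,4) by algebra
  qed
qed

context quandle begin

text \<open>The over-passages \<open>o1, o2, o3\<close> alternate with the under-passages \<open>u3, u1, u2\<close>; the strands are colored \<open>p, c1, c2, q\<close> in
  this order.\<close>

lemma trefoil_colorable:
  assumes ord: "0 < o1" "o1 < u3" "u3 < o2" "o2 < u1" "u1 < o3" "o3 < u2" "u2 < (1::real)"
    and g: "g u1 = Some (e, o1)" "g u2 = Some (e, o2)" "g u3 = Some (e, o3)"
      "\<And>t. t \<notin> {u1, u2, u3} \<Longrightarrow> g t = None"
    and c: "c1 = tri e p c2" "c2 = tri e c1 p" "q = tri e c2 c1"
  shows "colorable g p q"
proof -
  define k where "k = (\<lambda>t. if t \<le> u3 then p else if t \<le> u1 then c1 else if t \<le> u2 then c2 else q)"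
  have k: "k o1 = p" "k o2 = c1" "k o3 = c2" "k u3 = p" "k u1 = c1" "k u2 = c2" "k 0 = p" "k 1 = q"
    using ord by (auto simp: k_def)
  have passed: "passed g k t = (if t < u3 then p else if t < u1 then c1 else if t < u2 then c2 else q)" for t
  proof -
    consider "t = u1" | "t = u2" | "t = u3" | "t \<notin> {u1, u2, u3}" by auto
    then show ?thesis
    proof cases
      case 1
      show ?thesis unfolding 1 using ord k by (simp add: passed_def g c(2)[symmetric])
    next
      case 2
      show ?thesis unfolding 2 using ord k by (simp add: passed_def g c(3)[symmetric])
    next
      case 3
      show ?thesis unfolding 3 using ord k by (simp add: passed_def g c(1)[symmetric])
    next
      case 4
      then have "passed g k t = k t" by (simp add: passed_def g)
      then show ?thesis using 4 by (auto simp: k_def)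
    qed
  qed
  have "coloring_on g k 0 1"
    unfolding coloring_on_def
  proof safe
    fix t :: real
    from eventually_le_threshold(1)[of u3 t] eventually_le_threshold(1)[of u1 t] eventually_le_threshold(1)[of u2 t]
    show "\<forall>\<^sub>F x in at_left t. k x = k t" by eventually_elim (simp add: k_def)
    from eventually_le_threshold(2)[of u3 t] eventually_le_threshold(2)[of u1 t] eventually_le_threshold(2)[of u2 t]
    show "\<forall>\<^sub>F x in at_right t. k x = passed g k t" unfolding passed by eventually_elim (simp add: k_def)
  qed
  with k show ?thesis by (auto simp: colorable_def)
qed

lemma mirror_trefoil_colorableD:
  assumes ord: "0 < o1" "o1 < u3" "u3 < o2" "o2 < u1" "u1 < o3" "o3 < u2" "u2 < (1::real)"
    and g: "g o1 = Some (e, u1)" "g o2 = Some (e, u2)" "g o3 = Some (e, u3)"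
      "\<And>t. t \<notin> {o1, o2, o3} \<Longrightarrow> g t = None"
    and col: "colorable g p q"
  obtains c1 c2 where "c1 = tri e p c2" "c2 = tri e c1 q" "q = tri e c2 c1"
proof -
  obtain k where k: "coloring_on g k 0 1" "k 0 = p" "k 1 = q" using col by (auto simp: colorable_def)
  have const: "k t = passed g k s" if "0 \<le> s" "s < t" "t \<le> 1" "{s<..<t} \<inter> {o1, o2, o3} = {}" for s t
    by (rule coloring_on_passed[OF k(1) that(1-3)]) (use that(4) in \<open>auto intro!: g(4)\<close>)
  have p0: "passed g k 0 = p" using ord k by (simp add: passed_def g)
  have ko1: "k o1 = p" using const[of 0 o1] p0 ord by auto
  have P: "passed g k o1 = tri e p (k u1)" "passed g k o2 = tri e (k o2) (k u2)" "passed g k o3 = tri e (k o3) (k u3)"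
    using ko1 by (simp_all add: passed_def g)
  have c1: "k u3 = tri e p (k u1)" "k o2 = tri e p (k u1)" using const[of o1 u3] const[of o1 o2] P ord by auto
  have c2: "k u1 = tri e (k o2) (k u2)" "k o3 = tri e (k o2) (k u2)" using const[of o2 u1] const[of o2 o3] P ord by auto
  have c3: "k u2 = tri e (k o3) (k u3)" "q = tri e (k o3) (k u3)" using const[of o3 u2] const[of o3 1] P ord k by auto
  have "k o2 = k u3" "k o3 = k u1" "k u2 = q" using c1 c2 c3 by argo+
  then have "k u1 = tri e (k u3) q" "q = tri e (k u1) (k u3)" using c2(1) c3(2) by argo+
  then show ?thesis using c1(1) that[of "k u3" "k u1"] by blast
qed

end

section \<open>Smooth functions of one real variable\<close>

lemma Ck_on_Suc_real:
  fixes f :: "real \<Rightarrow> 'b::euclidean_space"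
  shows "Ck_on (Suc k) f UNIV \<longleftrightarrow> (\<exists>f'. (\<forall>x. (f has_vector_derivative f' x) (at x)) \<and> (\<forall>v. Ck_on k (\<lambda>x. v *\<^sub>R f' x) UNIV))"
proof
  assume *: "Ck_on (Suc k) f UNIV"
  define f' where "f' = (\<lambda>x. frechet_derivative f (at x) 1)"
  have d: "(f has_derivative frechet_derivative f (at x)) (at x)" for x
    using * by (simp add: frechet_derivative_works)
  then have "frechet_derivative f (at x) v = v *\<^sub>R f' x" for x v
    unfolding f'_def using linear_scale[OF has_derivative_linear[OF d[of x]], of v 1] by simp
  then have "frechet_derivative f (at x) = (\<lambda>v. v *\<^sub>R f' x)" for x by blast
  then show "\<exists>f'. (\<forall>x. (f has_vector_derivative f' x) (at x)) \<and> (\<forall>v. Ck_on k (\<lambda>x. v *\<^sub>R f' x) UNIV)"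
    using d * by (intro exI[of _ f']) (simp add: has_vector_derivative_def)
next
  assume "\<exists>f'. (\<forall>x. (f has_vector_derivative f' x) (at x)) \<and> (\<forall>v. Ck_on k (\<lambda>x. v *\<^sub>R f' x) UNIV)"
  then obtain f' where f': "\<And>x. (f has_derivative (\<lambda>v. v *\<^sub>R f' x)) (at x)" "\<And>v. Ck_on k (\<lambda>x. v *\<^sub>R f' x) UNIV"
    by (auto simp: has_vector_derivative_def)
  then have "frechet_derivative f (at x) = (\<lambda>v. v *\<^sub>R f' x)" for x
    using frechet_derivative_at by metis
  then show "Ck_on (Suc k) f UNIV" using f' by (auto simp: differentiable_def)
qed

lemma Ck_on_linear:
  fixes f :: "real \<Rightarrow> 'b::euclidean_space" and L :: "'b \<Rightarrow> 'c::euclidean_space"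
  assumes "bounded_linear L" "Ck_on k f UNIV" shows "Ck_on k (\<lambda>x. L (f x)) UNIV"
  using assms(2)
proof (induction k arbitrary: f)
  case 0
  then show ?case using bounded_linear.continuous_on[OF assms(1)] by simp
next
  case (Suc k)
  then obtain f' where f': "\<And>x. (f has_vector_derivative f' x) (at x)" "\<And>v. Ck_on k (\<lambda>x. v *\<^sub>R f' x) UNIV"
    unfolding Ck_on_Suc_real by blast
  have "Ck_on k (\<lambda>x. v *\<^sub>R L (f' x)) UNIV" for v
    using Suc.IH[OF f'(2)[of v]] linear_scale[OF bounded_linear.linear[OF assms(1)]] by simp
  then show ?case unfolding Ck_on_Suc_real
    using bounded_linear.has_vector_derivative[OF assms(1) f'(1)] by (intro exI[of _ "\<lambda>x. L (f' x)"]) simp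
qed

text \<open>On the real line directional derivatives are multiples of one derivative. This recursion yields the closure
  properties by induction.\<close>

lemma Ck_on_Suc_real':
  fixes f :: "real \<Rightarrow> 'b::euclidean_space"
  shows "Ck_on (Suc k) f UNIV \<longleftrightarrow> (\<exists>f'. (\<forall>x. (f has_vector_derivative f' x) (at x)) \<and> Ck_on k f' UNIV)"
  unfolding Ck_on_Suc_real
  using Ck_on_linear[OF bounded_linear_scaleR_right] by (metis (no_types, lifting) ext scaleR_one)

lemma Ck_on_Suc_imp: "Ck_on (Suc k) (f :: real \<Rightarrow> 'b::euclidean_space) UNIV \<Longrightarrow> Ck_on k f UNIV"
proof (induction k arbitrary: f)
  case 0
  then obtain f' where "\<And>x. (f has_vector_derivative f' x) (at x)" unfolding Ck_on_Suc_real' by blast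
  then have "continuous (at x) f" for x using has_vector_derivative_continuous by blast
  then show ?case by (simp add: continuous_at_imp_continuous_on)
next
  case (Suc k)
  obtain f' where f': "\<And>x. (f has_vector_derivative f' x) (at x)" "Ck_on (Suc k) f' UNIV"
    using Suc.prems unfolding Ck_on_Suc_real'[of "Suc k"] by blast
  from f'(1) Suc.IH[OF f'(2)] show ?case unfolding Ck_on_Suc_real' by (intro exI[of _ f']) simp
qed

definition smooth :: "(real \<Rightarrow> 'b::euclidean_space) \<Rightarrow> bool" where
  "smooth f \<longleftrightarrow> (\<forall>k. Ck_on k f UNIV)"

lemma smooth_imp_smooth_on: "smooth f \<Longrightarrow> smooth_on A f"
  unfolding smooth_on_def smooth_def by (intro ballI exI[of _ UNIV] exI[of _ f]) auto

lemma smooth_linear: "bounded_linear L \<Longrightarrow> smooth f \<Longrightarrow> smooth (\<lambda>x. L (f x))"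
  using Ck_on_linear by (auto simp: smooth_def)

lemma Ck_on_add:
  fixes f g :: "real \<Rightarrow> 'b::euclidean_space"
  shows "Ck_on k f UNIV \<Longrightarrow> Ck_on k g UNIV \<Longrightarrow> Ck_on k (\<lambda>x. f x + g x) UNIV"
proof (induction k arbitrary: f g)
  case (Suc k)
  obtain f' where f': "\<And>x. (f has_vector_derivative f' x) (at x)" "Ck_on k f' UNIV"
    using Suc.prems(1) unfolding Ck_on_Suc_real' by blast
  obtain g' where g': "\<And>x. (g has_vector_derivative g' x) (at x)" "Ck_on k g' UNIV"
    using Suc.prems(2) unfolding Ck_on_Suc_real' by blast
  show ?case
    unfolding Ck_on_Suc_real'
    using Suc.IH[OF f'(2) g'(2)] has_vector_derivative_add[OF f'(1) g'(1)]
    by (intro exI[of _ "\<lambda>x. f' x + g' x"]) simp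
qed (simp add: continuous_on_add)

lemma Ck_on_mult:
  fixes f g :: "real \<Rightarrow> real"
  shows "Ck_on k f UNIV \<Longrightarrow> Ck_on k g UNIV \<Longrightarrow> Ck_on k (\<lambda>x. f x * g x) UNIV"
proof (induction k arbitrary: f g)
  case (Suc k)
  obtain f' where f': "\<And>x. (f has_vector_derivative f' x) (at x)" "Ck_on k f' UNIV"
    using Suc.prems(1) unfolding Ck_on_Suc_real' by blast
  obtain g' where g': "\<And>x. (g has_vector_derivative g' x) (at x)" "Ck_on k g' UNIV"
    using Suc.prems(2) unfolding Ck_on_Suc_real' by blast
  have "Ck_on k (\<lambda>x. f x * g' x + f' x * g x) UNIV"
    by (rule Ck_on_add[OF Suc.IH[OF Ck_on_Suc_imp[OF Suc.prems(1)] g'(2)] Suc.IH[OF f'(2) Ck_on_Suc_imp[OF Suc.prems(2)]]])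
  then show ?case
    unfolding Ck_on_Suc_real' using has_vector_derivative_mult[OF f'(1) g'(1)]
    by (intro exI[of _ "\<lambda>x. f x * g' x + f' x * g x"]) simp
qed (simp add: continuous_on_mult)

lemma Ck_on_inverse:
  fixes f :: "real \<Rightarrow> real"
  assumes nz: "\<And>x. f x \<noteq> 0"
  shows "Ck_on k f UNIV \<Longrightarrow> Ck_on k (\<lambda>x. inverse (f x)) UNIV"
proof (induction k)
  case (Suc k)
  obtain f' where f': "\<And>x. (f has_vector_derivative f' x) (at x)" "Ck_on k f' UNIV"
    using Suc.prems unfolding Ck_on_Suc_real' by blast
  have 1: "Ck_on k (\<lambda>x. - (f' x * (inverse (f x) * inverse (f x)))) UNIV"
    using Ck_on_linear[OF bounded_linear_minus[OF bounded_linear_ident] Ck_on_mult[OF f'(2) Ck_on_mult]]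
      Suc.IH[OF Ck_on_Suc_imp[OF Suc.prems]] by simp
  have "((\<lambda>x. inverse (f x)) has_vector_derivative - (f' x * (inverse (f x) * inverse (f x)))) (at x)" for x
    using DERIV_inverse'[of f "f' x" x UNIV] f'(1)[of x] nz[of x]
    by (simp add: has_real_derivative_iff_has_vector_derivative mult_ac)
  with 1 show ?case unfolding Ck_on_Suc_real'
    by (intro exI[of _ "\<lambda>x. - (f' x * (inverse (f x) * inverse (f x)))"]) simp
qed (simp add: continuous_on_inverse nz)

lemma Ck_on_const: "Ck_on k (\<lambda>x. c :: 'b::euclidean_space) (UNIV :: real set)"
proof (induction k arbitrary: c)
  case (Suc k)
  then show ?case unfolding Ck_on_Suc_real' by (intro exI[of _ "\<lambda>_. 0"]) auto
qed simp

lemma Ck_on_sin_cos: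
  fixes a b :: real
  shows "Ck_on k (\<lambda>x. sin (a * x + b)) UNIV \<and> Ck_on k (\<lambda>x. cos (a * x + b)) UNIV"
proof (induction k)
  case 0
  show ?case by (auto intro!: continuous_intros)
next
  case (Suc k)
  have ds: "((\<lambda>x. sin (a * x + b)) has_vector_derivative a * cos (a * x + b)) (at x)"
    and dc: "((\<lambda>x. cos (a * x + b)) has_vector_derivative (- a) * sin (a * x + b)) (at x)" for x
    unfolding has_real_derivative_iff_has_vector_derivative[symmetric]
    by (auto intro!: derivative_eq_intros)
  have cs: "Ck_on k (\<lambda>x. a * cos (a * x + b)) UNIV"
    by (rule Ck_on_mult[OF Ck_on_const conjunct2[OF Suc]])
  have cc: "Ck_on k (\<lambda>x. (- a) * sin (a * x + b)) UNIV"
    by (rule Ck_on_mult[OF Ck_on_const conjunct1[OF Suc]])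
  show ?case unfolding Ck_on_Suc_real'
  proof (rule conjI)
    show "\<exists>f'. (\<forall>x. ((\<lambda>x. sin (a * x + b)) has_vector_derivative f' x) (at x)) \<and> Ck_on k f' UNIV"
      by (rule exI[of _ "\<lambda>x. a * cos (a * x + b)"], rule conjI, rule allI, rule ds, rule cs)
    show "\<exists>f'. (\<forall>x. ((\<lambda>x. cos (a * x + b)) has_vector_derivative f' x) (at x)) \<and> Ck_on k f' UNIV"
      by (rule exI[of _ "\<lambda>x. (- a) * sin (a * x + b)"], rule conjI, rule allI, rule dc, rule cc)
  qed
qed

lemma smooth_sin: "smooth (\<lambda>x::real. sin (a * x + b))" and smooth_cos: "smooth (\<lambda>x::real. cos (a * x + b))"
  using Ck_on_sin_cos by (auto simp: smooth_def)
lemma smooth_add: "smooth f \<Longrightarrow> smooth g \<Longrightarrow> smooth (\<lambda>x. f x + g x)"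
  by (simp add: smooth_def Ck_on_add)
lemma smooth_mult: "smooth f \<Longrightarrow> smooth g \<Longrightarrow> smooth (\<lambda>x. f x * g x :: real)"
  by (simp add: smooth_def Ck_on_mult)
lemma smooth_inverse: "smooth f \<Longrightarrow> (\<And>x. f x \<noteq> 0) \<Longrightarrow> smooth (\<lambda>x. inverse (f x) :: real)"
  by (simp add: smooth_def Ck_on_inverse)
lemma smooth_const: "smooth (\<lambda>x. c)"
  by (simp add: smooth_def Ck_on_const)

lemma smooth_sum: "finite I \<Longrightarrow> (\<And>i. i \<in> I \<Longrightarrow> smooth (f i)) \<Longrightarrow> smooth (\<lambda>x. \<Sum>i\<in>I. f i x)"
  by (induction I rule: finite_induct) (auto intro: smooth_const smooth_add)

lemma smooth_vec:
  fixes f :: "real \<Rightarrow> real ^ 'n"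
  assumes "\<And>i. smooth (\<lambda>x. f x $ i)" shows "smooth f"
proof -
  have "smooth (\<lambda>x. \<Sum>i\<in>UNIV. (f x $ i) *\<^sub>R axis i 1)"
    by (intro smooth_sum smooth_linear[OF bounded_linear_scaleR_left] assms) simp
  also have "(\<lambda>x. \<Sum>i\<in>UNIV. (f x $ i) *\<^sub>R axis i 1) = f"
    using basis_expansion[of "f x" for x] by (intro ext) (simp add: scalar_mult_eq_scaleR)
  finally show ?thesis .
qed

section \<open>The double points of the trefoil curve\<close>

text \<open>The angles run from \<open>-arc_end\<close> to \<open>arc_end\<close>; the two angles of a crossing are at distance \<open>half_gap\<close> from their mean,
  modulo \<open>2 \<pi>\<close>.\<close>

abbreviation "arc_end \<equiv> 11 * pi / 12"
abbreviation "half_gap \<equiv> arccos (1/4)"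

lemma half_gap_bounds: "cos half_gap = 1/4" "pi / 3 < half_gap" "half_gap < pi / 2" "sin half_gap > 0"
proof -
  show *: "cos half_gap = 1/4" by simp
  show "pi / 3 < half_gap"
    using arccos_less_arccos[of "1/4" "1/2"] arccos_cos[of "pi/3"] by (simp add: cos_60)
  show **: "half_gap < pi / 2" using arccos_less_arccos[of 0 "1/4"] by simp
  show "sin half_gap > 0" using \<open>pi / 3 < half_gap\<close> ** by (intro sin_gt_zero) (use pi_gt_zero in linarith)+
qed

text \<open>The angles of the three crossings, over-passage first.\<close>

definition trefoil_pair :: "real \<Rightarrow> real \<Rightarrow> bool" where
  "trefoil_pair x y \<longleftrightarrow> (x = - pi/3 - half_gap \<and> y = - pi/3 + half_gap) \<or> (x = pi/3 - half_gap \<and> y = pi/3 + half_gap) \<or> (x = pi - half_gap \<and> y = - pi + half_gap)"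

text \<open>With the mean \<open>m\<close> and half the difference \<open>d\<close> of the two angles as variables, the sum-to-product formulas split off \<open>sin d\<close>.\<close>

lemma trefoil_curve_diff:
  fixes m d :: real
  shows "trefoil_curve (m + d) = trefoil_curve (m - d) \<longleftrightarrow>
    sin d * (cos m + 4 * cos (2 * m) * cos d) = 0 \<and> sin d * (4 * sin (2 * m) * cos d - sin m) = 0"
proof -
  have 1: "trefoil_curve (m + d) $ 1 - trefoil_curve (m - d) $ 1 = 2 * (sin d * (cos m + 4 * cos (2 * m) * cos d))"
  proof -
    have "sin (2 * (m + d)) - sin (2 * (m - d)) = 4 * cos (2 * m) * sin d * cos d"
      unfolding distrib_left right_diff_distrib sin_add[of "2*m"] sin_diff[of "2*m"] by (simp add: sin_double)
    moreover have "sin (m + d) - sin (m - d) = 2 * cos m * sin d" by (simp add: sin_add sin_diff)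
    ultimately show ?thesis by (simp add: trefoil_curve_def algebra_simps)
  qed
  have 2: "trefoil_curve (m + d) $ 2 - trefoil_curve (m - d) $ 2 = 2 * (sin d * (4 * sin (2 * m) * cos d - sin m))"
  proof -
    have "cos (2 * (m + d)) - cos (2 * (m - d)) = - 4 * sin (2 * m) * sin d * cos d"
      unfolding distrib_left right_diff_distrib cos_add[of "2*m"] cos_diff[of "2*m"] by (simp add: sin_double)
    moreover have "cos (m + d) - cos (m - d) = - 2 * sin m * sin d" by (simp add: cos_add cos_diff)
    ultimately show ?thesis by (simp add: trefoil_curve_def algebra_simps)
  qed
  have "trefoil_curve (m + d) = trefoil_curve (m - d) \<longleftrightarrow>
      trefoil_curve (m + d) $ 1 - trefoil_curve (m - d) $ 1 = 0 \<and> trefoil_curve (m + d) $ 2 - trefoil_curve (m - d) $ 2 = 0"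
    by (auto simp: vec_eq_iff forall_2)
  also have "\<dots> \<longleftrightarrow> sin d * (cos m + 4 * cos (2 * m) * cos d) = 0 \<and> sin d * (4 * sin (2 * m) * cos d - sin m) = 0"
    unfolding 1 2 by simp
  finally show ?thesis .
qed

lemma abs_eq_of_cos_eq: "\<bar>x\<bar> \<le> pi \<Longrightarrow> 0 \<le> y \<Longrightarrow> y \<le> pi \<Longrightarrow> cos x = cos y \<Longrightarrow> \<bar>x\<bar> = y"
  using cos_inj_pi[of "\<bar>x\<bar>" y] by (simp only: cos_abs_real abs_ge_zero simp_thms)

lemma trefoil_pair_eq: "trefoil_pair x y \<Longrightarrow> trefoil_curve x = trefoil_curve y"
proof -
  have A: "trefoil_curve (m + half_gap) = trefoil_curve (m - half_gap)" if "cos m = 1/2" for m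
  proof -
    have "cos (2 * m) = - 1/2" unfolding cos_double_cos that by (simp add: power2_eq_square)
    moreover have "sin (2 * m) = sin m" unfolding sin_double that by simp
    ultimately show ?thesis using that unfolding trefoil_curve_diff by (simp add: half_gap_bounds(1))
  qed
  have B: "trefoil_curve (0 + (pi - half_gap)) = trefoil_curve (0 - (pi - half_gap))"
    unfolding trefoil_curve_diff by (simp add: half_gap_bounds(1))
  assume "trefoil_pair x y"
  then consider "x = - pi/3 - half_gap \<and> y = - pi/3 + half_gap" | "x = pi/3 - half_gap \<and> y = pi/3 + half_gap" | "x = pi - half_gap \<and> y = - pi + half_gap"
    by (auto simp: trefoil_pair_def)
  then show ?thesis
  proof cases
    case 1 then show ?thesis using A[of "- pi / 3"] by (simp add: cos_60)
  next
    case 2 then show ?thesis using A[of "pi / 3"] by (simp add: cos_60)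
  next
    case 3 then show ?thesis using B by simp
  qed
qed

text \<open>Adding the squares of the two equations of \<open>trefoil_curve_diff\<close> gives \<open>16 cos\<^sup>2 d = 1\<close>. Each of the two signs of \<open>cos d\<close> leaves
  three values of \<open>m\<close> modulo \<open>2 \<pi>\<close>, so that every crossing of the closed curve is found twice; the bounds on the angles keep
  one of the two.\<close>

lemma trefoil_double_points:
  assumes "\<bar>x\<bar> \<le> arc_end" "\<bar>y\<bar> \<le> arc_end" "x \<noteq> y" "trefoil_curve x = trefoil_curve y"
  shows "trefoil_pair x y \<or> trefoil_pair y x"
proof -
  have main: "trefoil_pair x y \<or> trefoil_pair y x"
    if le: "\<bar>x\<bar> \<le> arc_end" "\<bar>y\<bar> \<le> arc_end" and lt: "y < x" and eq: "trefoil_curve x = trefoil_curve y" for x y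
  proof -
    define m d where "m = (x + y) / 2" and "d = (x - y) / 2"
    have xy: "x = m + d" "y = m - d" by (simp_all add: m_def d_def field_simps)
    have pi: "pi > 0" by simp
    have d: "0 < d" "d \<le> arc_end" using le lt by (auto simp: d_def)
    have m: "\<bar>m\<bar> \<le> arc_end" "\<bar>m\<bar> + d \<le> arc_end"
      using le[unfolded xy] d(1) by (simp_all only: abs_le_iff, linarith+)
    have sd: "sin d > 0" using d pi by (intro sin_gt_zero) linarith+
    have e: "cos m + 4 * cos (2 * m) * cos d = 0" "4 * sin (2 * m) * cos d = sin m"
      using eq sd unfolding xy trefoil_curve_diff by auto
    have acd: "arccos (cos d) = d" using d pi by (intro arccos_cos) linarith+
    have "(cos m)\<^sup>2 + (sin m)\<^sup>2 = (4 * cos d)\<^sup>2 * ((cos (2 * m))\<^sup>2 + (sin (2 * m))\<^sup>2)"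
      using e by algebra
    then have "(4 * cos d)\<^sup>2 = 1" by (simp add: add.commute)
    then have "(4 * cos d - 1) * (4 * cos d + 1) = 0" by (simp add: power2_eq_square algebra_simps)
    then consider "cos d = 1 / 4" | "cos d = - (1 / 4)" by auto
    then show ?thesis
    proof cases
      case 1
      then have dc: "d = half_gap" using acd by (simp only:)
      have sm: "sin m * (1 - 2 * cos m) = 0" using e(2) unfolding 1 sin_double by (simp add: algebra_simps)
      have cm: "cos m = - cos (2 * m)" using e(1) unfolding 1 by simp
      have "cos m = 1 / 2"
      proof (rule ccontr)
        assume "cos m \<noteq> 1 / 2"
        then have "sin m = 0" using sm by auto
        then have "m = 0" using m pi sin_zero_pi_iff[of m] by linarith
        with cm show False by simp
      qed
      then have "\<bar>m\<bar> = pi / 3" using m pi by (intro abs_eq_of_cos_eq) (auto simp: cos_60)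
      then have "m = pi / 3 \<or> m = - pi / 3" by linarith
      then show ?thesis using xy dc by (auto simp: trefoil_pair_def)
    next
      case 2
      have "d = arccos (- (1 / 4))" using acd 2 by (simp only:)
      then have dc: "d = pi - half_gap" by (simp add: arccos_minus)
      have sm: "sin m * (1 + 2 * cos m) = 0" using e(2) unfolding 2 sin_double by (simp add: algebra_simps)
      have "m = 0"
      proof (rule ccontr)
        assume "m \<noteq> 0"
        then have "sin m \<noteq> 0" using m pi sin_zero_pi_iff[of m] by linarith
        then have "cos m = - (1 / 2)" using sm by auto
        then have "cos m = cos (2 * pi / 3)" using cos_120 by simp
        then have "\<bar>m\<bar> = 2 * pi / 3" using m pi by (intro abs_eq_of_cos_eq) auto
        then show False using m(2) dc half_gap_bounds(3) by linarith
      qed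
      then show ?thesis using xy dc by (auto simp: trefoil_pair_def)
    qed
  qed
  show ?thesis
  proof (cases "y < x")
    case True then show ?thesis using main[of x y] assms by simp
  next
    case False then show ?thesis using main[of y x] assms by auto
  qed
qed

definition trefoil_vel :: "real \<Rightarrow> real \<times> real" where
  "trefoil_vel \<theta> = (cos \<theta> + 4 * cos (2 * \<theta>), 4 * sin (2 * \<theta>) - sin \<theta>)"

definition det2 :: "real \<times> real \<Rightarrow> real \<times> real \<Rightarrow> real" where
  "det2 v w = fst v * snd w - snd v * fst w"

lemma trefoil_vel_nonzero: "(fst (trefoil_vel \<theta>))\<^sup>2 + (snd (trefoil_vel \<theta>))\<^sup>2 > 0"
proof -
  have "(fst (trefoil_vel \<theta>))\<^sup>2 + (snd (trefoil_vel \<theta>))\<^sup>2 =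
      ((cos \<theta>)\<^sup>2 + (sin \<theta>)\<^sup>2) + 16 * ((cos (2 * \<theta>))\<^sup>2 + (sin (2 * \<theta>))\<^sup>2) + 8 * (cos \<theta> * cos (2 * \<theta>) - sin \<theta> * sin (2 * \<theta>))"
    unfolding trefoil_vel_def fst_conv snd_conv by algebra
  also have "\<dots> = 17 + 8 * cos (\<theta> + 2 * \<theta>)" unfolding cos_add[of \<theta> "2 * \<theta>"] by simp
  also have "\<dots> > 0" using cos_ge_minus_one[of "\<theta> + 2 * \<theta>"] by linarith
  finally show ?thesis .
qed

text \<open>The velocities are sums of two rotating vectors, so their determinant is a short trigonometric polynomial in \<open>m\<close> and \<open>d\<close>,
  whose value at the crossings is known.\<close>

lemma det2_trefoil_vel:
  "det2 (trefoil_vel (m - d)) (trefoil_vel (m + d)) = - sin (2 * d) + 16 * sin (4 * d) + 8 * cos (3 * m) * sin d"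
proof -
  have 1: "det2 (trefoil_vel x) (trefoil_vel y) =
     - sin (y - x) + 16 * sin (2 * y - 2 * x) + 4 * (sin (x + 2 * y) - sin (2 * x + y))" for x y
    unfolding det2_def trefoil_vel_def sin_diff sin_add fst_conv snd_conv by (simp add: algebra_simps)
  have "sin (m - d + 2 * (m + d)) - sin (2 * (m - d) + (m + d)) = sin (3 * m + d) - sin (3 * m - d)"
    by (simp add: algebra_simps)
  also have "\<dots> = 2 * cos (3 * m) * sin d" by (simp add: sin_add sin_diff)
  finally have 2: "sin (m - d + 2 * (m + d)) - sin (2 * (m - d) + (m + d)) = 2 * cos (3 * m) * sin d" .
  have 3: "m + d - (m - d) = 2 * d" "2 * (m + d) - 2 * (m - d) = 4 * d" by (simp_all add: algebra_simps)
  show ?thesis unfolding 1 2 3 by simp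
qed

lemma trefoil_pair_negative:
  assumes "trefoil_pair x y" shows "det2 (trefoil_vel x) (trefoil_vel y) < 0"
proof -
  have s4: "sin (4 * d) = 2 * sin (2 * d) * cos (2 * d)" for d :: real
    using sin_double[of "2 * d"] by simp
  have A: "det2 (trefoil_vel (m - half_gap)) (trefoil_vel (m + half_gap)) < 0" if "cos (3 * m) = - 1" for m
  proof -
    have "cos (2 * half_gap) = - 7 / 8" by (simp add: cos_double_cos half_gap_bounds(1) power2_eq_square)
    moreover have "sin (2 * half_gap) = sin half_gap / 2" by (simp add: sin_double half_gap_bounds(1))
    ultimately show ?thesis using half_gap_bounds(4) that unfolding det2_trefoil_vel s4 by simp
  qed
  have B: "det2 (trefoil_vel (0 - (half_gap - pi))) (trefoil_vel (0 + (half_gap - pi))) < 0"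
  proof -
    have cd: "cos (half_gap - pi) = - 1 / 4" "sin (half_gap - pi) = - sin half_gap" by (simp_all add: cos_diff sin_diff half_gap_bounds(1))
    have "cos (2 * (half_gap - pi)) = - 7 / 8" unfolding cos_double_cos cd by (simp add: power2_eq_square)
    moreover have "sin (2 * (half_gap - pi)) = sin half_gap / 2" unfolding sin_double cd by simp
    ultimately show ?thesis using half_gap_bounds(4) unfolding det2_trefoil_vel s4 cd by simp
  qed
  consider "x = - pi/3 - half_gap \<and> y = - pi/3 + half_gap" | "x = pi/3 - half_gap \<and> y = pi/3 + half_gap" | "x = pi - half_gap \<and> y = - pi + half_gap"
    using assms by (auto simp: trefoil_pair_def)
  then show ?thesis
  proof cases
    case 1 then show ?thesis using A[of "- pi / 3"] by simp
  next
    case 2 then show ?thesis using A[of "pi / 3"] by simp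
  next
    case 3 then show ?thesis using B by simp
  qed
qed

section \<open>Chirality of the trefoil in the plane and on the sphere\<close>

lemma (in oriented_surface) dim_of_vol_nonzero:
  assumes "vol x v w \<noteq> 0" shows "dim {v, w} = 2"
proof -
  have 1: "vol x (k *\<^sub>R u) u' = k * vol x u u'" for k u u' using vol_scale[of x k u 1 u'] by simp
  have vw: "v \<noteq> w" using assms vol_same by auto
  have wnz: "w \<noteq> 0" using vol_scale[of x 1 v 0 w] assms by auto
  have "v \<notin> span {w}" using assms 1 by (auto simp: span_singleton)
  then have "independent {v, w}" using wnz by (simp add: independent_insert vw)
  then show ?thesis using vw by (simp add: dim_eq_card_independent)
qed

lemma knotoid_diagram_mirror:
  assumes "knotoid_diagram S D" shows "knotoid_diagram S (mirror D)"
  unfolding knotoid_diagram_def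
proof (intro conjI ballI impI)
  show "generic_immersion S (curve (mirror D))" using assms by (simp add: knotoid_diagram_def mirror_def)
  show "over (mirror D) \<subseteq> crossing_params (curve (mirror D))" by (auto simp: mirror_def)
  fix s t :: real assume st: "s \<in> {0..1}" "t \<in> {0..1}" "s \<noteq> t \<and> curve (mirror D) s = curve (mirror D) t"
  then have "crosses D s t" by (auto simp: crosses_def mirror_def)
  moreover from st have "s \<in> crossing_params (curve D)" "t \<in> crossing_params (curve D)"
    unfolding crossing_params_def by (auto simp: mirror_def)
  ultimately show "s \<in> over (mirror D) \<longleftrightarrow> t \<notin> over (mirror D)"
    using crosses_over[OF assms] by (auto simp: mirror_def)
qed

lemma trefoil_order:
  "- arc_end < - pi/3 - half_gap" "- pi/3 - half_gap < - pi + half_gap" "- pi + half_gap < pi/3 - half_gap" "pi/3 - half_gap < - pi/3 + half_gap"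
  "- pi/3 + half_gap < pi - half_gap" "pi - half_gap < pi/3 + half_gap" "pi/3 + half_gap < arc_end"
  using half_gap_bounds(2,3) pi_gt_zero by linarith+

lemma trefoil_pair_unique:
  assumes "trefoil_pair x y \<or> trefoil_pair y x" "trefoil_pair x z \<or> trefoil_pair z x"
  shows "y = z"
  using assms trefoil_order unfolding trefoil_pair_def by argo

lemma trefoil_pair_bound: "trefoil_pair x y \<Longrightarrow> \<bar>x\<bar> < arc_end \<and> \<bar>y\<bar> < arc_end \<and> x \<noteq> y"
  using trefoil_order unfolding trefoil_pair_def abs_less_iff by argo

lemma trefoil_pair_asym: "trefoil_pair x y \<Longrightarrow> \<not> trefoil_pair y z"
  using trefoil_order unfolding trefoil_pair_def by argo

definition trefoil_param :: "real \<Rightarrow> real" where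
  "trefoil_param \<theta> = (\<theta> / arc_end + 1) / 2"

lemma arc_end_pos: "arc_end > 0"
  by simp

lemma trefoil_angle_param [simp]: "trefoil_angle (trefoil_param \<theta>) = \<theta>"
proof -
  have "(2 * ((\<theta> / w + 1) / 2) - 1) * w = \<theta>" if "w > 0" for w :: real using that by (simp add: field_simps)
  from this[OF arc_end_pos] show ?thesis unfolding trefoil_angle_def trefoil_param_def .
qed

lemma trefoil_param_angle: "trefoil_param (trefoil_angle u) = u"
proof -
  have "((2 * u - 1) * w / w + 1) / 2 = u" if "w > 0" for w :: real using that by (simp add: field_simps)
  from this[OF arc_end_pos] show ?thesis unfolding trefoil_angle_def trefoil_param_def .
qed

lemma trefoil_param_less: "x < y \<Longrightarrow> trefoil_param x < trefoil_param y"
proof -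
  assume "x < y"
  then have "(x / w + 1) / 2 < (y / w + 1) / 2" if "w > 0" for w :: real using that by (simp add: divide_strict_right_mono)
  from this[OF arc_end_pos] show ?thesis unfolding trefoil_param_def .
qed

lemma trefoil_param_ends: "trefoil_param (- arc_end) = 0" "trefoil_param arc_end = 1"
proof -
  have "((- w) / w + 1) / 2 = 0" "(w / w + 1) / 2 = 1" if "w > 0" for w :: real using that by (simp_all add: field_simps)
  from this[OF arc_end_pos] show "trefoil_param (- arc_end) = 0" "trefoil_param arc_end = 1" unfolding trefoil_param_def by blast+
qed

lemma trefoil_param_01: "\<bar>x\<bar> < arc_end \<Longrightarrow> trefoil_param x \<in> {0<..<1}"
  using trefoil_param_less[of "- arc_end" x] trefoil_param_less[of x arc_end] unfolding trefoil_param_ends by auto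

lemma trefoil_angle_bound: "u \<in> {0..1} \<Longrightarrow> \<bar>trefoil_angle u\<bar> \<le> arc_end"
proof -
  assume "u \<in> {0..1}"
  then have "\<bar>2 * u - 1\<bar> * arc_end \<le> 1 * arc_end" by (intro mult_right_mono) auto
  then show ?thesis by (simp add: trefoil_angle_def abs_mult)
qed

lemma trefoil_angle_inj: "trefoil_angle s = trefoil_angle t \<longleftrightarrow> s = t"
  by (metis trefoil_param_angle)

lemma mem_trefoil_over: "t \<in> trefoil_over \<longleftrightarrow> (\<exists>y. trefoil_pair (trefoil_angle t) y)"
  by (auto simp: trefoil_over_def trefoil_pair_def)

context oriented_surface begin

context
  fixes \<gamma> :: "real \<Rightarrow> 'a" and V :: "real \<Rightarrow> 'a" and K :: "real \<Rightarrow> real"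
  assumes smooth: "smooth \<gamma>" and inS: "\<And>t. \<gamma> t \<in> S"
    and inj: "\<And>s t. \<gamma> s = \<gamma> t \<longleftrightarrow> trefoil_curve (trefoil_angle s) = trefoil_curve (trefoil_angle t)"
    and V: "\<And>t. (\<gamma> has_vector_derivative V t) (at t)" "\<And>t. V t \<noteq> 0"
    and K: "\<And>t. K t > 0" "\<And>s t. \<gamma> s = \<gamma> t \<Longrightarrow>
      vol (\<gamma> t) (V s) (V t) = K t * det2 (trefoil_vel (trefoil_angle s)) (trefoil_vel (trefoil_angle t))"
begin

text \<open>In this part \<open>\<gamma>\<close> is the trefoil curve or its image on the sphere. Both cases are covered by two
  properties: the double points are those of the plane curve, and oriented areas are positive multiples of the planar ones.\<close>

lemma trefoil_like_double_point:
  "s \<in> {0..1} \<and> t \<in> {0..1} \<and> s \<noteq> t \<and> \<gamma> s = \<gamma> t \<longleftrightarrow>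
     trefoil_pair (trefoil_angle s) (trefoil_angle t) \<or> trefoil_pair (trefoil_angle t) (trefoil_angle s)"
proof
  assume "s \<in> {0..1} \<and> t \<in> {0..1} \<and> s \<noteq> t \<and> \<gamma> s = \<gamma> t"
  then show "trefoil_pair (trefoil_angle s) (trefoil_angle t) \<or> trefoil_pair (trefoil_angle t) (trefoil_angle s)"
    by (intro trefoil_double_points trefoil_angle_bound) (auto simp: inj trefoil_angle_inj)
next
  have *: "s \<in> {0..1} \<and> t \<in> {0..1} \<and> s \<noteq> t \<and> \<gamma> s = \<gamma> t" if "trefoil_pair (trefoil_angle s) (trefoil_angle t)" for s t
    using trefoil_param_01[of "trefoil_angle s"] trefoil_param_01[of "trefoil_angle t"] trefoil_pair_bound[OF that]
      trefoil_pair_eq[OF that]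
    by (auto simp: trefoil_param_angle inj)
  assume "trefoil_pair (trefoil_angle s) (trefoil_angle t) \<or> trefoil_pair (trefoil_angle t) (trefoil_angle s)"
  then show "s \<in> {0..1} \<and> t \<in> {0..1} \<and> s \<noteq> t \<and> \<gamma> s = \<gamma> t" using *[of s t] *[of t s] by metis
qed

lemma trefoil_like_velocity: "t \<in> {0..1} \<Longrightarrow> velocity \<gamma> t = V t"
  by (rule has_velocity_unique[OF has_vector_derivative_at_within[OF V(1)]])

lemma trefoil_like_sign:
  assumes "trefoil_pair (trefoil_angle s) (trefoil_angle t)"
  shows "vol (\<gamma> t) (V s) (V t) < 0" "vol (\<gamma> s) (V t) (V s) > 0"
proof -
  have eq: "\<gamma> s = \<gamma> t" using trefoil_like_double_point[of s t] assms by blast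
  show "vol (\<gamma> t) (V s) (V t) < 0"
    unfolding K(2)[OF eq] using K(1)[of t] trefoil_pair_negative[OF assms] by (rule mult_pos_neg)
  then show "vol (\<gamma> s) (V t) (V s) > 0" using eq vol_swap[of "\<gamma> t" "V s" "V t"] by simp
qed

lemma trefoil_like_diagram: "knotoid_diagram S (Diagram \<gamma> trefoil_over)"
proof -
  have cp: "crossing_params \<gamma> = {s. \<exists>t. trefoil_pair (trefoil_angle s) (trefoil_angle t) \<or> trefoil_pair (trefoil_angle t) (trefoil_angle s)}"
    unfolding crossing_params_def trefoil_like_double_point[symmetric] by blast
  have fin: "finite (crossing_params \<gamma>)"
  proof (rule finite_subset)
    show "crossing_params \<gamma> \<subseteq> trefoil_param ` {- pi/3 - half_gap, - pi/3 + half_gap, pi/3 - half_gap, pi/3 + half_gap, pi - half_gap, - pi + half_gap}"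
    proof
      fix s assume "s \<in> crossing_params \<gamma>"
      then have "trefoil_angle s \<in> {- pi/3 - half_gap, - pi/3 + half_gap, pi/3 - half_gap, pi/3 + half_gap, pi - half_gap, - pi + half_gap}"
        unfolding cp trefoil_pair_def by blast
      then show "s \<in> trefoil_param ` {- pi/3 - half_gap, - pi/3 + half_gap, pi/3 - half_gap, pi/3 + half_gap, pi - half_gap, - pi + half_gap}"
        by (metis imageI trefoil_param_angle)
    qed
  qed simp
  have open01: "crossing_params \<gamma> \<subseteq> {0<..<1}"
  proof
    fix s assume "s \<in> crossing_params \<gamma>"
    then have "\<bar>trefoil_angle s\<bar> < arc_end" unfolding cp using trefoil_pair_bound by blast
    then show "s \<in> {0<..<1}" using trefoil_param_01 trefoil_param_angle by metis
  qed
  have "generic_immersion S \<gamma>"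
    unfolding generic_immersion_def
  proof (intro conjI ballI impI)
    show "\<gamma> ` {0..1} \<subseteq> S" using inS by blast
    show "smooth_on {0..1} \<gamma>" by (rule smooth_imp_smooth_on[OF smooth])
    show "velocity \<gamma> t \<noteq> 0" if "t \<in> {0..1}" for t using trefoil_like_velocity[OF that] V(2) by simp
    fix s t assume "s \<in> {0..1}" "t \<in> {0..1}" "s \<noteq> t \<and> \<gamma> s = \<gamma> t"
    then have st: "s \<in> {0..1}" "t \<in> {0..1}" and
      p: "trefoil_pair (trefoil_angle s) (trefoil_angle t) \<or> trefoil_pair (trefoil_angle t) (trefoil_angle s)"
      using trefoil_like_double_point[of s t] by blast+
    have "vol (\<gamma> t) (V s) (V t) \<noteq> 0" using p trefoil_like_sign[of s t] trefoil_like_sign[of t s] by force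
    then show "dim {velocity \<gamma> s, velocity \<gamma> t} = 2"
      using trefoil_like_velocity st by (simp add: dim_of_vol_nonzero)
    fix u assume u: "u \<in> {0..1}" "\<gamma> u = \<gamma> s"
    show "u = s \<or> u = t"
    proof (cases "u = s")
      case False
      then have "trefoil_pair (trefoil_angle s) (trefoil_angle u) \<or> trefoil_pair (trefoil_angle u) (trefoil_angle s)"
        using trefoil_like_double_point[of u s] u st by blast
      then have "trefoil_angle u = trefoil_angle t" using p by (rule trefoil_pair_unique)
      then show ?thesis by (simp add: trefoil_angle_inj)
    qed simp
  qed (fact fin open01)+
  moreover have "trefoil_over \<subseteq> crossing_params \<gamma>"
  proof
    fix s assume "s \<in> trefoil_over"
    then obtain y where "trefoil_pair (trefoil_angle s) y" by (auto simp: mem_trefoil_over)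
    then have "trefoil_pair (trefoil_angle s) (trefoil_angle (trefoil_param y))" by simp
    then show "s \<in> crossing_params \<gamma>" unfolding cp by blast
  qed
  moreover have "s \<in> trefoil_over \<longleftrightarrow> t \<notin> trefoil_over" if "s \<in> {0..1}" "t \<in> {0..1}" "s \<noteq> t \<and> \<gamma> s = \<gamma> t" for s t
    using trefoil_like_double_point[of s t] that trefoil_pair_asym unfolding mem_trefoil_over by blast
  ultimately show ?thesis unfolding knotoid_diagram_def diagram.sel by (intro conjI ballI impI)
qed

lemma trefoil_like_chiral: "chiral S (knotoid S (Diagram \<gamma> trefoil_over))"
proof -
  interpret surface_quandle S vol cross_under
    by (intro surface_quandle.intro oriented_surface_axioms quandle_cross_under)
  define D where "D = Diagram \<gamma> trefoil_over"
  have D: "knotoid_diagram S D" unfolding D_def by (rule trefoil_like_diagram)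
  note M = knotoid_diagram_mirror[OF D]
  have crD: "crosses D s t \<longleftrightarrow> trefoil_pair (trefoil_angle s) (trefoil_angle t) \<or> trefoil_pair (trefoil_angle t) (trefoil_angle s)" for s t
    using trefoil_like_double_point[of s t] by (simp add: crosses_def D_def)
  have crM: "crosses (mirror D) s t \<longleftrightarrow> crosses D s t" for s t by (simp add: crosses_def mirror_def)
  have overD: "s \<in> over D \<longleftrightarrow> trefoil_pair (trefoil_angle s) (trefoil_angle t)" if "crosses D s t" for s t
  proof -
    have "s \<in> over D \<longleftrightarrow> (\<exists>y. trefoil_pair (trefoil_angle s) y)" by (simp add: D_def mem_trefoil_over)
    then show ?thesis using that trefoil_pair_asym unfolding crD by blast
  qed
  have overM: "s \<in> over (mirror D) \<longleftrightarrow> s \<notin> over D" if "crosses D s t" for s t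
    using that by (auto simp: mirror_def crosses_def crossing_params_def)
  have vel: "vel D t = V t" "vel (mirror D) t = V t" if "t \<in> {0..1}" for t
    using trefoil_like_velocity[OF that] by (simp_all add: D_def mirror_def)
  have gD: "gauss D t = Some (e, s) \<longleftrightarrow> trefoil_pair (trefoil_angle s) (trefoil_angle t) \<and> \<not> e" for s t e
  proof -
    have "\<not> crossing_sign D s t" if "trefoil_pair (trefoil_angle s) (trefoil_angle t)"
      using trefoil_like_sign(1)[OF that] trefoil_like_double_point[of s t] that vel[of s] vel[of t]
      by (simp add: crossing_sign_def D_def)
    then show ?thesis unfolding gauss_eq_Some[OF D] using overD[of s t] crD[of s t] by blast
  qed
  have gM: "gauss (mirror D) t = Some (e, s) \<longleftrightarrow> trefoil_pair (trefoil_angle t) (trefoil_angle s) \<and> e" for s t e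
  proof -
    have "crossing_sign (mirror D) s t" if "trefoil_pair (trefoil_angle t) (trefoil_angle s)"
      using trefoil_like_sign(2)[OF that] trefoil_like_double_point[of s t] that vel[of s] vel[of t]
      by (simp add: crossing_sign_def D_def mirror_def)
    moreover have "trefoil_pair (trefoil_angle t) (trefoil_angle s) \<longleftrightarrow> crosses D s t \<and> s \<in> over (mirror D)"
      using overD[of s t] overM[of s t] crD[of s t] trefoil_pair_asym by blast
    ultimately show ?thesis unfolding gauss_eq_Some[OF M] crM by blast
  qed
  define o1 o2 o3 u1 u2 u3 where "o1 = trefoil_param (- pi/3 - half_gap)" and "o2 = trefoil_param (pi/3 - half_gap)" and "o3 = trefoil_param (pi - half_gap)"
    and "u1 = trefoil_param (- pi/3 + half_gap)" and "u2 = trefoil_param (pi/3 + half_gap)" and "u3 = trefoil_param (- pi + half_gap)"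
  note defs = o1_def o2_def o3_def u1_def u2_def u3_def
  have ord: "0 < o1" "o1 < u3" "u3 < o2" "o2 < u1" "u1 < o3" "o3 < u2" "u2 < 1"
    using trefoil_order[THEN trefoil_param_less] unfolding defs trefoil_param_ends by blast+
  have pair: "trefoil_pair (trefoil_angle s) (trefoil_angle t) \<longleftrightarrow> s = o1 \<and> t = u1 \<or> s = o2 \<and> t = u2 \<or> s = o3 \<and> t = u3" for s t
  proof -
    have "trefoil_angle s = \<theta> \<longleftrightarrow> s = trefoil_param \<theta>" for s \<theta> by (metis trefoil_angle_param trefoil_param_angle)
    then show ?thesis unfolding trefoil_pair_def defs by blast
  qed
  have "colorable (gauss D) base_color longitude_color"
  proof (rule trefoil_colorable[OF ord])
    show "gauss D u1 = Some (False, o1)" "gauss D u2 = Some (False, o2)" "gauss D u3 = Some (False, o3)"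
      unfolding gD pair by auto
    show "gauss D t = None" if "t \<notin> {u1, u2, u3}" for t
      using gD[of t] pair[of _ t] that by (cases "gauss D t") auto
  qed (fact negative_trefoil_colors[symmetric])+
  moreover have "\<not> colorable (gauss (mirror D)) base_color longitude_color"
  proof
    assume col: "colorable (gauss (mirror D)) base_color longitude_color"
    have g: "gauss (mirror D) o1 = Some (True, u1)" "gauss (mirror D) o2 = Some (True, u2)" "gauss (mirror D) o3 = Some (True, u3)"
      unfolding gM pair by auto
    have gN: "gauss (mirror D) t = None" if "t \<notin> {o1, o2, o3}" for t
      using gM[of t] pair[of t] that by (cases "gauss (mirror D) t") auto
    obtain c1 c2 where "c1 = cross_under True base_color c2" "c2 = cross_under True c1 longitude_color"
      "longitude_color = cross_under True c2 c1"
      using mirror_trefoil_colorableD[OF ord g gN col] by blast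
    then show False by (rule positive_trefoil_no_colors)
  qed
  ultimately have "\<not> diagram_equiv S D (mirror D)" using diagram_equiv_colorable by blast
  moreover have refl: "F \<in> knotoid S F" for F by (simp add: knotoid_def diagram_equiv_def)
  ultimately have "mir S (knotoid S D) \<noteq> knotoid S D"
    unfolding mir_def using refl[of D] refl[of "mirror D"] by (auto simp: knotoid_def)
  then show ?thesis using D unfolding D_def[symmetric] chiral_def knotoids_def by blast
qed

end
end

lemma has_vector_derivative_vec:
  fixes f :: "real \<Rightarrow> real ^ 'n"
  assumes "\<And>i. ((\<lambda>t. f t $ i) has_real_derivative v $ i) F"
  shows "(f has_vector_derivative v) F"
proof -
  have "((\<lambda>t. \<Sum>i\<in>UNIV. (f t $ i) *\<^sub>R (axis i 1 :: real ^ 'n)) has_vector_derivative (\<Sum>i\<in>UNIV. (v $ i) *\<^sub>R axis i 1)) F"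
    by (intro has_vector_derivative_sum bounded_linear.has_vector_derivative[OF bounded_linear_scaleR_left])
       (simp add: assms has_real_derivative_iff_has_vector_derivative[symmetric])
  moreover have "(\<Sum>i\<in>UNIV. (w $ i) *\<^sub>R axis i 1) = w" for w :: "real ^ 'n"
    using basis_expansion[of w] by (simp add: scalar_mult_eq_scaleR)
  ultimately show ?thesis by (simp only:)
qed

definition plane_vol :: "real^2 \<Rightarrow> real^2 \<Rightarrow> real^2 \<Rightarrow> real" where
  "plane_vol x v w = v $ 1 * w $ 2 - v $ 2 * w $ 1"

interpretation plane: oriented_surface UNIV plane_vol
proof
  show "continuous_on UNIV (\<lambda>(x, v, w). plane_vol x v w)"
    unfolding plane_vol_def case_prod_beta by (intro continuous_intros)
  show "plane_vol x (a *\<^sub>R u + b *\<^sub>R v) w = a * plane_vol x u w + b * plane_vol x v w" for x a u b v w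
    by (simp add: plane_vol_def algebra_simps)
  show "plane_vol x w v = - plane_vol x v w" for x v w by (simp add: plane_vol_def)
  fix x v w :: "real^2" assume ind: "indep2 v w"
  show "plane_vol x v w \<noteq> 0"
  proof
    assume 0: "plane_vol x v w = 0"
    then have "(w $ 2) *\<^sub>R v + (- v $ 2) *\<^sub>R w = 0" "(w $ 1) *\<^sub>R v + (- v $ 1) *\<^sub>R w = 0"
      by (auto simp: vec_eq_iff forall_2 plane_vol_def algebra_simps)
    then have "v $ 2 = 0" "v $ 1 = 0" using ind unfolding indep2_def by fastforce+
    then have "v = 0" by (simp add: vec_eq_iff forall_2)
    then have "1 *\<^sub>R v + 0 *\<^sub>R w = 0" by simp
    then show False using ind unfolding indep2_def by fastforce
  qed
qed

definition sphere_vol :: "real^3 \<Rightarrow> real^3 \<Rightarrow> real^3 \<Rightarrow> real" where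
  "sphere_vol x v w = x $ 1 * (v $ 2 * w $ 3 - v $ 3 * w $ 2) + x $ 2 * (v $ 3 * w $ 1 - v $ 1 * w $ 3) + x $ 3 * (v $ 1 * w $ 2 - v $ 2 * w $ 1)"

text \<open>Curves on the sphere have constant norm; differentiate it.\<close>

lemma tangent_sphere:
  fixes x v :: "real^3"
  assumes "tangent (sphere 0 1) x v" shows "x \<bullet> v = 0"
proof -
  obtain f t where f: "f t = x" "(f has_vector_derivative v) (at t)" "\<forall>\<^sub>F r in nhds t. f r \<in> sphere 0 1"
    using assms by (auto simp: tangent_def)
  have 1: "((\<lambda>r. f r \<bullet> f r) has_derivative (\<lambda>h. f t \<bullet> (h *\<^sub>R v) + (h *\<^sub>R v) \<bullet> f t)) (at t)"
    using f(2) unfolding has_vector_derivative_def by (intro has_derivative_inner)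
  have "((\<lambda>r. f r \<bullet> f r) has_derivative (\<lambda>h. 0)) (at t)"
  proof (rule has_derivative_transform_eventually[OF has_derivative_const[of 1]])
    show "\<forall>\<^sub>F r in at t. 1 = f r \<bullet> f r"
      using f(3) by (auto simp: eventually_at_filter dot_square_norm elim: eventually_mono)
    show "1 = f t \<bullet> f t" using eventually_nhds_x_imp_x[OF f(3)] by (simp add: dot_square_norm)
  qed simp
  from has_derivative_unique[OF this 1] have "0 = f t \<bullet> (1 *\<^sub>R v) + (1 *\<^sub>R v) \<bullet> f t" by (rule fun_cong)
  then show ?thesis using f(1) by (simp add: inner_commute)
qed

interpretation sphere: oriented_surface "sphere 0 1" sphere_vol
proof
  show "continuous_on UNIV (\<lambda>(x, v, w). sphere_vol x v w)"
    unfolding sphere_vol_def case_prod_beta by (intro continuous_intros)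
  show "sphere_vol x (a *\<^sub>R u + b *\<^sub>R v) w = a * sphere_vol x u w + b * sphere_vol x v w" for x a u b v w
    by (simp add: sphere_vol_def algebra_simps)
  show "sphere_vol x w v = - sphere_vol x v w" for x v w by (simp add: sphere_vol_def algebra_simps)
  fix x v w :: "real^3" assume x: "x \<in> sphere 0 1" and t: "tangent (sphere 0 1) x v" "tangent (sphere 0 1) x w" and ind: "indep2 v w"
  show "sphere_vol x v w \<noteq> 0"
  proof
    assume 0: "sphere_vol x v w = 0"
    have dot: "a \<bullet> b = a $ 1 * b $ 1 + a $ 2 * b $ 2 + a $ 3 * b $ 3" for a b :: "real^3"
      by (simp add: inner_vec_def sum_3)
    have xx: "x $ 1 * x $ 1 + x $ 2 * x $ 2 + x $ 3 * x $ 3 = 1" using x by (simp add: dot[symmetric] dot_square_norm)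
    note xv = tangent_sphere[OF t(1), unfolded dot] and xw = tangent_sphere[OF t(2), unfolded dot]
    \<comment> \<open>the vector product of \<open>v\<close> and \<open>w\<close> is parallel to \<open>x\<close> and orthogonal to \<open>x\<close>, hence zero\<close>
    have c: "v $ 2 * w $ 3 - v $ 3 * w $ 2 = 0" "v $ 3 * w $ 1 - v $ 1 * w $ 3 = 0" "v $ 1 * w $ 2 - v $ 2 * w $ 1 = 0"
      using 0[unfolded sphere_vol_def] xx xv xw by algebra+
    have "(w $ i) *\<^sub>R v + (- v $ i) *\<^sub>R w = 0" for i
      using c exhaust_3[of i] by (auto simp: vec_eq_iff forall_3 algebra_simps)
    then have "v $ i = 0" for i using ind unfolding indep2_def by fastforce
    then have "v = 0" by (simp add: vec_eq_iff)
    then have "1 *\<^sub>R v + 0 *\<^sub>R w = 0" by simp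
    then show False using ind unfolding indep2_def by fastforce
  qed
qed

definition tx :: "real \<Rightarrow> real" where "tx t = trefoil_curve (trefoil_angle t) $ 1"
definition ty :: "real \<Rightarrow> real" where "ty t = trefoil_curve (trefoil_angle t) $ 2"
definition tx' :: "real \<Rightarrow> real" where "tx' t = 2 * arc_end * fst (trefoil_vel (trefoil_angle t))"
definition ty' :: "real \<Rightarrow> real" where "ty' t = 2 * arc_end * snd (trefoil_vel (trefoil_angle t))"

lemma txy_smooth: "smooth tx" "smooth ty"
proof -
  have A: "trefoil_angle t = (2 * arc_end) * t + (- arc_end)" "2 * trefoil_angle t = (4 * arc_end) * t + (- 2 * arc_end)" for t
  proof -
    have "(2 * t - 1) * w = (2 * w) * t + (- w)" "2 * ((2 * t - 1) * w) = (4 * w) * t + (- 2 * w)" for w :: real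
      by (simp_all add: algebra_simps)
    from this[of arc_end] show "trefoil_angle t = (2 * arc_end) * t + (- arc_end)" "2 * trefoil_angle t = (4 * arc_end) * t + (- 2 * arc_end)"
      unfolding trefoil_angle_def .
  qed
  have "tx = (\<lambda>t. sin ((2 * arc_end) * t + (- arc_end)) + 2 * sin ((4 * arc_end) * t + (- 2 * arc_end)))"
    unfolding tx_def[abs_def] trefoil_curve_def A(2) unfolding A(1) vector_2 ..
  then show "smooth tx" by (rule ssubst) (intro smooth_add smooth_sin smooth_mult smooth_const)
  have "ty = (\<lambda>t. cos ((2 * arc_end) * t + (- arc_end)) + (- 2) * cos ((4 * arc_end) * t + (- 2 * arc_end)))"
    unfolding ty_def[abs_def] trefoil_curve_def A(2) unfolding A(1) vector_2 diff_conv_add_uminus mult_minus_left ..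
  then show "smooth ty" by (rule ssubst) (intro smooth_add smooth_cos smooth_mult smooth_const)
qed

lemma txy_deriv: "(tx has_real_derivative tx' t) (at t)" "(ty has_real_derivative ty' t) (at t)"
proof -
  have A: "(trefoil_angle has_real_derivative 2 * arc_end) (at t)"
    unfolding trefoil_angle_def[abs_def] by (auto intro!: derivative_eq_intros)
  show "(tx has_real_derivative tx' t) (at t)"
    unfolding tx_def[abs_def] tx'_def trefoil_curve_def trefoil_vel_def
    by (auto intro!: derivative_eq_intros A simp: algebra_simps)
  show "(ty has_real_derivative ty' t) (at t)"
    unfolding ty_def[abs_def] ty'_def trefoil_curve_def trefoil_vel_def
    by (auto intro!: derivative_eq_intros A simp: algebra_simps)
qed

lemma txy_vel_nonzero: "tx' t \<noteq> 0 \<or> ty' t \<noteq> 0"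
  using trefoil_vel_nonzero[of "trefoil_angle t"] by (auto simp: tx'_def ty'_def)

lemma txy_det: "tx' s * ty' t - ty' s * tx' t = (2 * arc_end)\<^sup>2 * det2 (trefoil_vel (trefoil_angle s)) (trefoil_vel (trefoil_angle t))"
  by (simp add: tx'_def ty'_def det2_def power2_eq_square algebra_simps)

lemma trefoil_plane_chiral: "chiral UNIV (knotoid UNIV trefoil_plane)"
proof -
  define \<gamma> where "\<gamma> = trefoil_curve \<circ> trefoil_angle"
  define V where "V = (\<lambda>t. vector [tx' t, ty' t] :: real^2)"
  have c: "\<gamma> t $ 1 = tx t" "\<gamma> t $ 2 = ty t" for t by (simp_all add: \<gamma>_def tx_def ty_def)
  have "chiral UNIV (knotoid UNIV (Diagram \<gamma> trefoil_over))"
  proof (rule plane.trefoil_like_chiral)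
    show "smooth \<gamma>"
    proof (rule smooth_vec)
      show "smooth (\<lambda>t. \<gamma> t $ i)" for i using txy_smooth exhaust_2[of i] by (auto simp: c cong: if_cong)
    qed
    show "\<gamma> s = \<gamma> t \<longleftrightarrow> trefoil_curve (trefoil_angle s) = trefoil_curve (trefoil_angle t)" for s t
      by (simp add: \<gamma>_def)
    show "(\<gamma> has_vector_derivative V t) (at t)" for t
    proof (rule has_vector_derivative_vec)
      show "((\<lambda>t. \<gamma> t $ i) has_real_derivative V t $ i) (at t)" for i
        using txy_deriv exhaust_2[of i] by (auto simp: c V_def)
    qed
    show "V t \<noteq> 0" for t using txy_vel_nonzero[of t] by (auto simp: V_def vec_eq_iff forall_2)
    show "0 < (2 * arc_end)\<^sup>2" by simp
    show "plane_vol (\<gamma> t) (V s) (V t) = (2 * arc_end)\<^sup>2 * det2 (trefoil_vel (trefoil_angle s)) (trefoil_vel (trefoil_angle t))" for s t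
      unfolding txy_det[symmetric] by (simp add: plane_vol_def V_def)
  qed simp
  then show ?thesis by (simp add: trefoil_plane_def \<gamma>_def)
qed

text \<open>Stereographic projection is conformal and orientation preserving: it multiplies oriented areas by \<open>4 / N\<^sup>2\<close>, where
  \<open>N = 1 + x\<^sup>2 + y\<^sup>2\<close>.\<close>

lemma trefoil_sphere_chiral: "chiral (sphere 0 1) (knotoid (sphere 0 1) trefoil_sphere)"
proof -
  define \<gamma> where "\<gamma> = plane_to_sphere \<circ> (trefoil_curve \<circ> trefoil_angle)"
  define N where "N = (\<lambda>t. 1 + (tx t * tx t + ty t * ty t))"
  define N' where "N' = (\<lambda>t. 2 * (tx t * tx' t + ty t * ty' t))"
  have N: "N t > 0" for t by (simp add: N_def add_pos_nonneg)
  have nrm: "(norm (trefoil_curve (trefoil_angle t)))\<^sup>2 = tx t * tx t + ty t * ty t" for t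
    by (simp add: norm_vec_def L2_set_def sum_2 tx_def ty_def power2_eq_square)
  have c: "\<gamma> t $ 1 = 2 * tx t * inverse (N t)" "\<gamma> t $ 2 = 2 * ty t * inverse (N t)" "\<gamma> t $ 3 = 2 * inverse (N t) + (- 1)" for t
    using N[of t] by (simp_all add: \<gamma>_def plane_to_sphere_def nrm N_def tx_def[symmetric] ty_def[symmetric] field_simps)
  define V where "V = (\<lambda>t. vector [2 * tx' t / N t - 2 * tx t * N' t / (N t)\<^sup>2,
      2 * ty' t / N t - 2 * ty t * N' t / (N t)\<^sup>2, - 2 * N' t / (N t)\<^sup>2] :: real^3)"
  have dN: "(N has_real_derivative N' t) (at t)" for t
    unfolding N_def N'_def by (auto intro!: derivative_eq_intros txy_deriv)
  have eqN: "N s = N t \<and> tx s = tx t \<and> ty s = ty t" if "\<gamma> s = \<gamma> t" for s t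
  proof -
    have "inverse (N s) = inverse (N t)" using arg_cong[OF that, of "\<lambda>z. z $ 3"] unfolding c by simp
    moreover have "2 * tx s * inverse (N s) = 2 * tx t * inverse (N t)" "2 * ty s * inverse (N s) = 2 * ty t * inverse (N t)"
      using that by (metis c)+
    ultimately show ?thesis using N[of s] N[of t] by auto
  qed
  have "chiral (sphere 0 1) (knotoid (sphere 0 1) (Diagram \<gamma> trefoil_over))"
  proof (rule sphere.trefoil_like_chiral)
    show "smooth \<gamma>"
    proof (rule smooth_vec)
      have "smooth N" unfolding N_def by (intro smooth_add smooth_mult smooth_const txy_smooth)
      then have "smooth (\<lambda>t. inverse (N t))" using N by (intro smooth_inverse) (auto simp: less_le)
      then have "smooth (\<lambda>t. \<gamma> t $ 1)" "smooth (\<lambda>t. \<gamma> t $ 2)" "smooth (\<lambda>t. \<gamma> t $ 3)"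
        unfolding c by (intro smooth_add smooth_mult smooth_const txy_smooth; assumption)+
      then show "smooth (\<lambda>t. \<gamma> t $ i)" for i using exhaust_3[of i] by auto
    qed
    show "\<gamma> t \<in> sphere 0 1" for t
    proof -
      have *: "(tx t * tx t + ty t * ty t) = N t - 1" by (simp add: N_def)
      have "(norm (\<gamma> t))\<^sup>2 = (\<gamma> t $ 1)\<^sup>2 + (\<gamma> t $ 2)\<^sup>2 + (\<gamma> t $ 3)\<^sup>2"
        by (simp add: norm_vec_def L2_set_def sum_3)
      also have "\<dots> = 4 * (tx t * tx t + ty t * ty t) * (inverse (N t))\<^sup>2 + (2 * inverse (N t) + (- 1))\<^sup>2"
        unfolding c by (simp add: power2_eq_square algebra_simps)
      also have "\<dots> = 1" unfolding * using N[of t] by (simp add: power2_eq_square field_simps)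
      finally have "norm (\<gamma> t) = 1" by (simp add: power2_eq_1_iff) (metis norm_ge_zero neg_0_le_iff_le not_one_le_zero)
      then show ?thesis by simp
    qed
    show "\<gamma> s = \<gamma> t \<longleftrightarrow> trefoil_curve (trefoil_angle s) = trefoil_curve (trefoil_angle t)" for s t
    proof
      assume "\<gamma> s = \<gamma> t"
      then show "trefoil_curve (trefoil_angle s) = trefoil_curve (trefoil_angle t)"
        using eqN by (auto simp: vec_eq_iff forall_2 tx_def ty_def)
    qed (simp add: \<gamma>_def)
    show "(\<gamma> has_vector_derivative V t) (at t)" for t
    proof (rule has_vector_derivative_vec)
      have "((\<lambda>t. \<gamma> t $ 1) has_real_derivative V t $ 1) (at t)" "((\<lambda>t. \<gamma> t $ 2) has_real_derivative V t $ 2) (at t)"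
        "((\<lambda>t. \<gamma> t $ 3) has_real_derivative V t $ 3) (at t)"
        unfolding c V_def using N[of t]
        by (auto intro!: derivative_eq_intros txy_deriv dN simp: field_simps power2_eq_square)
      then show "((\<lambda>t. \<gamma> t $ i) has_real_derivative V t $ i) (at t)" for i using exhaust_3[of i] by auto
    qed
    show "V t \<noteq> 0" for t
    proof
      assume "V t = 0"
      then have "N' t = 0" "2 * tx' t / N t - 2 * tx t * N' t / (N t)\<^sup>2 = 0" "2 * ty' t / N t - 2 * ty t * N' t / (N t)\<^sup>2 = 0"
        using N[of t] by (auto simp: V_def vec_eq_iff forall_3)
      then have "tx' t = 0" "ty' t = 0" using N[of t] by auto
      then show False using txy_vel_nonzero[of t] by simp
    qed
    show "0 < 4 * (2 * arc_end)\<^sup>2 / (N t)\<^sup>2" for t using N[of t] by simp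
    fix s t assume eq: "\<gamma> s = \<gamma> t"
    define n where "n = inverse (N t)"
    have n: "n * N t = 1" "1 + (tx t * tx t + ty t * ty t) = N t" using N[of t] by (simp_all add: n_def N_def)
    have vs: "V s $ 1 = 2 * tx' s * n - 2 * tx t * (2 * (tx t * tx' s + ty t * ty' s)) * n\<^sup>2"
       "V s $ 2 = 2 * ty' s * n - 2 * ty t * (2 * (tx t * tx' s + ty t * ty' s)) * n\<^sup>2"
       "V s $ 3 = - 2 * (2 * (tx t * tx' s + ty t * ty' s)) * n\<^sup>2"
      if "\<gamma> s = \<gamma> t" for s
      using eqN[OF that] by (simp_all add: V_def N'_def n_def divide_inverse power_inverse)
    have "sphere_vol (\<gamma> t) (V s) (V t) = 4 * n\<^sup>2 * (tx' s * ty' t - ty' s * tx' t)"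
      unfolding sphere_vol_def vs[OF eq] vs[OF refl] c n_def[symmetric] using n by algebra
    also have "\<dots> = 4 * (1 / (N t)\<^sup>2) * ((2 * arc_end)\<^sup>2 * det2 (trefoil_vel (trefoil_angle s)) (trefoil_vel (trefoil_angle t)))"
      unfolding txy_det n_def by (simp only: inverse_eq_divide power_one_over)
    also have "4 * (1 / M) * (W * d) = 4 * W / M * d" for M W d :: real by simp
    finally show "sphere_vol (\<gamma> t) (V s) (V t) =
        4 * (2 * arc_end)\<^sup>2 / (N t)\<^sup>2 * det2 (trefoil_vel (trefoil_angle s)) (trefoil_vel (trefoil_angle t))" .
  qed
  then show ?thesis by (simp add: trefoil_sphere_def trefoil_plane_def \<gamma>_def)
qed

theorem theorem5p1:
  shows "chiral (UNIV :: (real^2) set) (knotoid UNIV trefoil_plane) \<and>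
         chiral (sphere 0 1 :: (real^3) set) (knotoid (sphere 0 1) trefoil_sphere)"
  using trefoil_plane_chiral trefoil_sphere_chiral by blast

end
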